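(* Assume (A1) and (A2). Let $g>0$ and let $(\lambda_n)$ be a sequence with $\lambda_n\to\infty$, $n^{-1/2}\lambda_n\to 0$ and $n^{(g-1)/2}\lambda_n\to\infty$ as $n\to\infty$. Then the adaptive LASSO quantile estimator $\hat\phi^*_n$ satisfies the oracle properties: (i) $\sqrt n\,(\hat\phi^*_{\mathcal A^0}-\phi^0_{\mathcal A^0})$ converges in distribution, as $n\to\infty$, to $\mathcal N\left(\mathbf 0,\ \frac{\tau(1-\tau)}{f^2(b^0)}\Upsilon_{\mathcal A^0}^{-1}\right)$, where $\Upsilon_{\mathcal A^0}=(v_{ij})_{i,j\in\mathcal A^0}$. (ii) If moreover $n^{g/2-1}\lambda_n\to\infty$, then $\mathbb P[\hat{\mathcal A}^*_n=\mathcal A^0]\to 1$ as $n\to\infty$.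
   Context: Model: $Y_i=X_i^t\phi^0+\varepsilon_i$, $i=1,\dots,n$, with deterministic regressors $X_i=(X_{i1},\dots,X_{ip})\in\mathbb R^p$, $p$ fixed. Fix $\tau\in(0,1)$. The errors $\varepsilon_i$ are i.i.d. with distribution function $F$, and $b^0$ is the (unknown) $\tau$-th quantile: $F(b^0)=\tau$. They have a continuous positive density $f$ in a neighborhood of $b^0$. No moment condition is imposed on the errors. Parameters $(b,\phi)$ lie in $\mathcal B\times\Gamma$ with $\mathcal B\subseteq\mathbb R$, $\Gamma\subseteq\mathbb R^p$ compact, and the true values $b^0,\phi^0$ are interior points. Check function: $\rho_\tau(r)=r[\tau\mathbf 1_{r>0}-(1-\tau)\mathbf 1_{r\le 0}]$. Assumption (A1): $n^{-1}\max_{1\le i\le n}X_i^tX_i\to 0$ and $n^{-1}\sum_{i=1}^nX_iX_i^t\to\Upsilon=(v_{ij})_{1\le i,j\le p}$ as $n\to\infty$, with $\Upsilon$ positive definite. Assumption (A2): for every $e\in\mathrm{int}(\mathcal B)$, $u_0\in\mathbb R$, $u\in\mathbb R^p$, $$\lim_{n\to\infty}n^{-1}\sum_{i=1}^n\int_0^{u_0+X_i^tu}\sqrt n\,[F(e+v/\sqrt n)-F(e)]\,dv=\tfrac12 f(e)\,(u_0,u^t)\begin{pmatrix}1&\mathbf 0\\ \mathbf 0&\Upsilon\end{pmatrix}(u_0,u^t)^t.$$ Quantile estimator: $(\hat b_n,\hat\phi_n)=\arg\min_{(b,\phi)}\sum_{i=1}^n\rho_\tau(Y_i-b-X_i^t\phi)$,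 with $\hat\phi_n=(\hat\phi_{n,1},\dots,\hat\phi_{n,p})$. Adaptive LASSO quantile estimator: $$(\hat b^*_n,\hat\phi^*_n)=\arg\min_{(b,\phi)}\Big(\sum_{i=1}^n\rho_\tau(Y_i-b-X_i^t\phi)+\lambda_n\sum_{j=1}^p\hat\omega_{n,j}|\phi_{,j}|\Big),\qquad \hat\omega_{n,j}=|\hat\phi_{n,j}|^{-g},$$ with $\lambda_n>0$. Index sets: $\mathcal A^0=\{j:\phi^0_{,j}\ne0\}$ and $\hat{\mathcal A}^*_n=\{j:\hat\phi^*_{n,j}\neq0\}$. For a vector $\phi$, $\phi_{\mathcal A^0}$ is the sub-vector of components with index in $\mathcal A^0$; $\hat\phi^*_{\mathcal A^0}$ is the corresponding sub-vector of $\hat\phi^*_n$. *)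

theory Defs
  imports "HOL-Probability.Probability"
begin

definition check_loss :: "real \<Rightarrow> real \<Rightarrow> real" where
  "check_loss \<tau> r = r * (\<tau> * indicator {0<..} r - (1 - \<tau>) * indicator {..0} r)"

definition quantile_objective ::
    "real \<Rightarrow> (nat \<Rightarrow> real ^ 'p) \<Rightarrow> (nat \<Rightarrow> real) \<Rightarrow> nat \<Rightarrow> real \<times> (real ^ 'p::finite) \<Rightarrow> real" where
  "quantile_objective \<tau> X y n = (\<lambda>(b, \<phi>). \<Sum>i=1..n. check_loss \<tau> (y i - b - X i \<bullet> \<phi>))"

(* The weight |x|^(-g) for g > 0, extended-real valued because a coordinate of the
   preliminary estimator may vanish: since inverse (0::ereal) = \<infinity>, the weight is \<infinity> at
   x = 0. *)
definition adaptive_weight :: "real \<Rightarrow> real \<Rightarrow> ereal" where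
  "adaptive_weight g x = inverse (ereal (\<bar>x\<bar> powr g))"

(* As \<infinity> * 0 = 0 in ereal, a coordinate with weight \<infinity> contributes 0 to the penalty if it
   is 0, and \<infinity> otherwise. *)
definition adaptive_lasso_objective ::
    "real \<Rightarrow> real \<Rightarrow> real \<Rightarrow> (nat \<Rightarrow> real ^ 'p) \<Rightarrow> (nat \<Rightarrow> real) \<Rightarrow> real ^ 'p \<Rightarrow> nat
      \<Rightarrow> real \<times> (real ^ 'p::finite) \<Rightarrow> ereal" where
  "adaptive_lasso_objective \<tau> g l X y \<psi> n = (\<lambda>(b, \<phi>).
     ereal (quantile_objective \<tau> X y n (b, \<phi>))
       + ereal l * (\<Sum>j\<in>UNIV. adaptive_weight g (\<psi> $ j) * ereal \<bar>\<phi> $ j\<bar>))"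

(* Only the restriction of D to a neighbourhood of x0 is required to have a density;
   D may have atoms or a singular part elsewhere. *)
definition continuous_positive_density_near ::
    "real measure \<Rightarrow> (real \<Rightarrow> real) \<Rightarrow> real \<Rightarrow> bool" where
  "continuous_positive_density_near D f x0 \<longleftrightarrow>
     (\<exists>U. open U \<and> x0 \<in> U \<and> continuous_on U f \<and> (\<forall>x\<in>U. 0 < f x) \<and>
        (\<forall>A\<in>sets borel. A \<subseteq> U \<longrightarrow> emeasure D A = (\<integral>\<^sup>+x\<in>A. ennreal (f x) \<partial>lborel)))"

definition positive_definite :: "real ^ 'n ^ 'n::finite \<Rightarrow> bool" where
  "positive_definite S \<longleftrightarrow> transpose S = S \<and> (\<forall>x. x \<noteq> 0 \<longrightarrow> 0 < x \<bullet> (S *v x))"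

definition outer_prod :: "real ^ 'n \<Rightarrow> real ^ 'm \<Rightarrow> real ^ 'm ^ 'n" where
  "outer_prod x y = (\<chi> i j. x $ i * y $ j)"

definition design_assumption :: "(nat \<Rightarrow> real ^ 'p) \<Rightarrow> real ^ 'p ^ 'p::finite \<Rightarrow> bool" where
  "design_assumption X \<Upsilon> \<longleftrightarrow>
     (\<lambda>n. (MAX i\<in>{1..n}. X i \<bullet> X i) / real n) \<longlonglongrightarrow> 0 \<and>
     (\<lambda>n. (1 / real n) *\<^sub>R (\<Sum>i=1..n. outer_prod (X i) (X i))) \<longlonglongrightarrow> \<Upsilon> \<and>
     positive_definite \<Upsilon>"

(* The integral is oriented, so the upper limit may be negative. The right-hand side is the
   quadratic form of the block matrix diag(1, \<Upsilon>) at (u0, u). *)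
definition smoothness_assumption ::
    "(nat \<Rightarrow> real ^ 'p) \<Rightarrow> real ^ 'p ^ 'p::finite \<Rightarrow> (real \<Rightarrow> real) \<Rightarrow> (real \<Rightarrow> real) \<Rightarrow> real set
      \<Rightarrow> bool" where
  "smoothness_assumption X \<Upsilon> F f B \<longleftrightarrow>
     (\<forall>e\<in>interior B. \<forall>u0 u.
        (\<lambda>n. (1 / real n) * (\<Sum>i=1..n.
            LBINT v=0..ereal (u0 + X i \<bullet> u). sqrt (real n) * (F (e + v / sqrt (real n)) - F e)))
        \<longlonglongrightarrow> 1 / 2 * f e * (u0\<^sup>2 + u \<bullet> (\<Upsilon> *v u)))"

(* Sub-vectors and principal submatrices for an index set A are taken along a bijection \<iota>
   from a finite type onto A. *)
definition subvector :: "('a \<Rightarrow> 'p) \<Rightarrow> real ^ 'p \<Rightarrow> real ^ 'a" where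
  "subvector \<iota> v = (\<chi> a. v $ \<iota> a)"

definition principal_submatrix :: "('a \<Rightarrow> 'p) \<Rightarrow> real ^ 'p ^ 'p \<Rightarrow> real ^ 'a ^ 'a" where
  "principal_submatrix \<iota> S = (\<chi> a b. S $ \<iota> a $ \<iota> b)"

(* The law N(m, S), for positive definite S. *)
definition multivariate_normal :: "real ^ 'a \<Rightarrow> real ^ 'a ^ 'a::finite \<Rightarrow> (real ^ 'a) measure" where
  "multivariate_normal m S = density lborel (\<lambda>x. ennreal
     (exp (- ((x - m) \<bullet> (matrix_inv S *v (x - m))) / 2) / sqrt ((2 * pi) ^ CARD('a) * det S)))"

definition converges_in_distribution ::
    "'w measure \<Rightarrow> (nat \<Rightarrow> 'w \<Rightarrow> 'b::topological_space) \<Rightarrow> 'b measure \<Rightarrow> bool" where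
  "converges_in_distribution M Z N \<longleftrightarrow>
     (\<forall>h :: 'b \<Rightarrow> real. continuous_on UNIV h \<and> bounded (range h) \<longrightarrow>
        (\<lambda>n. \<integral>\<omega>. h (Z n \<omega>) \<partial>M) \<longlonglongrightarrow> (\<integral>x. h x \<partial>N))"

definition support_set :: "real ^ 'p \<Rightarrow> 'p set" where
  "support_set \<phi> = {j. \<phi> $ j \<noteq> 0}"

end

theory Submission imports Defs begin

text \<open>
  Write \<open>u = sqrt n *\<^sub>R (\<theta> - \<theta>0)\<close> for a parameter \<open>\<theta> = (b, \<phi>)\<close> in local coordinates around the truth \<open>\<theta>0\<close>. By
  Knight's identity the loss at \<open>\<theta>\<close> minus the loss at \<open>\<theta>0\<close> is a linear term \<open>- score \<bullet> u\<close> plus a nonnegative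
  remainder. The expectation of the remainder is the integral in the smoothness assumption, hence it
  tends to the quadratic form \<open>quad u\<close>; its variance vanishes, and a bound on its Lipschitz constant makes the
  approximation uniform on balls (\<open>remainder_uniform\<close>). So on every ball the loss is \<open>quad u - score \<bullet> u\<close> up
  to a negligible error, where the score is bounded in probability.

  The parameter sets need not be convex, but the loss is: if it exceeds its value at \<open>\<theta>0\<close> on a large
  sphere, which has high probability, it does so outside the ball as well, along each ray from \<open>\<theta>0\<close>. Hence the preliminary estimator is
  root-\<open>n\<close> consistent (\<open>hat_bounded\<close>). Consequently the adaptive weights stay bounded on the relevant
  coordinates, where the penalty is negligible as \<open>lam n / sqrt n\<close> tends to zero, and are of order at least
  \<open>n powr (g / 2)\<close> on the irrelevant ones. This gives root-\<open>n\<close> consistency of the penalised estimator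
  (\<open>star_bounded\<close>).

  For the limit law, the penalised estimator is compared with the minimiser of \<open>quad u - score \<bullet> u\<close> over the
  \<open>u\<close> that are supported on the relevant coordinates. In local coordinates, the irrelevant ones are
  penalised by a factor that tends to infinity, which forces the two to be close
  (\<open>star_near_oracle_fit\<close>). The minimiser is a linear function of the score, a weighted sum of
  i.i.d. bounded variables, so its characteristic functions converge to Gaussian ones
  (\<open>weighted_sum_char_tendsto\<close>). Levy's continuity theorem in Euclidean space
  (\<open>levy_continuity_euclidean\<close>), proved by Gaussian smoothing, turns this into convergence in distribution.

  For variable selection, setting the irrelevant coordinates to zero changes the loss by at most a
  constant times \<open>n\<close> times the sum of their absolute values, whereas it saves a penalty of order
  \<open>lam n * n powr (g / 2)\<close> times that sum. Once the second factor dominates, the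
  irrelevant coordinates must vanish; the relevant ones do not, by consistency
  (\<open>selection_consistency\<close>).
\<close>

section \<open>Gaussian smoothing and the Levy continuity theorem\<close>

definition std_gaussian :: "'a::euclidean_space measure" where
  "std_gaussian = density lborel (\<lambda>x. ennreal (\<Prod>b\<in>Basis. std_normal_density (x \<bullet> b)))"

lemma sets_std_gaussian [simp, measurable_cong]: "sets std_gaussian = sets borel"
  by (simp add: std_gaussian_def)

lemma space_std_gaussian [simp]: "space std_gaussian = UNIV"
  by (simp add: std_gaussian_def)

lemma prob_space_std_gaussian: "prob_space (std_gaussian :: 'a::euclidean_space measure)"
proof
  have "(\<integral>\<^sup>+x. ennreal (\<Prod>b\<in>Basis. std_normal_density (x \<bullet> b)) \<partial>(lborel :: 'a measure))
      = (\<integral>\<^sup>+x. (\<Prod>b\<in>Basis. ennreal (std_normal_density (x \<bullet> b))) \<partial>(lborel :: 'a measure))"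
    by (simp add: prod_ennreal)
  also have "\<dots> = (\<Prod>b\<in>(Basis::'a set). (\<integral>\<^sup>+x. ennreal (std_normal_density x) \<partial>lborel))"
    by (rule nn_integral_lborel_prod) auto
  also have "\<dots> = 1"
  proof -
    interpret N: prob_space std_normal_distribution by (rule prob_space_normal_density) simp
    show ?thesis using N.emeasure_space_1 by (simp add: emeasure_density)
  qed
  finally show "emeasure (std_gaussian :: 'a measure) (space std_gaussian) = 1"
    by (simp add: std_gaussian_def emeasure_density)
qed

lemma sum_inner_Basis_power2: "(\<Sum>b\<in>Basis. (x \<bullet> b)\<^sup>2) = (norm (x::'a::euclidean_space))\<^sup>2"
proof -
  have "(\<Sum>b\<in>Basis. (x \<bullet> b)\<^sup>2) = x \<bullet> x"
    by (subst euclidean_inner) (simp add: power2_eq_square)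
  then show ?thesis by (simp add: power2_norm_eq_inner)
qed

lemma prod_std_normal_density:
  "(\<Prod>b\<in>Basis. std_normal_density (x \<bullet> b))
    = exp (- (norm (x::'a::euclidean_space))\<^sup>2 / 2) / sqrt (2 * pi) ^ DIM('a)"
proof -
  have "(\<Sum>b\<in>(Basis::'a set). - (x \<bullet> b)\<^sup>2 / 2) = - (norm x)\<^sup>2 / 2"
    by (simp add: sum_negf sum_divide_distrib [symmetric] sum_inner_Basis_power2)
  then show ?thesis
    by (simp add: std_normal_density_def prod_dividef exp_sum [symmetric])
qed

text \<open>The complex-valued counterpart of \<open>nn_integral_lborel_prod\<close>, needed for characteristic functions.\<close>
lemma integral_lborel_prod:
  fixes f :: "'a::euclidean_space \<Rightarrow> real \<Rightarrow> complex"
  assumes int: "\<And>b. b \<in> Basis \<Longrightarrow> integrable lborel (f b)"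
  shows "(\<integral>x. (\<Prod>b\<in>Basis. f b (x \<bullet> b)) \<partial>lborel) = (\<Prod>b\<in>Basis. (\<integral>x. f b x \<partial>lborel))"
proof -
  interpret product_sigma_finite "\<lambda>b::'a. lborel :: real measure"
    by (simp add: product_sigma_finite_def sigma_finite_lborel)
  have [measurable]: "\<And>b. b \<in> Basis \<Longrightarrow> f b \<in> borel_measurable borel"
    using int by (auto dest: borel_measurable_integrable)
  show ?thesis
    by (subst lborel_eq) (simp add: integral_distr product_integral_prod[OF finite_Basis int] cong: prod.cong)
qed

text \<open>The standard Gaussian law is a product law, so its characteristic function is a product of
  one-dimensional ones.\<close>
lemma char_std_gaussian:
  "(CLINT x|std_gaussian. iexp (t \<bullet> x)) = exp (- (norm (t::'a::euclidean_space))\<^sup>2 / 2)"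
proof -
  have int: "integrable lborel (\<lambda>x. std_normal_density x *\<^sub>R iexp (t \<bullet> b * x))" for b :: 'a
  proof -
    interpret N: prob_space std_normal_distribution by (rule prob_space_normal_density) simp
    have "integrable std_normal_distribution (\<lambda>x. iexp (t \<bullet> b * x))"
      by (rule N.integrable_iexp) auto
    then show ?thesis by (subst (asm) integrable_density) auto
  qed
  have "(CLINT x|std_gaussian. iexp (t \<bullet> x))
      = (CLINT x|lborel. (\<Prod>b\<in>Basis. std_normal_density (x \<bullet> b)) *\<^sub>R iexp (t \<bullet> x))"
    unfolding std_gaussian_def by (subst integral_density) (auto intro!: prod_nonneg)
  also have "\<dots> = (CLINT x|lborel. (\<Prod>b\<in>Basis. std_normal_density (x \<bullet> b) *\<^sub>R iexp (t \<bullet> b * (x \<bullet> b))))"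
  proof (rule Bochner_Integration.integral_cong[OF refl])
    fix x :: 'a
    have "iexp (t \<bullet> x) = (\<Prod>b\<in>Basis. iexp (t \<bullet> b * (x \<bullet> b)))"
      by (subst euclidean_inner) (simp add: sum_distrib_left exp_sum)
    then show "(\<Prod>b\<in>Basis. std_normal_density (x \<bullet> b)) *\<^sub>R iexp (t \<bullet> x)
        = (\<Prod>b\<in>Basis. std_normal_density (x \<bullet> b) *\<^sub>R iexp (t \<bullet> b * (x \<bullet> b)))"
      by (simp add: scaleR_conv_of_real prod.distrib)
  qed
  also have "\<dots> = (\<Prod>b\<in>Basis. (CLINT x|lborel. std_normal_density x *\<^sub>R iexp (t \<bullet> b * x)))"
    by (rule integral_lborel_prod) (rule int)
  also have "\<dots> = (\<Prod>b\<in>Basis. char std_normal_distribution (t \<bullet> b))"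
    unfolding char_def by (subst integral_density) auto
  also have "\<dots> = exp (- (norm t)\<^sup>2 / 2)"
  proof -
    have "(\<Sum>b\<in>(Basis::'a set). - (t \<bullet> b)\<^sup>2 / 2) = - (norm t)\<^sup>2 / 2"
      by (simp add: sum_negf sum_divide_distrib [symmetric] sum_inner_Basis_power2)
    then show ?thesis
      by (simp add: char_std_normal_distribution of_real_exp [symmetric] exp_sum [symmetric] del: of_real_exp of_real_prod flip: of_real_prod)
  qed
  finally show ?thesis .
qed

text \<open>Fourier inversion in the only form needed: a Gaussian bump is itself a Gaussian average of
  characters, so its expectation is an average of values of the characteristic function.\<close>
lemma expectation_gaussian_bump:
  fixes Z :: "'w \<Rightarrow> 'a::euclidean_space"
  assumes "prob_space M" and [measurable]: "Z \<in> borel_measurable M"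
  shows "complex_of_real (\<integral>\<omega>. exp (- (s * norm (y - Z \<omega>))\<^sup>2 / 2) \<partial>M)
       = (CLINT t|std_gaussian. iexp (s * (t \<bullet> y)) * (CLINT \<omega>|M. iexp ((- s *\<^sub>R t) \<bullet> Z \<omega>)))"
proof -
  interpret M: prob_space M by fact
  interpret G: prob_space "std_gaussian :: 'a measure" by (rule prob_space_std_gaussian)
  interpret P: pair_prob_space "std_gaussian :: 'a measure" M ..
  have "complex_of_real (\<integral>\<omega>. exp (- (s * norm (y - Z \<omega>))\<^sup>2 / 2) \<partial>M)
     = (CLINT \<omega>|M. complex_of_real (exp (- (norm (s *\<^sub>R (y - Z \<omega>)))\<^sup>2 / 2)))"
    by (simp add: power_mult_distrib del: of_real_exp)
  also have "\<dots> = (CLINT \<omega>|M. CLINT t|std_gaussian. iexp ((s *\<^sub>R (y - Z \<omega>)) \<bullet> t))"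
    by (simp only: char_std_gaussian)
  also have "\<dots> = (CLINT t|std_gaussian. CLINT \<omega>|M. iexp ((s *\<^sub>R (y - Z \<omega>)) \<bullet> t))"
  proof (rule P.Fubini_integral)
    show "integrable (std_gaussian \<Otimes>\<^sub>M M) (\<lambda>(t, \<omega>). iexp ((s *\<^sub>R (y - Z \<omega>)) \<bullet> t))"
      by (rule P.integrable_const_bound[where B=1]) auto
  qed
  also have "\<dots> = (CLINT t|std_gaussian. iexp (s * (t \<bullet> y)) * (CLINT \<omega>|M. iexp ((- s *\<^sub>R t) \<bullet> Z \<omega>)))"
  proof (rule Bochner_Integration.integral_cong[OF refl])
    fix t :: 'a
    have "iexp ((s *\<^sub>R (y - Z \<omega>)) \<bullet> t) = iexp (s * (t \<bullet> y)) * iexp ((- s *\<^sub>R t) \<bullet> Z \<omega>)" for \<omega>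
      by (simp add: exp_add [symmetric] algebra_simps inner_simps inner_commute)
    then show "(CLINT \<omega>|M. iexp ((s *\<^sub>R (y - Z \<omega>)) \<bullet> t))
       = iexp (s * (t \<bullet> y)) * (CLINT \<omega>|M. iexp ((- s *\<^sub>R t) \<bullet> Z \<omega>))"
      by (simp only: integral_mult_right_zero)
  qed
  finally show ?thesis .
qed

text \<open>The average over Gaussian perturbations is a convolution with a Gaussian bump. For bounded uniformly
  continuous \<open>h\<close> and large \<open>s\<close> the left-hand side is close to \<open>h z\<close>; in the right-hand side \<open>z\<close> enters only through the bump, whose
  expectation is controlled by the characteristic function.\<close>
lemma gaussian_average_eq_lborel:
  fixes h :: "'a::euclidean_space \<Rightarrow> real"
  assumes [measurable]: "h \<in> borel_measurable borel" and s: "0 < s"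
  shows "(\<integral>t. h (z + (1 / s) *\<^sub>R t) \<partial>std_gaussian)
    = (s / sqrt (2 * pi)) ^ DIM('a) * (\<integral>y. h y * exp (- (s * norm (y - z))\<^sup>2 / 2) \<partial>lborel)"
proof -
  let ?g = "\<lambda>y. h y * exp (- (s * norm (y - z))\<^sup>2 / 2)"
  have "(\<integral>y. ?g y \<partial>lborel) = (\<integral>y. ?g y \<partial>density (distr lborel borel (\<lambda>x. z + (1 / s) *\<^sub>R x)) (\<lambda>_. ennreal (\<bar>1 / s\<bar> ^ DIM('a))))"
    using s by (subst lborel_affine[of "1 / s" z]) auto
  also have "\<dots> = (\<integral>x. (1 / s) ^ DIM('a) * ?g (z + (1 / s) *\<^sub>R x) \<partial>lborel)"
    using s by (simp add: integral_density integral_distr)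
  also have "\<dots> = (1 / s) ^ DIM('a) * (\<integral>x. h (z + (1 / s) *\<^sub>R x) * exp (- (norm x)\<^sup>2 / 2) \<partial>lborel)"
    using s by simp
  finally have *: "(\<integral>y. ?g y \<partial>lborel) = (1 / s) ^ DIM('a) * (\<integral>x. h (z + (1 / s) *\<^sub>R x) * exp (- (norm x)\<^sup>2 / 2) \<partial>lborel)" .
  have "(\<integral>t. h (z + (1 / s) *\<^sub>R t) \<partial>std_gaussian)
     = (\<integral>t. (exp (- (norm t)\<^sup>2 / 2) / sqrt (2 * pi) ^ DIM('a)) *\<^sub>R h (z + (1 / s) *\<^sub>R t) \<partial>lborel)"
    unfolding std_gaussian_def prod_std_normal_density by (subst integral_density) auto
  also have "\<dots> = (1 / sqrt (2 * pi)) ^ DIM('a) * (\<integral>x. h (z + (1 / s) *\<^sub>R x) * exp (- (norm x)\<^sup>2 / 2) \<partial>lborel)"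
    unfolding integral_mult_right_zero[symmetric]
    by (intro Bochner_Integration.integral_cong) (auto simp: power_divide)
  finally show ?thesis
    using s unfolding * by (simp add: power_divide)
qed

lemma prob_norm_tail:
  fixes N :: "'a::euclidean_space measure"
  assumes "prob_space N" and [simp, measurable_cong]: "sets N = sets borel" and "0 < e"
  obtains r where "0 < r" "measure N {x. r < norm x} < e"
proof -
  interpret prob_space N by fact
  have sp: "space N = UNIV" using sets_eq_imp_space_eq[of N borel] by simp
  have "(\<lambda>n::nat. measure N {x. real n < norm x}) \<longlonglongrightarrow> measure N (\<Inter>n. {x. real n < norm x})"
    by (rule finite_Lim_measure_decseq) (auto simp: decseq_def)
  moreover have "(\<Inter>n. {x::'a. real n < norm x}) = {}"
  proof (intro equals0I)
    fix x :: 'a assume "x \<in> (\<Inter>n. {x. real n < norm x})"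
    then show False using reals_Archimedean2[of "norm x"] by (auto dest: less_asym)
  qed
  ultimately have "(\<lambda>n::nat. measure N {x. real n < norm x}) \<longlonglongrightarrow> 0" by simp
  then have "\<forall>\<^sub>F n in sequentially. measure N {x. real n < norm x} < e"
    using \<open>0 < e\<close> by (rule order_tendstoD)
  then have "\<forall>\<^sub>F n in sequentially. measure N {x. real n < norm x} < e \<and> 0 < n"
    using eventually_gt_at_top[of "0::nat"] by (rule eventually_conj)
  then obtain n :: nat where "measure N {x. real n < norm x} < e" "0 < n"
    by (auto dest: eventually_happens)
  then show ?thesis by (intro that[of "real n"]) auto
qed

lemma compact_support_uniformly_continuous:
  fixes h :: "'a::euclidean_space \<Rightarrow> real"
  assumes cont: "continuous_on UNIV h" and supp: "\<And>x. R < norm x \<Longrightarrow> h x = 0" and "0 < e"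
  obtains d where "0 < d" "\<And>x y. norm y < d \<Longrightarrow> \<bar>h (x + y) - h x\<bar> < e"
proof -
  have "uniformly_continuous_on (cball 0 (R + 1)) h"
    by (rule compact_uniformly_continuous) (auto intro: continuous_on_subset[OF cont])
  then obtain d where d: "0 < d" "\<And>x y. x \<in> cball 0 (R+1) \<Longrightarrow> y \<in> cball 0 (R+1) \<Longrightarrow> dist y x < d \<Longrightarrow> dist (h y) (h x) < e"
    using \<open>0 < e\<close> unfolding uniformly_continuous_on_def by blast
  show ?thesis
  proof (rule that[of "min d 1"])
    show "0 < min d 1" using d by simp
    fix x y :: 'a assume y: "norm y < min d 1"
    have t: "norm (x + y) \<le> norm x + norm y" "norm x \<le> norm (x + y) + norm y"
      using norm_triangle_ineq[of x y] norm_triangle_ineq4[of "x + y" y] by auto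
    show "\<bar>h (x + y) - h x\<bar> < e"
    proof (cases "norm x \<le> R + 1 \<and> norm (x + y) \<le> R + 1")
      case True
      then have "dist (h (x + y)) (h x) < e"
        using y by (intro d(2)) (auto simp: mem_cball_0 dist_norm simp del: mem_cball)
      then show ?thesis by (simp add: dist_norm)
    next
      case False
      then have "R < norm x" "R < norm (x + y)" using t y by auto
      then show ?thesis using supp \<open>0 < e\<close> by simp
    qed
  qed
qed

text \<open>At a small scale, Gaussian perturbations that exceed the modulus of continuity are rare.\<close>
lemma gaussian_average_close:
  fixes h :: "'a::euclidean_space \<Rightarrow> real"
  assumes [measurable]: "h \<in> borel_measurable borel"
    and C: "\<And>x. \<bar>h x\<bar> \<le> C"
    and uc: "\<And>e. 0 < e \<Longrightarrow> \<exists>d>0. \<forall>x y. norm y < d \<longrightarrow> \<bar>h (x + y) - h x\<bar> < e"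
    and "0 < e"
  obtains s where "0 < s" "\<And>z. \<bar>(\<integral>t. h (z + (1 / s) *\<^sub>R t) \<partial>std_gaussian) - h z\<bar> \<le> e"
proof -
  let ?G = "std_gaussian :: 'a measure"
  interpret G: prob_space ?G by (rule prob_space_std_gaussian)
  have C0: "0 \<le> C" using C[of 0] by simp
  obtain d where d: "0 < d" "\<And>x y. norm y < d \<Longrightarrow> \<bar>h (x + y) - h x\<bar> < e / 2"
    using uc[of "e / 2"] \<open>0 < e\<close> by auto
  obtain r where r: "0 < r" "measure ?G {x. r < norm x} < e / (4 * C + 1)"
    using prob_norm_tail[OF G.prob_space_axioms, of "e / (4 * C + 1)"] \<open>0 < e\<close> C0 by auto
  \<comment> \<open>with this scale, a perturbation \<open>t / s\<close> of size at least \<open>d\<close> requires \<open>norm t > r\<close>\<close>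
  define s where "s = 2 * r / d"
  have s: "0 < s" using r d by (simp add: s_def)
  show ?thesis
  proof (rule that[OF s])
    fix z
    have int: "integrable ?G (\<lambda>t. h (z + (1 / s) *\<^sub>R t))"
      by (rule G.integrable_const_bound[where B=C]) (auto simp: C)
    have "\<bar>(\<integral>t. h (z + (1 / s) *\<^sub>R t) \<partial>?G) - h z\<bar> = \<bar>\<integral>t. h (z + (1 / s) *\<^sub>R t) - h z \<partial>?G\<bar>"
      using int G.prob_space by (subst Bochner_Integration.integral_diff) auto
    also have "\<dots> \<le> (\<integral>t. \<bar>h (z + (1 / s) *\<^sub>R t) - h z\<bar> \<partial>?G)"
      by (rule integral_abs_bound)
    also have "\<dots> \<le> (\<integral>t. e / 2 + 2 * C * indicator {x. r < norm x} t \<partial>?G)"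
    proof (rule integral_mono)
      show "integrable ?G (\<lambda>t. \<bar>h (z + (1 / s) *\<^sub>R t) - h z\<bar>)" using int by simp
      show "integrable ?G (\<lambda>t. e / 2 + 2 * C * indicator {x. r < norm x} t)"
        by (rule G.integrable_const_bound[where B="e / 2 + 2 * C"]) (use C0 \<open>0 < e\<close> in \<open>auto simp: indicator_def\<close>)
      fix t :: 'a
      show "\<bar>h (z + (1 / s) *\<^sub>R t) - h z\<bar> \<le> e / 2 + 2 * C * indicator {x. r < norm x} t"
      proof (cases "r < norm t")
        case True
        have "\<bar>h (z + (1 / s) *\<^sub>R t) - h z\<bar> \<le> C + C"
          by (intro order_trans[OF abs_triangle_ineq4] add_mono C)
        then show ?thesis using True \<open>0 < e\<close> by simp
      next
        case False
        then have "norm ((1 / s) *\<^sub>R t) \<le> r / s" using s by (simp add: divide_right_mono)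
        also have "\<dots> < d" using r d by (simp add: s_def)
        finally show ?thesis using d(2)[of "(1 / s) *\<^sub>R t" z] C0 by (auto simp: indicator_def)
      qed
    qed
    also have "\<dots> = e / 2 + 2 * C * measure ?G {x. r < norm x}"
    proof -
      have "integrable ?G (\<lambda>t. 2 * C * indicat_real {x. r < norm x} t)"
        by (rule G.integrable_const_bound[where B="2 * C"]) (use C0 in \<open>auto simp: indicator_def\<close>)
      then show ?thesis
        using G.prob_space by (subst Bochner_Integration.integral_add) auto
    qed
    also have "\<dots> \<le> e / 2 + 2 * C * (e / (4 * C + 1))"
      using r C0 by (intro add_left_mono mult_left_mono) auto
    also have "\<dots> \<le> e"
      using C0 \<open>0 < e\<close> by (simp add: field_simps)
    finally show "\<bar>(\<integral>t. h (z + (1 / s) *\<^sub>R t) \<partial>?G) - h z\<bar> \<le> e" .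
  qed
qed

lemma expectation_gaussian_convolution:
  fixes Z :: "'w \<Rightarrow> 'a::euclidean_space" and h :: "'a \<Rightarrow> real"
  assumes "prob_space M" and [measurable]: "Z \<in> borel_measurable M"
    and h: "integrable lborel h"
  shows "(\<integral>\<omega>. (\<integral>y. h y * exp (- (s * norm (y - Z \<omega>))\<^sup>2 / 2) \<partial>lborel) \<partial>M)
       = (\<integral>y. h y * (\<integral>\<omega>. exp (- (s * norm (y - Z \<omega>))\<^sup>2 / 2) \<partial>M) \<partial>lborel)"
proof -
  interpret M: prob_space M by fact
  interpret P: pair_sigma_finite lborel M ..
  let ?k = "\<lambda>(y, \<omega>). h y * exp (- (s * norm (y - Z \<omega>))\<^sup>2 / 2)"
  have [measurable]: "h \<in> borel_measurable borel" using h by (auto dest: borel_measurable_integrable)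
  have "integrable (lborel \<Otimes>\<^sub>M M) ?k"
  proof (rule Bochner_Integration.integrable_bound)
    show "integrable (lborel \<Otimes>\<^sub>M M) (\<lambda>(y, \<omega>). h y)"
      by (rule P.Fubini_integrable) (use h M.prob_space in auto)
    show "AE x in lborel \<Otimes>\<^sub>M M. norm (?k x) \<le> norm (case x of (y, \<omega>) \<Rightarrow> h y)"
      by (auto simp: abs_mult mult_left_le)
  qed measurable
  from P.Fubini_integral[OF this] show ?thesis by simp
qed

lemma expectation_gaussian_bump_tendsto:
  fixes Z :: "nat \<Rightarrow> 'w \<Rightarrow> 'a::euclidean_space"
  assumes "prob_space M" and Z: "\<And>n. Z n \<in> borel_measurable M"
    and "prob_space N" and N: "sets N = sets borel"
    and cf: "\<And>t. (\<lambda>n. CLINT \<omega>|M. iexp (t \<bullet> Z n \<omega>)) \<longlonglongrightarrow> (CLINT x|N. iexp (t \<bullet> x))"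
  shows "(\<lambda>n. \<integral>\<omega>. exp (- (s * norm (y - Z n \<omega>))\<^sup>2 / 2) \<partial>M)
      \<longlonglongrightarrow> (\<integral>x. exp (- (s * norm (y - x))\<^sup>2 / 2) \<partial>N)"
proof -
  interpret M: prob_space M by fact
  interpret N: prob_space N by fact
  interpret G: prob_space "std_gaussian :: 'a measure" by (rule prob_space_std_gaussian)
  note [measurable] = Z
  note N[simp, measurable_cong]
  have id[measurable]: "(\<lambda>x. x) \<in> borel_measurable N" by simp
  have "(\<lambda>n. complex_of_real (\<integral>\<omega>. exp (- (s * norm (y - Z n \<omega>))\<^sup>2 / 2) \<partial>M))
      \<longlonglongrightarrow> complex_of_real (\<integral>x. exp (- (s * norm (y - x))\<^sup>2 / 2) \<partial>N)"
    unfolding expectation_gaussian_bump[OF M.prob_space_axioms Z] expectation_gaussian_bump[OF N.prob_space_axioms id]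
  proof (rule integral_dominated_convergence[where w="\<lambda>_. 1"])
    show "AE t in std_gaussian. (\<lambda>n. iexp (s * (t \<bullet> y)) * (CLINT \<omega>|M. iexp ((- s *\<^sub>R t) \<bullet> Z n \<omega>)))
       \<longlonglongrightarrow> iexp (s * (t \<bullet> y)) * (CLINT x|N. iexp ((- s *\<^sub>R t) \<bullet> x))"
      by (intro AE_I2 tendsto_mult tendsto_const cf)
    have "norm (CLINT \<omega>|M. iexp ((- s *\<^sub>R t) \<bullet> Z n \<omega>)) \<le> 1" for n t
    proof -
      have "norm (CLINT \<omega>|M. iexp ((- s *\<^sub>R t) \<bullet> Z n \<omega>)) \<le> (\<integral>\<omega>. norm (iexp ((- s *\<^sub>R t) \<bullet> Z n \<omega>)) \<partial>M)"
        by (rule integral_norm_bound)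
      then show ?thesis using M.prob_space by simp
    qed
    then show "AE t in std_gaussian. norm (iexp (s * (t \<bullet> y)) * (CLINT \<omega>|M. iexp ((- s *\<^sub>R t) \<bullet> Z n \<omega>))) \<le> 1" for n
      by (simp add: norm_mult)
  qed auto
  then show ?thesis by (simp only: tendsto_of_real_iff)
qed

lemma expectation_close:
  fixes X Y :: "'w \<Rightarrow> real"
  assumes "prob_space M" and X: "X \<in> borel_measurable M" and Y: "Y \<in> borel_measurable M"
    and bnd: "\<And>\<omega>. \<bar>X \<omega>\<bar> \<le> C" "\<And>\<omega>. \<bar>Y \<omega>\<bar> \<le> C'" and close: "\<And>\<omega>. \<bar>X \<omega> - Y \<omega>\<bar> \<le> e"
  shows "\<bar>(\<integral>\<omega>. X \<omega> \<partial>M) - (\<integral>\<omega>. Y \<omega> \<partial>M)\<bar> \<le> e"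
proof -
  interpret M: prob_space M by fact
  have i: "integrable M X" "integrable M Y"
    by (rule M.integrable_const_bound[where B=C], use bnd X in auto)
      (rule M.integrable_const_bound[where B=C'], use bnd Y in auto)
  then have "\<bar>(\<integral>\<omega>. X \<omega> \<partial>M) - (\<integral>\<omega>. Y \<omega> \<partial>M)\<bar> = \<bar>\<integral>\<omega>. X \<omega> - Y \<omega> \<partial>M\<bar>" by simp
  also have "\<dots> \<le> (\<integral>\<omega>. \<bar>X \<omega> - Y \<omega>\<bar> \<partial>M)" by (rule integral_abs_bound)
  also have "\<dots> \<le> e"
    using i close by (intro M.integral_le_const AE_I2) auto
  finally show ?thesis .
qed

text \<open>For compactly supported \<open>h\<close>, replacing \<open>h\<close> by its Gaussian average costs little uniformly in the
  argument, hence uniformly in \<open>n\<close>; for the averaged function convergence follows from Fubini's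
  theorem and dominated convergence.\<close>
lemma levy_compact_support:
  fixes Z :: "nat \<Rightarrow> 'w \<Rightarrow> 'a::euclidean_space" and h :: "'a \<Rightarrow> real"
  assumes "prob_space M" and Z: "\<And>n. Z n \<in> borel_measurable M"
    and "prob_space N" and N: "sets N = sets borel"
    and cf: "\<And>t. (\<lambda>n. CLINT \<omega>|M. iexp (t \<bullet> Z n \<omega>)) \<longlonglongrightarrow> (CLINT x|N. iexp (t \<bullet> x))"
    and cont: "continuous_on UNIV h" and supp: "\<And>x. R < norm x \<Longrightarrow> h x = 0"
  shows "(\<lambda>n. \<integral>\<omega>. h (Z n \<omega>) \<partial>M) \<longlonglongrightarrow> (\<integral>x. h x \<partial>N)"
proof (rule LIMSEQ_I)
  interpret M: prob_space M by fact
  interpret N: prob_space N by fact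
  interpret G: prob_space "std_gaussian :: 'a measure" by (rule prob_space_std_gaussian)
  note [measurable] = Z
  note N[simp, measurable_cong]
  have id[measurable]: "(\<lambda>x. x) \<in> borel_measurable N" by simp
  have hm[measurable]: "h \<in> borel_measurable borel"
    using cont by (rule borel_measurable_continuous_onI)
  have "bounded (h ` cball 0 R)"
    by (intro compact_imp_bounded compact_continuous_image continuous_on_subset[OF cont]) auto
  then obtain C' where C': "\<And>x. x \<in> cball 0 R \<Longrightarrow> \<bar>h x\<bar> \<le> C'" by (metis bounded_iff imageI real_norm_def)
  define C where "C = max C' 0"
  have C: "\<bar>h x\<bar> \<le> C" for x
    using C'[of x] supp[of x] by (cases "norm x \<le> R") (auto simp: C_def)
  have hi: "integrable lborel h"
  proof -
    have "integrable lborel (\<lambda>x. indicator (cball 0 R) x *\<^sub>R h x)"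
      by (rule borel_integrable_compact) (auto intro: continuous_on_subset[OF cont])
    also have "(\<lambda>x. indicator (cball 0 R) x *\<^sub>R h x) = h"
      using supp by (auto simp: indicator_def fun_eq_iff)
    finally show ?thesis .
  qed
  fix e :: real assume e: "0 < e"
  have uc: "\<exists>d>0. \<forall>x y. norm y < d \<longrightarrow> \<bar>h (x + y) - h x\<bar> < e" if "0 < e" for e
    by (rule compact_support_uniformly_continuous[OF cont supp that]) auto
  obtain s where s: "0 < s" and close: "\<And>z. \<bar>(\<integral>t. h (z + (1 / s) *\<^sub>R t) \<partial>std_gaussian) - h z\<bar> \<le> e / 4"
    using gaussian_average_close[OF hm C uc, of "e / 4"] e by auto
  define hs where "hs z = (\<integral>t. h (z + (1 / s) *\<^sub>R t) \<partial>std_gaussian)" for z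
  have hs: "hs z = (s / sqrt (2 * pi)) ^ DIM('a) * (\<integral>y. h y * exp (- (s * norm (y - z))\<^sup>2 / 2) \<partial>lborel)" for z
    unfolding hs_def by (rule gaussian_average_eq_lborel[OF hm s])
  have hs_m[measurable]: "hs \<in> borel_measurable borel" unfolding hs_def by measurable
  have hs_C: "\<bar>hs z\<bar> \<le> C + e / 4" for z using close[of z] C[of z] unfolding hs_def by linarith
  have E: "(\<integral>\<omega>. hs (W \<omega>) \<partial>P) = (s / sqrt (2 * pi)) ^ DIM('a) *
      (\<integral>y. h y * (\<integral>\<omega>. exp (- (s * norm (y - W \<omega>))\<^sup>2 / 2) \<partial>P) \<partial>lborel)"
    if "prob_space P" "W \<in> borel_measurable P" for P :: "'v measure" and W
    unfolding hs integral_mult_right_zero expectation_gaussian_convolution[OF that hi] ..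
  have near: "\<bar>(\<integral>\<omega>. hs (W \<omega>) \<partial>P) - (\<integral>\<omega>. h (W \<omega>) \<partial>P)\<bar> \<le> e / 4"
    if "prob_space P" and W: "W \<in> borel_measurable P" for P :: "'v measure" and W
    by (rule expectation_close[OF that(1) measurable_compose[OF W hs_m] measurable_compose[OF W hm] hs_C C])
      (rule close[folded hs_def])
  have "(\<lambda>n. \<integral>y. h y * (\<integral>\<omega>. exp (- (s * norm (y - Z n \<omega>))\<^sup>2 / 2) \<partial>M) \<partial>lborel)
      \<longlonglongrightarrow> (\<integral>y. h y * (\<integral>x. exp (- (s * norm (y - x))\<^sup>2 / 2) \<partial>N) \<partial>lborel)"
  proof (rule integral_dominated_convergence[where w="\<lambda>y. \<bar>h y\<bar>"])
    show "AE y in lborel. (\<lambda>n. h y * (\<integral>\<omega>. exp (- (s * norm (y - Z n \<omega>))\<^sup>2 / 2) \<partial>M))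
        \<longlonglongrightarrow> h y * (\<integral>x. exp (- (s * norm (y - x))\<^sup>2 / 2) \<partial>N)"
      by (intro AE_I2 tendsto_mult_left expectation_gaussian_bump_tendsto[OF assms(1-5)])
    have "\<bar>\<integral>\<omega>. exp (- (s * norm (y - Z n \<omega>))\<^sup>2 / 2) \<partial>M\<bar> \<le> 1" for n y
    proof -
      have i: "integrable M (\<lambda>\<omega>. exp (- (s * norm (y - Z n \<omega>))\<^sup>2 / 2))"
        by (rule M.integrable_const_bound[where B=1]) auto
      then have "(\<integral>\<omega>. exp (- (s * norm (y - Z n \<omega>))\<^sup>2 / 2) \<partial>M) \<le> 1"
        by (intro M.integral_le_const) auto
      moreover have "0 \<le> (\<integral>\<omega>. exp (- (s * norm (y - Z n \<omega>))\<^sup>2 / 2) \<partial>M)"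
        by (intro Bochner_Integration.integral_nonneg) auto
      ultimately show ?thesis by simp
    qed
    then show "AE y in lborel. norm (h y * (\<integral>\<omega>. exp (- (s * norm (y - Z n \<omega>))\<^sup>2 / 2) \<partial>M)) \<le> \<bar>h y\<bar>" for n
      unfolding real_norm_def abs_mult by (intro AE_I2 mult_left_le) auto
    show "integrable lborel (\<lambda>y. \<bar>h y\<bar>)" using hi by (rule integrable_abs)
  qed measurable
  then have "(\<lambda>n. \<integral>\<omega>. hs (Z n \<omega>) \<partial>M) \<longlonglongrightarrow> (\<integral>x. hs x \<partial>N)"
    unfolding E[OF M.prob_space_axioms Z] E[OF N.prob_space_axioms id] by (rule tendsto_mult_left)
  then obtain n0 where n0: "\<And>n. n \<ge> n0 \<Longrightarrow> \<bar>(\<integral>\<omega>. hs (Z n \<omega>) \<partial>M) - (\<integral>x. hs x \<partial>N)\<bar> < e / 4"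
    using LIMSEQ_D[of "\<lambda>n. \<integral>\<omega>. hs (Z n \<omega>) \<partial>M" "\<integral>x. hs x \<partial>N" "e / 4"] e by (auto simp: real_norm_def)
  show "\<exists>no. \<forall>n\<ge>no. norm ((\<integral>\<omega>. h (Z n \<omega>) \<partial>M) - (\<integral>x. h x \<partial>N)) < e"
  proof (intro exI allI impI)
    fix n assume "n0 \<le> n"
    from n0[OF this] near[OF M.prob_space_axioms Z[of n]] near[OF N.prob_space_axioms id] e
    show "norm ((\<integral>\<omega>. h (Z n \<omega>) \<partial>M) - (\<integral>x. h x \<partial>N)) < e"
      unfolding real_norm_def by linarith
  qed
qed


text \<open>Tightness comes for free: a continuous cutoff \<open>c\<close> is a compactly supported test function, so the
  mass that \<open>Z n\<close> puts outside its support converges to the small mass left by the limit law.\<close>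
lemma levy_continuity_euclidean:
  fixes Z :: "nat \<Rightarrow> 'w \<Rightarrow> 'a::euclidean_space"
  assumes "prob_space M" and Z: "\<And>n. Z n \<in> borel_measurable M"
    and "prob_space N" and N: "sets N = sets borel"
    and cf: "\<And>t. (\<lambda>n. CLINT \<omega>|M. iexp (t \<bullet> Z n \<omega>)) \<longlonglongrightarrow> (CLINT x|N. iexp (t \<bullet> x))"
  shows "converges_in_distribution M Z N"
  unfolding converges_in_distribution_def
proof (intro allI impI, elim conjE)
  fix h :: "'a \<Rightarrow> real" assume cont: "continuous_on UNIV h" and "bounded (range h)"
  then obtain C where C: "\<And>x. \<bar>h x\<bar> \<le> C" by (auto simp: bounded_iff)
  interpret M: prob_space M by fact
  interpret N: prob_space N by fact
  note [measurable] = Z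
  note N[simp, measurable_cong]
  have C0: "0 \<le> C" using C[of 0] by simp
  have hm[measurable]: "h \<in> borel_measurable borel"
    using cont by (rule borel_measurable_continuous_onI)
  show "(\<lambda>n. \<integral>\<omega>. h (Z n \<omega>) \<partial>M) \<longlonglongrightarrow> (\<integral>x. h x \<partial>N)"
  proof (rule LIMSEQ_I)
    fix e :: real assume e: "0 < e"
    \<comment> \<open>truncation costs at most \<open>C * (2 * d)\<close> under \<open>Z n\<close> and \<open>C * d\<close> under \<open>N\<close>\<close>
    define d where "d = e / (4 * C + 4)"
    have d: "0 < d" "4 * (C * d) < e" using e C0 by (auto simp: d_def field_simps intro: add_nonneg_pos)
    obtain r where r: "0 < r" "measure N {x. r < norm x} < d"
      using prob_norm_tail[OF N.prob_space_axioms N d(1)] by auto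
    define c where "c x = max 0 (min 1 (r + 1 - norm x))" for x :: 'a
    have c01: "0 \<le> c x" "c x \<le> 1" for x by (auto simp: c_def)
    have c_cont: "continuous_on UNIV c" unfolding c_def by (intro continuous_intros)
    have cm[measurable]: "c \<in> borel_measurable borel"
      using c_cont by (rule borel_measurable_continuous_onI)
    have c_supp: "c x = 0" if "r + 1 < norm x" for x using that by (auto simp: c_def)
    have lim_c: "(\<lambda>n. \<integral>\<omega>. c (Z n \<omega>) \<partial>M) \<longlonglongrightarrow> (\<integral>x. c x \<partial>N)"
      by (rule levy_compact_support[OF assms c_cont c_supp])
    have lim_hc: "(\<lambda>n. \<integral>\<omega>. h (Z n \<omega>) * c (Z n \<omega>) \<partial>M) \<longlonglongrightarrow> (\<integral>x. h x * c x \<partial>N)"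
      by (rule levy_compact_support[OF assms continuous_on_mult[OF cont c_cont], of "r + 1"]) (simp add: c_supp)
    have intc: "integrable N c"
      by (rule N.integrable_const_bound[where B=1]) (use c01 in auto)
    have inti: "integrable N (indicat_real {x. r < norm x})"
      by (rule N.integrable_const_bound[where B=1]) (auto simp: indicator_def)
    have "(\<integral>x. 1 - indicator {x. r < norm x} x \<partial>N) \<le> (\<integral>x. c x \<partial>N)"
      by (rule integral_mono[OF _ intc]) (auto intro!: Bochner_Integration.integrable_diff inti, auto simp: indicator_def c_def)
    then have Nc: "1 - d \<le> (\<integral>x. c x \<partial>N)"
      using r inti N.prob_space sets_eq_imp_space_eq[OF N] by (subst (asm) Bochner_Integration.integral_diff) auto
    have tail: "\<bar>(\<integral>\<omega>. h (W \<omega>) \<partial>P) - (\<integral>\<omega>. h (W \<omega>) * c (W \<omega>) \<partial>P)\<bar> \<le> C * (1 - (\<integral>\<omega>. c (W \<omega>) \<partial>P))"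
      if "prob_space P" and W: "W \<in> borel_measurable P" for P :: "'v measure" and W
    proof -
      interpret P: prob_space P by fact
      note [measurable] = W
      have i1: "integrable P (\<lambda>\<omega>. h (W \<omega>))"
        by (rule P.integrable_const_bound[where B=C]) (use C in auto)
      have i2: "integrable P (\<lambda>\<omega>. c (W \<omega>))"
        by (rule P.integrable_const_bound[where B=1]) (use c01 in auto)
      have b3: "\<bar>h x * c x\<bar> \<le> C" for x
        using mult_mono[OF C[of x] c01(2)[of x]] c01[of x] C0 by (simp add: abs_mult)
      have i3: "integrable P (\<lambda>\<omega>. h (W \<omega>) * c (W \<omega>))"
        by (rule P.integrable_const_bound[where B=C]) (use b3 in auto)
      have "\<bar>(\<integral>\<omega>. h (W \<omega>) \<partial>P) - (\<integral>\<omega>. h (W \<omega>) * c (W \<omega>) \<partial>P)\<bar>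
          = \<bar>\<integral>\<omega>. h (W \<omega>) - h (W \<omega>) * c (W \<omega>) \<partial>P\<bar>" using i1 i3 by simp
      also have "\<dots> \<le> (\<integral>\<omega>. \<bar>h (W \<omega>) - h (W \<omega>) * c (W \<omega>)\<bar> \<partial>P)" by (rule integral_abs_bound)
      also have "\<dots> \<le> (\<integral>\<omega>. C * (1 - c (W \<omega>)) \<partial>P)"
      proof (rule integral_mono)
        show "integrable P (\<lambda>\<omega>. C * (1 - c (W \<omega>)))" using i2 by simp
        fix \<omega>
        have "\<bar>h (W \<omega>) - h (W \<omega>) * c (W \<omega>)\<bar> = \<bar>h (W \<omega>)\<bar> * (1 - c (W \<omega>))"
        proof -
          have "h (W \<omega>) - h (W \<omega>) * c (W \<omega>) = h (W \<omega>) * (1 - c (W \<omega>))" by (simp add: algebra_simps)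
          then show ?thesis using c01[of "W \<omega>"] by (simp only: abs_mult)
        qed
        also have "\<dots> \<le> C * (1 - c (W \<omega>))"
          using c01[of "W \<omega>"] by (intro mult_right_mono C) auto
        finally show "\<bar>h (W \<omega>) - h (W \<omega>) * c (W \<omega>)\<bar> \<le> C * (1 - c (W \<omega>))" .
      qed (use i1 i3 in simp)
      also have "\<dots> = C * (1 - (\<integral>\<omega>. c (W \<omega>) \<partial>P))"
        using i2 P.prob_space by simp
      finally show ?thesis .
    qed
    obtain n1 where n1: "\<And>n. n \<ge> n1 \<Longrightarrow> \<bar>(\<integral>\<omega>. c (Z n \<omega>) \<partial>M) - (\<integral>x. c x \<partial>N)\<bar> < d"
      using LIMSEQ_D[OF lim_c d(1)] unfolding real_norm_def by blast
    obtain n2 where n2: "\<And>n. n \<ge> n2 \<Longrightarrow> \<bar>(\<integral>\<omega>. h (Z n \<omega>) * c (Z n \<omega>) \<partial>M) - (\<integral>x. h x * c x \<partial>N)\<bar> < e - 4 * (C * d)"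
      using LIMSEQ_D[OF lim_hc, of "e - 4 * (C * d)"] d(2) unfolding real_norm_def by auto
    show "\<exists>no. \<forall>n\<ge>no. norm ((\<integral>\<omega>. h (Z n \<omega>) \<partial>M) - (\<integral>x. h x \<partial>N)) < e"
    proof (intro exI allI impI)
      fix n assume n: "max n1 n2 \<le> n"
      have idN: "(\<lambda>x. x) \<in> borel_measurable N" by simp
      note tM = tail[OF M.prob_space_axioms Z[of n]]
      note tN = tail[OF N.prob_space_axioms idN]
      have "1 - (\<integral>\<omega>. c (Z n \<omega>) \<partial>M) \<le> 2 * d" using n1[of n] n Nc by (auto simp: abs_less_iff)
      then have "C * (1 - (\<integral>\<omega>. c (Z n \<omega>) \<partial>M)) \<le> C * (2 * d)" using C0 by (rule mult_left_mono)
      moreover have "C * (1 - (\<integral>\<omega>. c \<omega> \<partial>N)) \<le> C * d" using C0 Nc by (intro mult_left_mono) auto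
      moreover have "0 \<le> C * d" using C0 d by simp
      ultimately show "norm ((\<integral>\<omega>. h (Z n \<omega>) \<partial>M) - (\<integral>x. h x \<partial>N)) < e"
        using tM tN n2[of n] n unfolding real_norm_def by linarith
    qed
  qed
qed

section \<open>The multivariate normal law as a linear image\<close>

text \<open>Boxes generate the Borel sets, so it suffices to know the factor by which a linear bijection scales
  their volume.\<close>
lemma lborel_linear_image:
  fixes f :: "'a::euclidean_space \<Rightarrow> 'a"
  assumes lin: "linear f" and bij: "bij f" and k: "0 \<le> k"
    and cbox: "\<And>a b. measure lebesgue (f ` cbox a b) = k * measure lebesgue (cbox a b)"
    and S: "S \<in> sets borel"
  shows "emeasure lborel S = ennreal k * emeasure lborel (f -` S)"
proof -
  obtain g where g: "linear g" "g \<circ> f = id" "f \<circ> g = id"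
    using linear_injective_isomorphism[OF lin] bij by (metis bij_is_inj o_def eq_id_iff)
  have [measurable]: "f \<in> borel_measurable borel"
    by (intro borel_measurable_continuous_onI linear_continuous_on) (simp add: lin linear_linear)
  have vim: "f -` B = g ` B" for B
    using g by (auto simp: fun_eq_iff image_iff) metis
  have "lborel = density (distr lborel borel f) (\<lambda>_. ennreal k)"
  proof (rule lborel_eqI)
    fix l u :: 'a assume le: "\<And>b. b \<in> Basis \<Longrightarrow> l \<bullet> b \<le> u \<bullet> b"
    have op: "open (f -` box l u)"
      by (intro open_vimage open_box linear_continuous_on) (simp add: lin linear_linear)
    have bd: "bounded (f -` box l u)"
      unfolding vim using g(1) by (intro bounded_linear_image bounded_box) (simp add: linear_linear)
    have lm: "f -` box l u \<in> lmeasurable" using bd op by (rule lmeasurable_open)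
    have "f ` (f -` box l u) = box l u" using bij by (auto simp: bij_def image_vimage_eq)
    then have "k * measure lebesgue (f -` box l u) = measure lebesgue (box l u)"
      using measure_linear_sufficient[OF lin lm cbox] by simp
    moreover have "emeasure lborel (f -` box l u) = ennreal (measure lebesgue (f -` box l u))"
      using fmeasurableD2[OF lm] op by (simp add: emeasure_eq_ennreal_measure)
    ultimately have "ennreal k * emeasure lborel (f -` box l u) = ennreal (measure lebesgue (box l u))"
      using k by (simp add: ennreal_mult'[symmetric])
    also have "\<dots> = (\<Prod>b\<in>Basis. (u - l) \<bullet> b)" using le by simp
    finally show "emeasure (density (distr lborel borel f) (\<lambda>_. ennreal k)) (box l u) = (\<Prod>b\<in>Basis. (u - l) \<bullet> b)"
      by (simp add: emeasure_density_const emeasure_distr)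
  qed simp
  then have "emeasure lborel S = emeasure (density (distr lborel borel f) (\<lambda>_. ennreal k)) S" by simp
  also have "\<dots> = ennreal k * emeasure lborel (f -` S)"
    using S by (simp add: emeasure_density_const emeasure_distr)
  finally show ?thesis .
qed

lemma bij_matrix_vector_mult:
  fixes A :: "real ^ 'n ^ 'n::finite"
  assumes "det A \<noteq> 0"
  shows "bij ((*v) A)"
  using assms by (simp add: invertible_det_nz[symmetric] invertible_eq_bij)

text \<open>Translating the box along the shearing direction removes the sign condition on \<open>a $ n\<close> in
  \<open>measure_shear_interval\<close>.\<close>
lemma measure_shear_cbox:
  fixes a :: "real ^ 'n::finite"
  assumes mn: "m \<noteq> n"
  defines "h \<equiv> \<lambda>x::real^'n. \<chi> i. if i = m then x $ m + x $ n else x $ i"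
  shows "measure lebesgue (h ` cbox a b) = measure lebesgue (cbox a b)"
proof (cases "cbox a b = {}")
  case False
  define t :: "real^'n" where "t = axis n \<bar>a $ n\<bar>"
  have lin: "linear h"
    unfolding h_def by (rule linearI) (auto simp: vec_eq_iff algebra_simps)
  have tr: "cbox (t + a) (t + b) = (+) t ` cbox a b"
    by (rule cbox_translation)
  have "measure lebesgue (h ` cbox (t + a) (t + b)) = measure lebesgue (cbox (t + a) (t + b))"
    unfolding h_def by (rule measure_shear_interval[OF mn]) (use False tr in \<open>auto simp: t_def\<close>)
  moreover have "h ` cbox (t + a) (t + b) = (+) (h t) ` h ` cbox a b"
    unfolding tr by (simp add: image_image linear_add[OF lin])
  ultimately show ?thesis unfolding tr by (simp add: measure_translation)
qed simp

text \<open>The change of variables formula for an invertible matrix, with an arbitrary finite index type;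
  it suffices to check it on elementary matrices.\<close>
lemma emeasure_lborel_vimage_matrix:
  fixes A :: "real ^ 'n ^ 'n::finite"
  assumes "det A \<noteq> 0" "S \<in> sets borel"
  shows "emeasure lborel S = ennreal \<bar>det A\<bar> * emeasure lborel ((*v) A -` S)"
proof -
  let ?P = "\<lambda>A::real^'n^'n. det A \<noteq> 0 \<longrightarrow>
    (\<forall>S\<in>sets borel. emeasure lborel S = ennreal \<bar>det A\<bar> * emeasure lborel ((*v) A -` S))"
  have lin: "linear ((*v) A)" for A :: "real^'n^'n" by (rule matrix_vector_mul_linear)
  have [measurable]: "(*v) A \<in> borel_measurable borel" for A :: "real^'n^'n"
    by (intro borel_measurable_continuous_onI linear_continuous_on) (simp add: lin linear_linear)
  have "?P A"
  proof (rule induct_matrix_elementary_alt)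
    fix A B :: "real^'n^'n" assume A: "?P A" and B: "?P B"
    show "?P (A ** B)"
    proof (intro impI ballI)
      fix S :: "(real^'n) set" assume "det (A ** B) \<noteq> 0" and S: "S \<in> sets borel"
      then have d: "det A \<noteq> 0" "det B \<noteq> 0" by (auto simp: det_mul)
      have AS: "(*v) A -` S \<in> sets borel" using measurable_sets[of "(*v) A" borel borel S] S by simp
      have "(*v) (A ** B) -` S = (*v) B -` ((*v) A -` S)" by (auto simp: matrix_vector_mul_assoc)
      moreover have "emeasure lborel S = ennreal \<bar>det A\<bar> * (ennreal \<bar>det B\<bar> * emeasure lborel ((*v) B -` ((*v) A -` S)))"
        using A B d S AS by simp
      ultimately show "emeasure lborel S = ennreal \<bar>det (A ** B)\<bar> * emeasure lborel ((*v) (A ** B) -` S)"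
        by (simp add: det_mul abs_mult ennreal_mult mult.assoc)
    qed
  next
    fix A :: "real^'n^'n" and i assume "row i A = 0"
    then show "?P A" using det_zero_row(2)[of i A] by simp
  next
    fix A :: "real^'n^'n" assume diag: "\<And>i j. i \<noteq> j \<Longrightarrow> A $ i $ j = 0"
    have "(\<Sum>j\<in>UNIV. A $ k $ j * x $ j) = A $ k $ k * x $ k" for x :: "real^'n" and k
      by (subst sum.remove[of _ k]) (auto intro!: sum.neutral simp: diag)
    then have "A *v x = (\<chi> k. A $ k $ k * x $ k)" for x
      by (simp add: vec_eq_iff matrix_vector_mult_def)
    then have eq: "(*v) A = (\<lambda>x. \<chi> k. A $ k $ k * x $ k)" by auto
    show "?P A"
    proof (intro impI ballI)
      fix S :: "(real^'n) set" assume d: "det A \<noteq> 0" and S: "S \<in> sets borel"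
      show "emeasure lborel S = ennreal \<bar>det A\<bar> * emeasure lborel ((*v) A -` S)"
      proof (rule lborel_linear_image[OF lin bij_matrix_vector_mult[OF d] _ _ S])
        show "measure lebesgue ((*v) A ` cbox a b) = \<bar>det A\<bar> * measure lebesgue (cbox a b)" for a b
          unfolding eq by (subst measure_stretch) (auto simp: det_diagonal[OF diag])
      qed simp
    qed
  next
    fix m n :: 'n assume mn: "m \<noteq> n"
    let ?t = "Transposition.transpose m n"
    let ?A = "(\<chi> i j. mat 1 $ i $ ?t j) :: real^'n^'n"
    have eq: "(*v) ?A = (\<lambda>x. \<chi> i. x $ ?t i)"
    proof (intro ext, simp add: vec_eq_iff matrix_vector_mult_def mat_def, intro allI)
      fix x :: "real^'n" and i
      have "(\<Sum>j\<in>UNIV. (if i = ?t j then 1 else 0) * x $ j) = (\<Sum>j\<in>UNIV. if j = ?t i then x $ j else 0)"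
        by (intro sum.cong) (auto simp: Transposition.transpose_eq_iff)
      then show "(\<Sum>j\<in>UNIV. (if i = ?t j then 1 else 0) * x $ j) = x $ ?t i" by simp
    qed
    have perm: "?t permutes UNIV" by (rule permutes_swap_id) auto
    have det: "\<bar>det ?A\<bar> = 1"
      using det_permute_columns[OF perm, of "mat 1 :: real^'n^'n"] mn by (simp add: sign_swap_id)
    show "?P ?A"
    proof (intro impI ballI)
      fix S :: "(real^'n) set" assume d: "det ?A \<noteq> 0" and S: "S \<in> sets borel"
      show "emeasure lborel S = ennreal \<bar>det ?A\<bar> * emeasure lborel ((*v) ?A -` S)"
      proof (rule lborel_linear_image[OF lin bij_matrix_vector_mult[OF d] _ _ S])
        fix a b :: "real^'n"
        show "measure lebesgue ((*v) ?A ` cbox a b) = \<bar>det ?A\<bar> * measure lebesgue (cbox a b)"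
        proof (cases "cbox a b = {}")
          case False
          let ?h = "\<lambda>x::real^'n. \<chi> i. x $ ?t i"
          have hh: "?h (?h x) = x" for x by (simp add: vec_eq_iff)
          have mem: "?h x \<in> cbox a b \<longleftrightarrow> x \<in> cbox (?h a) (?h b)" for x
            by (auto simp: mem_box_cart) (metis Transposition.transpose_involutory)+
          have im: "?h ` cbox a b = cbox (?h a) (?h b)"
          proof (intro equalityI subsetI)
            fix y assume "y \<in> ?h ` cbox a b"
            then obtain x where "x \<in> cbox a b" "y = ?h x" by (rule imageE)
            then show "y \<in> cbox (?h a) (?h b)" using mem[of y] by (simp only: hh)
          next
            fix y assume "y \<in> cbox (?h a) (?h b)"
            then have "?h y \<in> cbox a b" by (simp only: mem)
            then show "y \<in> ?h ` cbox a b" using hh[of y] by (metis image_eqI)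
          qed
          have ne: "cbox (?h a) (?h b) \<noteq> {}" using im False by blast
          have "(\<Prod>i\<in>UNIV. b $ ?t i - a $ ?t i) = (\<Prod>i\<in>UNIV. b $ i - a $ i)"
            using prod.permute[OF perm, of "\<lambda>i. b $ i - a $ i"] by simp
          then show ?thesis
            unfolding det eq im using content_cbox_cart[OF ne] content_cbox_cart[OF False] by simp
        qed simp
      qed simp
    qed
  next
    fix m n :: 'n assume mn: "m \<noteq> n"
    let ?A = "(\<chi> i j. of_bool (i = m \<and> j = n \<or> i = j)) :: real^'n^'n"
    have "(\<Sum>j\<in>UNIV. of_bool (i = m \<and> j = n \<or> i = j) * x $ j) = (if i = m then x $ m + x $ n else x $ i)"
      for x :: "real^'n" and i
    proof -
      have "(\<Sum>j\<in>UNIV. of_bool (i = m \<and> j = n \<or> i = j) * x $ j)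
          = (\<Sum>j\<in>UNIV. (if j = i then x $ j else 0) + (if j = n then of_bool (i = m) * x $ j else 0))"
        using mn by (intro sum.cong) auto
      then show ?thesis by (simp add: sum.distrib)
    qed
    then have eq: "(*v) ?A = (\<lambda>x. \<chi> i. if i = m then x $ m + x $ n else x $ i)"
      unfolding matrix_vector_mult_def by (simp only: vec_lambda_beta)
    have "?A = (\<chi> k. if k = m then row m (mat 1) + 1 *s row n (mat 1) else row k (mat 1))"
      using mn by (auto simp: vec_eq_iff row_def mat_def)
    then have det: "det ?A = 1"
      using det_row_operation[OF mn, of "mat 1" 1] by (simp add: det_I)
    show "?P ?A"
    proof (intro impI ballI)
      fix S :: "(real^'n) set" assume d: "det ?A \<noteq> 0" and S: "S \<in> sets borel"
      show "emeasure lborel S = ennreal \<bar>det ?A\<bar> * emeasure lborel ((*v) ?A -` S)"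
        by (rule lborel_linear_image[OF lin bij_matrix_vector_mult[OF d] _ _ S])
          (unfold eq det measure_shear_cbox[OF mn], auto)
    qed
  qed
  then show ?thesis using assms by blast
qed

text \<open>Gram--Schmidt for the inner product defined by \<open>P\<close>: the columns of \<open>A\<close> are orthonormal for it. The
  induction adds one index at a time; a vector outside the span of the previous columns exists as
  long as not all indices have been used.\<close>
lemma positive_definite_orthonormal:
  fixes P :: "real ^ 'n ^ 'n::finite"
  assumes P: "positive_definite P"
  obtains A :: "real ^ 'n ^ 'n" where "transpose A ** P ** A = mat 1"
proof -
  have sym: "x \<bullet> (P *v y) = y \<bullet> (P *v x)" for x y
    using P by (metis dot_lmul_matrix inner_commute positive_definite_def transpose_matrix_vector)
  have pos: "x \<noteq> 0 \<Longrightarrow> 0 < x \<bullet> (P *v x)" for x using P by (simp add: positive_definite_def)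
  have "finite I \<Longrightarrow> \<exists>v::'n \<Rightarrow> real^'n. \<forall>i\<in>I. \<forall>j\<in>I. v i \<bullet> (P *v v j) = of_bool (i = j)" for I :: "'n set"
  proof (induction I rule: finite_induct)
    case (insert k I)
    then obtain v :: "'n \<Rightarrow> real^'n" where v: "\<And>i j. i \<in> I \<Longrightarrow> j \<in> I \<Longrightarrow> v i \<bullet> (P *v v j) = of_bool (i = j)" by blast
    have "dim (v ` I) \<le> card (v ` I)" using insert by (intro dim_le_card') auto
    also have "\<dots> \<le> card I" using insert by (intro card_image_le)
    also have "\<dots> < card (insert k I)" using insert by simp
    also have "\<dots> \<le> CARD('n)" by (intro card_mono) auto
    finally have "dim (v ` I) < DIM(real^'n)" by simp
    then have "span (v ` I) \<noteq> UNIV" by (metis dim_UNIV dim_span less_irrefl)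
    then obtain x where x: "x \<notin> span (v ` I)" by blast
    define y where "y = x - (\<Sum>i\<in>I. (x \<bullet> (P *v v i)) *\<^sub>R v i)"
    have "(\<Sum>i\<in>I. (x \<bullet> (P *v v i)) *\<^sub>R v i) \<in> span (v ` I)"
      by (intro span_sum span_scale span_base) auto
    then have "y \<noteq> 0" using x by (auto simp: y_def)
    then have py: "0 < y \<bullet> (P *v y)" by (rule pos)
    have yo: "y \<bullet> (P *v v j) = 0" if "j \<in> I" for j
    proof -
      have "(\<Sum>i\<in>I. x \<bullet> (P *v v i) * (v i \<bullet> (P *v v j))) = (\<Sum>i\<in>I. if i = j then x \<bullet> (P *v v i) else 0)"
        using v that by (intro sum.cong) auto
      also have "\<dots> = x \<bullet> (P *v v j)" using insert that by simp
      finally show ?thesis by (simp add: y_def inner_diff_left inner_sum_left)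
    qed
    define w where "w = (1 / sqrt (y \<bullet> (P *v y))) *\<^sub>R y"
    have wo: "w \<bullet> (P *v v j) = 0" "v j \<bullet> (P *v w) = 0" if "j \<in> I" for j
      using yo[OF that] sym[of "v j" w] by (auto simp: w_def)
    have ww: "w \<bullet> (P *v w) = 1"
      using py by (simp add: w_def matrix_vector_mult_scaleR)
    have "\<forall>i\<in>insert k I. \<forall>j\<in>insert k I. (v(k := w)) i \<bullet> (P *v (v(k := w)) j) = of_bool (i = j)"
      using insert(2) wo ww v by auto
    then show ?case by (rule exI[of _ "v(k := w)"])
  qed simp
  then obtain v :: "'n \<Rightarrow> real^'n" where v: "\<And>i j. v i \<bullet> (P *v v j) = of_bool (i = j)"
    by (metis finite UNIV_I)
  define A where "A = (\<chi> r c. v c $ r)"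
  have "(transpose A ** (P ** A)) $ i $ j = v i \<bullet> (P *v v j)" for i j
    by (simp add: A_def matrix_matrix_mult_def matrix_vector_mult_def transpose_def inner_vec_def)
  then have "transpose A ** P ** A = mat 1"
    by (simp add: vec_eq_iff v mat_def matrix_mul_assoc[symmetric])
  then show ?thesis by (rule that)
qed

text \<open>Since \<open>transpose A ** P ** A = mat 1\<close>, the exponent \<open>x \<bullet> (P *v x)\<close> at \<open>x = A *v z\<close> is \<open>(norm z)\<^sup>2\<close>, and the
  determinants match as \<open>det S = (det A)\<^sup>2\<close>. In particular the density integrates to one.\<close>
lemma multivariate_normal_eq_distr:
  fixes P S A :: "real ^ 'n ^ 'n::finite"
  assumes SP: "S ** P = mat 1" "P ** S = mat 1" and A: "transpose A ** P ** A = mat 1"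
  shows "multivariate_normal 0 S = distr std_gaussian borel ((*v) A)"
proof -
  have inv: "matrix_inv S = P" 
  proof -
    have "S ** matrix_inv S = mat 1 \<and> matrix_inv S ** S = mat 1"
      unfolding matrix_inv_def by (rule someI[of _ P]) (use SP in simp)
    then have "matrix_inv S ** S = mat 1" by simp
    then have "matrix_inv S ** S ** P = P" by simp
    then show ?thesis by (simp add: matrix_mul_assoc[symmetric] SP)
  qed
  have d: "(det A)\<^sup>2 * det P = 1" "det S * det P = 1"
    using arg_cong[OF A, of det] arg_cong[OF SP(1), of det] by (auto simp: det_mul power2_eq_square mult_ac det_I)
  then have dA: "det A \<noteq> 0" and "det P \<noteq> 0" by auto
  then have dS: "det S = (det A)\<^sup>2" using d by (metis mult_cancel_right)
  have [measurable]: "(*v) B \<in> borel_measurable borel" for B :: "real^'n^'n"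
    by (intro borel_measurable_continuous_onI linear_continuous_on)
      (simp add: matrix_vector_mul_linear linear_linear)
  have quad: "(A *v z) \<bullet> (P *v (A *v z)) = (norm z)\<^sup>2" for z
  proof -
    have "(A *v z) \<bullet> (P *v (A *v z)) = z \<bullet> ((transpose A ** P ** A) *v z)"
      by (simp add: matrix_vector_mul_assoc[symmetric] inner_commute[of z] dot_lmul_matrix[symmetric]) (metis dot_lmul_matrix inner_commute transpose_matrix_vector)
    then show ?thesis by (simp add: A power2_norm_eq_inner)
  qed
  let ?f = "\<lambda>x. ennreal (exp (- ((x - 0) \<bullet> (matrix_inv S *v (x - 0))) / 2) / sqrt ((2 * pi) ^ CARD('n) * det S))"
  have lb: "lborel = density (distr lborel borel ((*v) A)) (\<lambda>_. ennreal \<bar>det A\<bar>)"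
  proof (rule measure_eqI)
    fix B :: "(real^'n) set" assume "B \<in> sets lborel"
    then show "emeasure lborel B = emeasure (density (distr lborel borel ((*v) A)) (\<lambda>_. ennreal \<bar>det A\<bar>)) B"
      using emeasure_lborel_vimage_matrix[OF dA, of B] by (simp add: emeasure_density_const emeasure_distr)
  qed simp
  have dens: "ennreal \<bar>det A\<bar> * ?f (A *v z) = ennreal (\<Prod>b\<in>Basis. std_normal_density (z \<bullet> b))" for z
  proof -
    have "sqrt ((2 * pi) ^ CARD('n) * det S) = sqrt (2 * pi) ^ CARD('n) * \<bar>det A\<bar>"
      unfolding dS real_sqrt_mult[of "(2 * pi) ^ CARD('n)"] real_sqrt_abs by (simp only: real_sqrt_power)
    then show ?thesis
      using dA by (simp add: inv quad prod_std_normal_density ennreal_mult[symmetric])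
  qed
  show ?thesis
  proof (rule measure_eqI)
    show "sets (multivariate_normal 0 S) = sets (distr std_gaussian borel ((*v) A))"
      by (simp add: multivariate_normal_def)
    fix B assume "B \<in> sets (multivariate_normal 0 S)"
    then have [measurable]: "B \<in> sets borel" by (simp add: multivariate_normal_def)
    have "emeasure (multivariate_normal 0 S) B = (\<integral>\<^sup>+x. ?f x * indicator B x \<partial>lborel)"
      unfolding multivariate_normal_def inv by (subst emeasure_density) auto
    also have "\<dots> = (\<integral>\<^sup>+z. ennreal \<bar>det A\<bar> * (?f (A *v z) * indicator B (A *v z)) \<partial>lborel)"
      unfolding inv by (subst lb, subst nn_integral_density) (auto simp: nn_integral_distr)
    also have "\<dots> = (\<integral>\<^sup>+z. ennreal (\<Prod>b\<in>Basis. std_normal_density (z \<bullet> b)) * indicator ((*v) A -` B) z \<partial>lborel)"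
      by (intro nn_integral_cong) (simp only: mult.assoc[symmetric] dens, simp add: indicator_def)
    also have "\<dots> = emeasure (distr std_gaussian borel ((*v) A)) B"
      using measurable_sets[of "(*v) A" borel borel B]
      by (simp add: emeasure_distr std_gaussian_def emeasure_density)
    finally show "emeasure (multivariate_normal 0 S) B = emeasure (distr std_gaussian borel ((*v) A)) B" .
  qed
qed

section \<open>A central limit theorem for weighted sums\<close>

text \<open>Second-order expansion of the characteristic function of each summand: a product of factors
  close to \<open>1 - v a\<^sup>2 / 2\<close> is close to the product of \<open>exp (- v a\<^sup>2 / 2)\<close> once all weights are small.\<close>
lemma (in prob_space) weighted_sum_char_tendsto:
  fixes \<psi> :: "nat \<Rightarrow> 'a \<Rightarrow> real" and a :: "nat \<Rightarrow> nat \<Rightarrow> real"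
  assumes indep: "indep_vars (\<lambda>_. borel) \<psi> {1..}"
    and bound: "\<And>i \<omega>. 1 \<le> i \<Longrightarrow> \<bar>\<psi> i \<omega>\<bar> \<le> 1"
    and mean: "\<And>i. 1 \<le> i \<Longrightarrow> expectation (\<psi> i) = 0"
    and var: "\<And>i. 1 \<le> i \<Longrightarrow> expectation (\<lambda>\<omega>. (\<psi> i \<omega>)\<^sup>2) = v"
    and small: "\<And>e. 0 < e \<Longrightarrow> \<forall>\<^sub>F n in sequentially. \<forall>i\<in>{1..n}. \<bar>a n i\<bar> \<le> e"
    and squares: "(\<lambda>n. \<Sum>i=1..n. (a n i)\<^sup>2) \<longlonglongrightarrow> s"
  shows "(\<lambda>n. CLINT \<omega>|M. iexp (\<Sum>i=1..n. a n i * \<psi> i \<omega>)) \<longlonglongrightarrow> exp (- (v * s) / 2)"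
proof -
  have rv[measurable]: "random_variable borel (\<psi> i)" if "1 \<le> i" for i
    using indep that by (auto simp: indep_vars_def)
  have int1: "integrable M (\<psi> i)" and int2: "integrable M (\<lambda>\<omega>. (\<psi> i \<omega>)\<^sup>2)" if "1 \<le> i" for i
  proof -
    note [measurable] = rv[OF that]
    show "integrable M (\<psi> i)"
      by (rule integrable_const_bound[where B=1]) (use bound that in auto)
    show "integrable M (\<lambda>\<omega>. (\<psi> i \<omega>)\<^sup>2)"
      by (rule integrable_const_bound[where B=1]) (use bound that in \<open>auto simp: abs_square_le_1\<close>)
  qed
  have v01: "0 \<le> v" "v \<le> 1"
  proof -
    have "v = expectation (\<lambda>\<omega>. (\<psi> 1 \<omega>)\<^sup>2)" using var by simp
    then show "0 \<le> v" by simp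
    show "v \<le> 1" unfolding var[of 1, OF order_refl, symmetric]
      using int2[of 1] bound[of 1] by (intro integral_le_const) (auto simp: abs_square_le_1)
  qed
  define ch where "ch n i = char (distr M borel (\<lambda>\<omega>. a n i * \<psi> i \<omega>)) 1" for n i
  have prod_ch: "(CLINT \<omega>|M. iexp (\<Sum>i=1..n. a n i * \<psi> i \<omega>)) = (\<Prod>i=1..n. ch n i)" for n
  proof -
    have "(CLINT \<omega>|M. iexp (\<Sum>i=1..n. a n i * \<psi> i \<omega>))
        = char (distr M borel (\<lambda>\<omega>. \<Sum>i=1..n. a n i * \<psi> i \<omega>)) 1"
      unfolding char_def by (subst integral_distr) auto
    also have "\<dots> = (\<Prod>i=1..n. ch n i)"
      unfolding ch_def
    proof (rule char_distr_sum)
      show "indep_vars (\<lambda>i. borel) (\<lambda>i \<omega>. a n i * \<psi> i \<omega>) {1..n}"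
        by (rule indep_vars_compose2[OF indep_vars_subset[OF indep]]) auto
    qed
    finally show ?thesis .
  qed
  have ch_le: "norm (ch n i) \<le> 1" if "1 \<le> i" for n i
  proof -
    interpret R: real_distribution "distr M borel (\<lambda>\<omega>. a n i * \<psi> i \<omega>)"
      using rv[OF that] by (intro real_distribution_distr) auto
    show ?thesis unfolding ch_def by (rule R.cmod_char_le_1)
  qed
  \<comment> \<open>if \<open>\<bar>a\<bar> \<le> e\<close>, the errors of all factors together are at most \<open>e\<close> times the sum of the squared weights\<close>
  have approx: "norm (ch n i - exp (- v * (a n i)\<^sup>2 / 2)) \<le> e * (a n i)\<^sup>2"
    if i: "1 \<le> i" and a: "\<bar>a n i\<bar> \<le> e" and e: "e \<le> 1" for n i e
  proof -
    let ?a = "a n i"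
    note [measurable] = rv[OF i]
    have "norm (ch n i - (1 - 1\<^sup>2 * (?a\<^sup>2 * v) / 2))
        \<le> 1\<^sup>2 / 6 * expectation (\<lambda>\<omega>. min (6 * (?a * \<psi> i \<omega>)\<^sup>2) (\<bar>1\<bar> * \<bar>?a * \<psi> i \<omega>\<bar> ^ 3))"
      unfolding ch_def
    proof (rule char_approx3'[OF _ _ _ _ _ refl])
      show "integrable M (\<lambda>x. ?a * \<psi> i x)" using int1[OF i] by simp
      show "integrable M (\<lambda>x. (?a * \<psi> i x)\<^sup>2)" using int2[OF i] by (simp add: power_mult_distrib)
      show "expectation (\<lambda>x. ?a * \<psi> i x) = 0" using mean[OF i] by simp
      then show "variance (\<lambda>x. ?a * \<psi> i x) = ?a\<^sup>2 * v" using var[OF i] mean[OF i] by (simp add: power_mult_distrib)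
    qed auto
    also have "\<dots> \<le> 1 / 6 * (e * ?a\<^sup>2)"
    proof -
      have le: "min (6 * (?a * \<psi> i \<omega>)\<^sup>2) (\<bar>1\<bar> * \<bar>?a * \<psi> i \<omega>\<bar> ^ 3) \<le> e * ?a\<^sup>2" for \<omega>
      proof -
        have "\<bar>?a * \<psi> i \<omega>\<bar> ^ 3 = (\<bar>?a\<bar> * ?a\<^sup>2) * \<bar>\<psi> i \<omega>\<bar> ^ 3"
          unfolding abs_mult power_mult_distrib power2_abs[of ?a, symmetric]
          by (simp only: power3_eq_cube power2_eq_square mult_ac)
        also have "\<dots> \<le> (e * ?a\<^sup>2) * 1"
          using a bound[OF i] by (intro mult_mono power_le_one) auto
        finally show ?thesis by simp
      qed
      have "expectation (\<lambda>\<omega>. min (6 * (?a * \<psi> i \<omega>)\<^sup>2) (\<bar>1\<bar> * \<bar>?a * \<psi> i \<omega>\<bar> ^ 3)) \<le> e * ?a\<^sup>2"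
      proof (rule integral_le_const)
        show "integrable M (\<lambda>\<omega>. min (6 * (?a * \<psi> i \<omega>)\<^sup>2) (\<bar>1\<bar> * \<bar>?a * \<psi> i \<omega>\<bar> ^ 3))"
          by (rule integrable_const_bound[where B="e * ?a\<^sup>2"]) (use le in auto)
      qed (use le in auto)
      then show ?thesis by simp
    qed
    finally have 1: "norm (ch n i - (1 - v * ?a\<^sup>2 / 2)) \<le> e * ?a\<^sup>2 / 6" by (simp add: mult.commute)
    have y: "0 \<le> v * ?a\<^sup>2 / 2" using v01 by simp
    have 2: "norm (complex_of_real (1 - v * ?a\<^sup>2 / 2) - exp (- v * ?a\<^sup>2 / 2)) \<le> e * ?a\<^sup>2 / 2"
    proof -
      let ?y = "v * ?a\<^sup>2 / 2"
      have a1: "\<bar>?a\<bar> \<le> 1" using a e by simp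
      have a2: "?a\<^sup>2 \<le> e * \<bar>?a\<bar>" using a mult_right_mono[OF a, of "\<bar>?a\<bar>"] by (simp add: power2_eq_square)
      have a3: "e * \<bar>?a\<bar> \<le> e" using a a1 by (intro mult_left_le) auto
      have y1: "?y \<le> ?a\<^sup>2 / 2" using v01 by (simp add: mult_left_le_one_le)
      have "1 - ?y \<le> exp (- ?y)" using exp_ge_add_one_self[of "- ?y"] by simp
      moreover have "exp (- ?y) \<le> 1 - ?y + ?y\<^sup>2"
      proof -
        have "?y \<le> 1" using y1 a1 abs_square_le_1[of ?a] by simp
        have "exp (- ?y) \<le> 1 / (1 + ?y)"
          using exp_ge_add_one_self[of ?y] y by (simp add: exp_minus divide_simps)
        also have "\<dots> \<le> 1 - ?y + ?y\<^sup>2"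
        proof -
          have "1 \<le> 1 + ?y ^ 3" using y by simp
          also have "\<dots> = (1 - ?y + ?y\<^sup>2) * (1 + ?y)" by (simp add: algebra_simps power2_eq_square power3_eq_cube)
          finally show ?thesis using y by (simp add: divide_le_eq)
        qed
        finally show ?thesis .
      qed
      moreover have "?y\<^sup>2 \<le> e * ?a\<^sup>2 / 2"
      proof -
        have "?y\<^sup>2 \<le> ?a\<^sup>2 / 2 * (?a\<^sup>2 / 2)" unfolding power2_eq_square[of ?y] using y1 y by (intro mult_mono) auto
        also have "\<dots> \<le> e / 2 * (?a\<^sup>2 / 2)" using a2 a3 by (intro mult_right_mono) auto
        also have "\<dots> \<le> e * ?a\<^sup>2 / 2" using a by (simp add: mult_nonneg_nonneg)
        finally show ?thesis .
      qed
      ultimately have "\<bar>(1 - ?y) - exp (- ?y)\<bar> \<le> e * ?a\<^sup>2 / 2" by linarith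
      then show ?thesis
        unfolding of_real_diff[symmetric] norm_of_real by simp
    qed
    have "norm (ch n i - exp (- v * ?a\<^sup>2 / 2)) \<le> norm (ch n i - (1 - v * ?a\<^sup>2 / 2))
        + norm (complex_of_real (1 - v * ?a\<^sup>2 / 2) - exp (- v * ?a\<^sup>2 / 2))"
      using norm_triangle_ineq[of "ch n i - (1 - v * ?a\<^sup>2 / 2)" "complex_of_real (1 - v * ?a\<^sup>2 / 2) - exp (- v * ?a\<^sup>2 / 2)"] by simp
    also have "\<dots> \<le> e * ?a\<^sup>2 / 6 + e * ?a\<^sup>2 / 2" by (rule add_mono[OF 1 2])
    also have "\<dots> \<le> e * ?a\<^sup>2" using a by (simp add: mult_nonneg_nonneg)
    finally show ?thesis .
  qed
  have prod_exp: "(\<Prod>i=1..n. complex_of_real (exp (- v * (a n i)\<^sup>2 / 2))) = exp (- v * (\<Sum>i=1..n. (a n i)\<^sup>2) / 2)" for n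
    by (simp add: exp_sum [symmetric] sum_distrib_left sum_divide_distrib flip: of_real_prod)
  have "(\<lambda>n. (\<Prod>i=1..n. ch n i) - complex_of_real (exp (- v * (\<Sum>i=1..n. (a n i)\<^sup>2) / 2))) \<longlonglongrightarrow> 0"
  proof (rule tendstoI)
    fix e :: real assume "0 < e"
    define d where "d = min 1 (e / (\<bar>s\<bar> + 2))"
    have d: "0 < d" "d \<le> 1" "d * (\<bar>s\<bar> + 1) < e"
    proof -
      show "0 < d" "d \<le> 1" using \<open>0 < e\<close> by (auto simp: d_def)
      have "d * (\<bar>s\<bar> + 1) \<le> e / (\<bar>s\<bar> + 2) * (\<bar>s\<bar> + 1)" by (intro mult_right_mono) (auto simp: d_def)
      also have "\<dots> < e" using \<open>0 < e\<close> by (simp add: field_simps)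
      finally show "d * (\<bar>s\<bar> + 1) < e" .
    qed
    have "\<forall>\<^sub>F n in sequentially. (\<Sum>i=1..n. (a n i)\<^sup>2) < \<bar>s\<bar> + 1"
      by (rule order_tendstoD[OF squares]) auto
    then show "\<forall>\<^sub>F n in sequentially. dist ((\<Prod>i=1..n. ch n i) - complex_of_real (exp (- v * (\<Sum>i=1..n. (a n i)\<^sup>2) / 2))) 0 < e"
      using small[OF d(1)]
    proof eventually_elim
      case (elim n)
      have "norm ((\<Prod>i=1..n. ch n i) - (\<Prod>i=1..n. complex_of_real (exp (- v * (a n i)\<^sup>2 / 2))))
        \<le> (\<Sum>i=1..n. norm (ch n i - complex_of_real (exp (- v * (a n i)\<^sup>2 / 2))))"
        by (rule norm_prod_diff) (use ch_le v01 in auto)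
      also have "\<dots> \<le> (\<Sum>i=1..n. d * (a n i)\<^sup>2)"
        by (intro sum_mono approx) (use elim d in auto)
      also have "\<dots> = d * (\<Sum>i=1..n. (a n i)\<^sup>2)" by (simp add: sum_distrib_left)
      also have "\<dots> \<le> d * (\<bar>s\<bar> + 1)" using elim d by (intro mult_left_mono) auto
      also note d(3)
      finally show ?case unfolding prod_exp by simp
    qed
  qed
  moreover have "(\<lambda>n. complex_of_real (exp (- v * (\<Sum>i=1..n. (a n i)\<^sup>2) / 2))) \<longlonglongrightarrow> exp (- v * s / 2)"
    by (intro tendsto_intros squares) auto
  ultimately have "(\<lambda>n. ((\<Prod>i=1..n. ch n i) - complex_of_real (exp (- v * (\<Sum>i=1..n. (a n i)\<^sup>2) / 2)))
      + complex_of_real (exp (- v * (\<Sum>i=1..n. (a n i)\<^sup>2) / 2))) \<longlonglongrightarrow> 0 + complex_of_real (exp (- v * s / 2))"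
    by (rule tendsto_add)
  then show ?thesis unfolding prod_ch by simp
qed

section \<open>Properties that hold with high probability in the limit\<close>

context prob_space
begin

text \<open>Probability at least \<open>1 - e\<close> in the limit, in the sense of inner measure: only some event on which
  \<open>P n\<close> holds is required. Hence \<open>P n\<close> may quantify over uncountably many parameters, and a deterministic
  argument can be run on the event.\<close>
definition eventually_prob :: "real \<Rightarrow> (nat \<Rightarrow> 'a \<Rightarrow> bool) \<Rightarrow> bool" where
  "eventually_prob e P \<longleftrightarrow>
     (\<forall>\<^sub>F n in sequentially. \<exists>A\<in>events. 1 - e \<le> prob A \<and> (\<forall>\<omega>\<in>A. P n \<omega>))"

lemma eventually_prob_conj:
  assumes "eventually_prob e1 P" "eventually_prob e2 Q"
  shows "eventually_prob (e1 + e2) (\<lambda>n \<omega>. P n \<omega> \<and> Q n \<omega>)"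
  using assms unfolding eventually_prob_def
proof eventually_elim
  case (elim n)
  then obtain A B where AB: "A \<in> events" "1 - e1 \<le> prob A" "\<forall>\<omega>\<in>A. P n \<omega>"
    "B \<in> events" "1 - e2 \<le> prob B" "\<forall>\<omega>\<in>B. Q n \<omega>" by blast
  have "prob (A \<union> B) = prob A + prob B - prob (A \<inter> B)"
    using AB by (simp add: measure_Un3 fmeasurable_eq_sets)
  then have "1 - (e1 + e2) \<le> prob (A \<inter> B)" using AB prob_le_1[of "A \<union> B"] by linarith
  then show ?case using AB by (intro bexI[of _ "A \<inter> B"]) auto
qed

lemma eventually_prob_mono:
  assumes "eventually_prob e P" and "\<forall>\<^sub>F n in sequentially. \<forall>\<omega>\<in>space M. P n \<omega> \<longrightarrow> Q n \<omega>"
  shows "eventually_prob e Q"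
  using assms unfolding eventually_prob_def
proof eventually_elim
  case (elim n)
  then show ?case using sets.sets_into_space by fast
qed

lemma eventually_prob_elim:
  assumes "eventually_prob e P" "eventually R sequentially"
    and "\<And>n \<omega>. R n \<Longrightarrow> P n \<omega> \<Longrightarrow> \<omega> \<in> space M \<Longrightarrow> Q n \<omega>"
  shows "eventually_prob e Q"
  using assms(1) by (rule eventually_prob_mono) (use assms(2,3) in \<open>auto elim: eventually_mono\<close>)

lemma eventually_prob_ball:
  assumes "finite S" and "\<And>x e. x \<in> S \<Longrightarrow> 0 < e \<Longrightarrow> eventually_prob e (P x)" and "0 < (e::real)"
  shows "eventually_prob e (\<lambda>n \<omega>. \<forall>x\<in>S. P x n \<omega>)"
  using assms
proof (induction S arbitrary: e rule: finite_induct)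
  case empty
  have "\<exists>A\<in>events. 1 - e \<le> prob A" using \<open>0 < e\<close> prob_space by (intro bexI[of _ "space M"]) auto
  then show ?case by (simp add: eventually_prob_def)
next
  case (insert x S)
  have "eventually_prob (e / 2) (P x)" using insert.prems by simp
  moreover have "eventually_prob (e / 2) (\<lambda>n \<omega>. \<forall>x\<in>S. P x n \<omega>)" using insert by simp
  ultimately have "eventually_prob (e / 2 + e / 2) (\<lambda>n \<omega>. P x n \<omega> \<and> (\<forall>x\<in>S. P x n \<omega>))"
    by (rule eventually_prob_conj)
  then show ?case by simp
qed

lemma eventually_prob_Markov:
  fixes X :: "nat \<Rightarrow> 'a \<Rightarrow> real"
  assumes int: "\<And>n. integrable M (X n)" and nonneg: "\<And>n \<omega>. 0 \<le> X n \<omega>"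
    and le: "\<forall>\<^sub>F n in sequentially. expectation (X n) \<le> C" and "0 < C" "0 < e"
  shows "eventually_prob e (\<lambda>n \<omega>. X n \<omega> < C / e)"
  using le unfolding eventually_prob_def
proof eventually_elim
  case (elim n)
  note [measurable] = borel_measurable_integrable[OF int[of n]]
  let ?B = "{\<omega>\<in>space M. C / e \<le> X n \<omega>}"
  have "prob ?B \<le> expectation (X n) / (C / e)"
    by (rule integral_Markov_inequality_measure[OF int, where A="{}"]) (use nonneg assms in auto)
  also have "\<dots> \<le> C / (C / e)" using elim assms by (intro divide_right_mono) auto
  also have "\<dots> = e" using assms by simp
  finally have "1 - e \<le> prob (space M - ?B)" by (subst prob_compl) auto
  then show ?case by (intro bexI[of _ "space M - ?B"]) auto
qed

lemma eventually_prob_Chebyshev: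
  fixes X :: "nat \<Rightarrow> 'a \<Rightarrow> real"
  assumes int: "\<And>n. integrable M (\<lambda>\<omega>. (X n \<omega>)\<^sup>2)"
    and lim: "(\<lambda>n. expectation (\<lambda>\<omega>. (X n \<omega>)\<^sup>2)) \<longlonglongrightarrow> 0" and "0 < d" "0 < e"
  shows "eventually_prob e (\<lambda>n \<omega>. \<bar>X n \<omega>\<bar> \<le> d)"
proof -
  have "\<forall>\<^sub>F n in sequentially. expectation (\<lambda>\<omega>. (X n \<omega>)\<^sup>2) < d\<^sup>2 * e"
    using assms by (intro order_tendstoD[OF lim]) auto
  then have "\<forall>\<^sub>F n in sequentially. expectation (\<lambda>\<omega>. (X n \<omega>)\<^sup>2) \<le> d\<^sup>2 * e"
    by eventually_elim simp
  from eventually_prob_Markov[OF int _ this, of e]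
  have "eventually_prob e (\<lambda>n \<omega>. (X n \<omega>)\<^sup>2 < d\<^sup>2 * e / e)"
    using \<open>0 < d\<close> \<open>0 < e\<close> by (simp del: times_divide_eq_right nonzero_mult_div_cancel_right)
  then show ?thesis
  proof (rule eventually_prob_mono[OF _ always_eventually], intro allI ballI impI)
    fix n \<omega> assume "(X n \<omega>)\<^sup>2 < d\<^sup>2 * e / e"
    then have "\<bar>X n \<omega>\<bar>\<^sup>2 \<le> d\<^sup>2" using \<open>0 < e\<close> by simp
    then show "\<bar>X n \<omega>\<bar> \<le> d" using \<open>0 < d\<close> by (simp only: abs_le_square_iff[symmetric])
  qed
qed

lemma eventually_prob_imp_tendsto_1:
  assumes "\<And>e. 0 < e \<Longrightarrow> eventually_prob e P"
    and meas: "\<forall>\<^sub>F n in sequentially. {\<omega>\<in>space M. P n \<omega>} \<in> events"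
  shows "(\<lambda>n. prob {\<omega>\<in>space M. P n \<omega>}) \<longlonglongrightarrow> 1"
proof (rule order_tendstoI)
  fix a :: real assume "a < 1"
  have "eventually_prob ((1 - a) / 2) P" using assms \<open>a < 1\<close> by simp
  then show "\<forall>\<^sub>F n in sequentially. a < prob {\<omega>\<in>space M. P n \<omega>}"
    using meas unfolding eventually_prob_def
  proof eventually_elim
    case (elim n)
    then obtain A where A: "A \<in> events" "1 - (1 - a) / 2 \<le> prob A" "\<forall>\<omega>\<in>A. P n \<omega>" by blast
    then have "prob A \<le> prob {\<omega>\<in>space M. P n \<omega>}"
      using elim sets.sets_into_space by (intro finite_measure_mono) auto
    moreover have "a < 1 - (1 - a) / 2" using \<open>a < 1\<close> by (simp add: field_simps)
    ultimately show ?case using A by linarith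
  qed
next
  fix a :: real assume "1 < a"
  then show "\<forall>\<^sub>F n in sequentially. prob {\<omega>\<in>space M. P n \<omega>} < a"
    by (intro always_eventually allI) (meson le_less_trans prob_le_1)
qed

text \<open>Slutsky's theorem on the level of characteristic functions, where it only needs that
  \<open>iexp\<close> is bounded and Lipschitz.\<close>
lemma cf_tendsto_perturb:
  fixes U V :: "nat \<Rightarrow> 'a \<Rightarrow> real"
  assumes meas: "\<And>n. random_variable borel (U n)" "\<And>n. random_variable borel (V n)"
    and close: "\<And>d e. 0 < d \<Longrightarrow> 0 < e \<Longrightarrow> eventually_prob e (\<lambda>n \<omega>. \<bar>U n \<omega> - V n \<omega>\<bar> \<le> d)"
    and lim: "(\<lambda>n. CLINT \<omega>|M. iexp (V n \<omega>)) \<longlonglongrightarrow> l"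
  shows "(\<lambda>n. CLINT \<omega>|M. iexp (U n \<omega>)) \<longlonglongrightarrow> l"
proof -
  note [measurable] = meas
  have iexp_diff: "norm (iexp x - iexp y) \<le> min 2 \<bar>x - y\<bar>" for x y :: real
  proof -
    have "iexp x - iexp y = iexp y * (iexp (x - y) - 1)"
      by (simp add: algebra_simps exp_add[symmetric])
    then have "norm (iexp x - iexp y) = norm (iexp (x - y) - 1)" by (simp add: norm_mult)
    also have "\<dots> \<le> \<bar>x - y\<bar>" using iexp_approx1[of "x - y" 0] by simp
    moreover have "norm (iexp x - iexp y) \<le> norm (iexp x) + norm (iexp y)" by (rule norm_triangle_ineq4)
    ultimately show ?thesis by simp
  qed
  have "(\<lambda>n. (CLINT \<omega>|M. iexp (U n \<omega>)) - (CLINT \<omega>|M. iexp (V n \<omega>))) \<longlonglongrightarrow> 0"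
  proof (rule tendstoI)
    fix e :: real assume e: "0 < e"
    have "eventually_prob (e / 6) (\<lambda>n \<omega>. \<bar>U n \<omega> - V n \<omega>\<bar> \<le> e / 3)" by (rule close) (use e in auto)
    then show "\<forall>\<^sub>F n in sequentially. dist ((CLINT \<omega>|M. iexp (U n \<omega>)) - (CLINT \<omega>|M. iexp (V n \<omega>))) 0 < e"
      unfolding eventually_prob_def
    proof eventually_elim
      case (elim n)
      then obtain A where A[measurable]: "A \<in> events" and pA: "1 - e / 6 \<le> prob A"
        and close_A: "\<And>\<omega>. \<omega> \<in> A \<Longrightarrow> \<bar>U n \<omega> - V n \<omega>\<bar> \<le> e / 3" by blast
      have i: "integrable M (\<lambda>\<omega>. iexp (U n \<omega>))" "integrable M (\<lambda>\<omega>. iexp (V n \<omega>))"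
        using meas by (auto intro: integrable_iexp)
      have "norm ((CLINT \<omega>|M. iexp (U n \<omega>)) - (CLINT \<omega>|M. iexp (V n \<omega>)))
          = norm (CLINT \<omega>|M. iexp (U n \<omega>) - iexp (V n \<omega>))" using i by simp
      also have "\<dots> \<le> (\<integral>\<omega>. norm (iexp (U n \<omega>) - iexp (V n \<omega>)) \<partial>M)" by (rule integral_norm_bound)
      also have "\<dots> \<le> (\<integral>\<omega>. e / 3 + 2 * indicator (space M - A) \<omega> \<partial>M)"
      proof (rule integral_mono)
        show "integrable M (\<lambda>\<omega>. norm (iexp (U n \<omega>) - iexp (V n \<omega>)))" using i by (intro integrable_norm) simp
        show "integrable M (\<lambda>\<omega>. e / 3 + 2 * indicat_real (space M - A) \<omega>)"
          by (rule integrable_const_bound[where B="e / 3 + 2"]) (use e in \<open>auto simp: indicator_def\<close>)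
        fix \<omega> assume "\<omega> \<in> space M"
        then show "norm (iexp (U n \<omega>) - iexp (V n \<omega>)) \<le> e / 3 + 2 * indicator (space M - A) \<omega>"
          using iexp_diff[of "U n \<omega>" "V n \<omega>"] close_A[of \<omega>] e by (cases "\<omega> \<in> A") auto
      qed
      also have "\<dots> = e / 3 + 2 * prob (space M - A)"
      proof -
        have "integrable M (\<lambda>\<omega>. 2 * indicat_real (space M - A) \<omega>)"
          by (rule integrable_const_bound[where B=2]) (auto simp: indicator_def)
        then show ?thesis using prob_space by (subst Bochner_Integration.integral_add) auto
      qed
      also have "\<dots> < e" using pA e prob_compl[OF A] by simp
      finally show ?case by simp
    qed
  qed
  from tendsto_add[OF this lim] show ?thesis by simp
qed

lemma integrable_square_bounded:
  fixes X :: "'a \<Rightarrow> real"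
  assumes "random_variable borel X" and bnd: "\<And>\<omega>. \<bar>X \<omega>\<bar> \<le> c"
  shows "integrable M (\<lambda>\<omega>. (X \<omega>)\<^sup>2)"
proof (rule integrable_const_bound[where B="c\<^sup>2"])
  have "\<bar>X \<omega>\<bar>\<^sup>2 \<le> c\<^sup>2" for \<omega> by (rule power_mono[OF bnd]) simp
  then show "AE \<omega> in M. norm ((X \<omega>)\<^sup>2) \<le> c\<^sup>2" by simp
qed (use assms in simp)

lemma expectation_square_sum_indep:
  fixes X :: "'i \<Rightarrow> 'a \<Rightarrow> real"
  assumes "finite I" "indep_vars (\<lambda>_. borel) X I"
    and "\<And>i \<omega>. i \<in> I \<Longrightarrow> \<bar>X i \<omega>\<bar> \<le> c i" and "\<And>i. i \<in> I \<Longrightarrow> expectation (X i) = 0"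
  shows "expectation (\<lambda>\<omega>. (\<Sum>i\<in>I. X i \<omega>)\<^sup>2) = (\<Sum>i\<in>I. expectation (\<lambda>\<omega>. (X i \<omega>)\<^sup>2))"
  using assms
proof (induction I rule: finite_induct)
  case (insert k I)
  let ?S = "\<lambda>\<omega>. \<Sum>i\<in>I. X i \<omega>"
  have [measurable]: "random_variable borel (X i)" if "i \<in> insert k I" for i
    using insert.prems(1) that by (auto simp: indep_vars_def)
  have b: "\<bar>?S \<omega>\<bar> \<le> (\<Sum>i\<in>I. c i)" for \<omega>
    using insert.prems(2) by (intro order_trans[OF sum_abs] sum_mono) auto
  have iX: "integrable M (X i)" if "i \<in> insert k I" for i
    by (rule integrable_const_bound[where B="c i"]) (use insert.prems(2) that in auto)
  have iS: "integrable M ?S" using iX by (intro Bochner_Integration.integrable_sum) auto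
  have iX2: "integrable M (\<lambda>\<omega>. (X k \<omega>)\<^sup>2)"
    by (rule integrable_square_bounded) (use insert.prems(2) in auto)
  have iS2: "integrable M (\<lambda>\<omega>. (?S \<omega>)\<^sup>2)"
    by (rule integrable_square_bounded[OF _ b]) simp
  have ind: "indep_var borel (X k) borel ?S"
    by (rule indep_vars_sum) (use insert in auto)
  have iP: "integrable M (\<lambda>\<omega>. X k \<omega> * ?S \<omega>)" by (rule indep_var_integrable[OF ind]) (use iX iS in auto)
  have "expectation (\<lambda>\<omega>. X k \<omega> * ?S \<omega>) = expectation (X k) * expectation ?S"
    by (rule indep_var_lebesgue_integral[OF ind]) (use iX iS in auto)
  then have P0: "expectation (\<lambda>\<omega>. X k \<omega> * ?S \<omega>) = 0" using insert.prems(3) by simp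
  have "expectation (\<lambda>\<omega>. (\<Sum>i\<in>insert k I. X i \<omega>)\<^sup>2)
      = expectation (\<lambda>\<omega>. (X k \<omega>)\<^sup>2 + 2 * (X k \<omega> * ?S \<omega>) + (?S \<omega>)\<^sup>2)"
    using insert.hyps by (simp add: power2_sum algebra_simps)
  also have "\<dots> = expectation (\<lambda>\<omega>. (X k \<omega>)\<^sup>2) + expectation (\<lambda>\<omega>. (?S \<omega>)\<^sup>2)"
    using iX2 iP iS2 P0 by simp
  also have "expectation (\<lambda>\<omega>. (?S \<omega>)\<^sup>2) = (\<Sum>i\<in>I. expectation (\<lambda>\<omega>. (X i \<omega>)\<^sup>2))"
    using insert.prems by (intro insert.IH indep_vars_subset[OF insert.prems(1)]) auto
  finally show ?case using insert.hyps by simp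
qed simp

end

section \<open>The check function and its local expansion\<close>

text \<open>A subgradient of the check function at \<open>r\<close>.\<close>
definition check_score :: "real \<Rightarrow> real \<Rightarrow> real" where
  "check_score \<tau> r = \<tau> - indicator {..0} r"

text \<open>The integral of \<open>indicator {..v} r - indicator {..0} r\<close> over \<open>v\<close> from \<open>0\<close> to \<open>s\<close>, in closed form.\<close>
definition knight_remainder :: "real \<Rightarrow> real \<Rightarrow> real" where
  "knight_remainder r s = (if 0 < r then max 0 (s - r) else max 0 (r - s))"

lemma check_loss_eq_max:
  assumes "0 \<le> \<tau>" "\<tau> \<le> 1"
  shows "check_loss \<tau> r = max (\<tau> * r) ((\<tau> - 1) * r)"
proof (cases "0 < r")
  case True
  then have "(\<tau> - 1) * r \<le> \<tau> * r" by (intro mult_right_mono) auto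
  then show ?thesis using True by (simp add: check_loss_def max_def mult.commute)
next
  case False
  then have "\<tau> * r \<le> (\<tau> - 1) * r" by (intro mult_right_mono_neg) auto
  then show ?thesis using False by (simp add: check_loss_def max_def algebra_simps)
qed

lemma check_loss_convex:
  assumes "0 \<le> \<tau>" "\<tau> \<le> 1" "0 \<le> t" "t \<le> 1"
  shows "check_loss \<tau> ((1 - t) * x + t * y) \<le> (1 - t) * check_loss \<tau> x + t * check_loss \<tau> y"
proof -
  have "c * ((1 - t) * x + t * y) \<le> (1 - t) * m + t * m'" if "c * x \<le> m" "c * y \<le> m'" for c m m'
  proof -
    have "(1 - t) * (c * x) + t * (c * y) \<le> (1 - t) * m + t * m'"
      using that assms by (intro add_mono mult_left_mono) auto
    then show ?thesis by (simp add: algebra_simps)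
  qed
  then show ?thesis unfolding check_loss_eq_max[OF assms(1,2)] by (intro max.boundedI) auto
qed

lemma check_loss_Lipschitz:
  assumes "0 \<le> \<tau>" "\<tau> \<le> 1"
  shows "\<bar>check_loss \<tau> x - check_loss \<tau> y\<bar> \<le> \<bar>x - y\<bar>"
proof -
  have le: "c * (x - y) \<le> \<bar>x - y\<bar>" if "\<bar>c\<bar> \<le> 1" for c x y :: real
    using mult_right_mono[OF that, of "\<bar>x - y\<bar>"] abs_ge_self[of "c * (x - y)"] by (simp add: abs_mult)
  have "check_loss \<tau> x \<le> check_loss \<tau> y + \<bar>x - y\<bar>" for x y
  proof -
    have "\<tau> * x \<le> \<tau> * y + \<bar>x - y\<bar>" "(\<tau> - 1) * x \<le> (\<tau> - 1) * y + \<bar>x - y\<bar>"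
      using le[of \<tau> x y] le[of "\<tau> - 1" x y] assms by (auto simp: algebra_simps)
    then show ?thesis unfolding check_loss_eq_max[OF assms] by (auto simp: max_def)
  qed
  from this[of x y] this[of y x] show ?thesis by (simp add: abs_le_iff abs_minus_commute)
qed

text \<open>Knight's identity: the loss increment splits into a linear term, whose mean vanishes for errors
  with \<open>\<tau>\<close>-quantile zero, and a nonnegative remainder of second order.\<close>
lemma check_loss_diff:
  "check_loss \<tau> (r - s) - check_loss \<tau> r = - s * check_score \<tau> r + knight_remainder r s"
  by (auto simp: check_loss_def check_score_def knight_remainder_def indicator_def algebra_simps)

lemma knight_remainder_bounds: "0 \<le> knight_remainder r s" "knight_remainder r s \<le> \<bar>s\<bar>"
  by (auto simp: knight_remainder_def)

text \<open>Only those errors that are smaller in absolute value than the shift contribute to the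
  increments of the remainder.\<close>
lemma knight_remainder_Lipschitz:
  assumes "\<bar>s\<bar> \<le> S" "\<bar>t\<bar> \<le> S"
  shows "\<bar>knight_remainder r s - knight_remainder r t\<bar> \<le> \<bar>s - t\<bar> * of_bool (\<bar>r\<bar> \<le> S)"
  using assms by (auto simp: knight_remainder_def)

lemma knight_remainder_scale:
  assumes "0 < k"
  shows "k * knight_remainder r (c / k) = knight_remainder (k * r) c"
  using assms by (auto simp: knight_remainder_def max_def field_simps zero_less_mult_iff)

lemma borel_measurable_knight_remainder [measurable]:
  "(\<lambda>r. knight_remainder r s) \<in> borel_measurable borel"
  unfolding knight_remainder_def by measurable

text \<open>The expected remainder is an integrated increment of the distribution function, by Fubini. The
  scaling by \<open>k\<close> (later \<open>sqrt n\<close>) is built in so that the result has the form of the smoothness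
  assumption.\<close>
lemma expectation_knight_remainder:
  fixes D :: "real measure"
  assumes "real_distribution D" and k: "0 < k"
  shows "k * (\<integral>x. knight_remainder (x - b) (c / k) \<partial>D) = (LBINT v=0..ereal c. cdf D (b + v / k) - cdf D b)"
proof -
  interpret D: real_distribution D by fact
  interpret P: pair_sigma_finite D lborel ..
  have Fubini: "(\<integral>x. (\<integral>v. indicat_real {l..u} v * indicator (A v) x \<partial>lborel) \<partial>D)
      = (LBINT v:{l..u}. measure D (A v))"
    if A: "Measurable.pred (borel \<Otimes>\<^sub>M borel) (\<lambda>(x, v). x \<in> A v)" for l u :: real and A :: "real \<Rightarrow> real set"
  proof -
    have A'[measurable]: "Measurable.pred (D \<Otimes>\<^sub>M lborel) (\<lambda>(x, v). x \<in> A v)"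
      using A by (simp cong: measurable_cong_sets add: sets_pair_measure_cong[OF D.events_eq_borel sets_lborel])
    have Am: "A v \<in> sets borel" for v
    proof -
      have "Measurable.pred borel (\<lambda>x. case (x, v) of (x, v) \<Rightarrow> x \<in> A v)"
        by (rule measurable_compose[OF _ A]) simp
      then show ?thesis by (simp add: pred_def)
    qed
    have m: "(\<lambda>(x, v). indicat_real {l..u} v * indicator (A v) x) \<in> borel_measurable (D \<Otimes>\<^sub>M lborel)"
    proof -
      have "(\<lambda>(x, v). indicat_real {l..u} v * indicator (A v) x)
        = (\<lambda>p. indicat_real {l..u} (snd p) * (if (case p of (x, v) \<Rightarrow> x \<in> A v) then 1 else 0))"
        by (auto simp: fun_eq_iff indicator_def)
      then show ?thesis by simp
    qed
    have "integrable (D \<Otimes>\<^sub>M lborel) (\<lambda>(x, v). indicat_real {l..u} v * indicator (A v) x)"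
    proof (rule Bochner_Integration.integrable_bound[OF _ m])
      show "integrable (D \<Otimes>\<^sub>M lborel) (\<lambda>(x, v). indicat_real {l..u} v)"
        by (rule P.Fubini_integrable) (auto intro!: integrable_real_indicator simp: emeasure_lborel_Icc_eq)
    qed (auto simp: indicator_def)
    from P.Fubini_integral[OF this, symmetric]
    have "(\<integral>x. (\<integral>v. indicat_real {l..u} v * indicator (A v) x \<partial>lborel) \<partial>D)
        = (\<integral>v. (\<integral>x. indicat_real {l..u} v * indicator (A v) x \<partial>D) \<partial>lborel)" by simp
    also have "\<dots> = (LBINT v:{l..u}. measure D (A v))"
      using Am by (simp add: set_lebesgue_integral_def)
    finally show ?thesis .
  qed
  have len: "(\<integral>v. indicat_real {l..u} v \<partial>lborel) = max 0 (u - l)"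
    "(\<integral>v. indicat_real {l..<u} v \<partial>lborel) = max 0 (u - l)" for l u :: real
    by (cases "l \<le> u"; simp add: measure_def)+
  have "k * (\<integral>x. knight_remainder (x - b) (c / k) \<partial>D) = (\<integral>x. knight_remainder (k * (x - b)) c \<partial>D)"
    unfolding knight_remainder_scale[OF k, symmetric] by simp
  also have "\<dots> = (LBINT v=0..ereal c. cdf D (b + v / k) - cdf D b)"
  proof (cases "0 \<le> c")
    case True
    have "(\<integral>x. knight_remainder (k * (x - b)) c \<partial>D)
        = (\<integral>x. (\<integral>v. indicat_real {0..c} v * indicator {b<..b + v / k} x \<partial>lborel) \<partial>D)"
    proof (rule Bochner_Integration.integral_cong[OF refl])
      fix x
      have eq: "indicat_real {0..c} v * indicator {b<..b + v / k} x
          = of_bool (b < x) * indicat_real {k * (x - b)..c} v" for v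
      proof -
        have "0 \<le> v" if "b < x" "x \<le> b + v / k"
        proof -
          have "0 < v / k" using that by linarith
          then show ?thesis using k by (simp add: zero_less_divide_iff)
        qed
        moreover have "x \<le> b + v / k \<longleftrightarrow> k * (x - b) \<le> v" using k by (auto simp: field_simps)
        ultimately show ?thesis by (auto simp: indicator_def)
      qed
      show "knight_remainder (k * (x - b)) c = (\<integral>v. indicat_real {0..c} v * indicator {b<..b + v / k} x \<partial>lborel)"
        unfolding eq integral_mult_right_zero len(1)
      proof (cases "b < x")
        case False
        then have "k * (x - b) \<le> 0" using k by (simp add: mult_nonneg_nonpos)
        then show "knight_remainder (k * (x - b)) c = of_bool (b < x) * max 0 (c - k * (x - b))"
          using False True unfolding knight_remainder_def by (simp only: if_False not_less) simp
      qed (use k in \<open>simp add: knight_remainder_def\<close>)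
    qed
    also have "\<dots> = (LBINT v:{0..c}. measure D {b<..b + v / k})"
      by (rule Fubini) (simp add: greaterThanAtMost_def)
    also have "\<dots> = (LBINT v:{0..c}. cdf D (b + v / k) - cdf D b)"
    proof (rule set_lebesgue_integral_cong)
      show "\<forall>v. v \<in> {0..c} \<longrightarrow> measure D {b<..b + v / k} = cdf D (b + v / k) - cdf D b"
      proof (intro allI impI)
        fix v assume "v \<in> {0..c}"
        then show "measure D {b<..b + v / k} = cdf D (b + v / k) - cdf D b"
          using k D.cdf_diff_eq[of b "b + v / k"] by (cases "v = 0") auto
      qed
    qed simp
    also have "\<dots> = (LBINT v=0..ereal c. cdf D (b + v / k) - cdf D b)"
      using True by (simp add: zero_ereal_def interval_integral_Icc)
    finally show ?thesis .
  next
    case False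
    have "(\<integral>x. knight_remainder (k * (x - b)) c \<partial>D)
        = (\<integral>x. (\<integral>v. indicat_real {c..0} v * indicator {b + v / k<..b} x \<partial>lborel) \<partial>D)"
    proof (rule Bochner_Integration.integral_cong[OF refl])
      fix x
      have eq: "indicat_real {c..0} v * indicator {b + v / k<..b} x
          = of_bool (x \<le> b) * indicat_real {c..<k * (x - b)} v" for v
      proof -
        have "v \<le> 0" if "x \<le> b" "b + v / k < x"
        proof -
          have "v / k < 0" using that by linarith
          then show ?thesis using k by (simp add: divide_less_0_iff)
        qed
        moreover have "b + v / k < x \<longleftrightarrow> v < k * (x - b)" using k by (auto simp: field_simps)
        ultimately show ?thesis by (auto simp: indicator_def)
      qed
      show "knight_remainder (k * (x - b)) c = (\<integral>v. indicat_real {c..0} v * indicator {b + v / k<..b} x \<partial>lborel)"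
        unfolding eq integral_mult_right_zero len(2)
      proof (cases "b < x")
        case True
        then have "0 < k * (x - b)" using k by simp
        then show "knight_remainder (k * (x - b)) c = of_bool (x \<le> b) * max 0 (k * (x - b) - c)"
          using False True unfolding knight_remainder_def by (simp only: if_True) simp
      next
        case False
        then have "\<not> 0 < k * (x - b)" using k by (simp add: zero_less_mult_iff)
        then show "knight_remainder (k * (x - b)) c = of_bool (x \<le> b) * max 0 (k * (x - b) - c)"
          using False unfolding knight_remainder_def by (simp only: if_False) simp
      qed
    qed
    also have "\<dots> = (LBINT v:{c..0}. measure D {b + v / k<..b})"
      by (rule Fubini) (simp add: greaterThanAtMost_def)
    also have "\<dots> = (LBINT v:{c..0}. - (cdf D (b + v / k) - cdf D b))"
    proof (rule set_lebesgue_integral_cong)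
      show "\<forall>v. v \<in> {c..0} \<longrightarrow> measure D {b + v / k<..b} = - (cdf D (b + v / k) - cdf D b)"
      proof (intro allI impI)
        fix v assume "v \<in> {c..0}"
        then show "measure D {b + v / k<..b} = - (cdf D (b + v / k) - cdf D b)"
          using k D.cdf_diff_eq[of "b + v / k" b] by (cases "v = 0") (auto simp: divide_less_0_iff)
      qed
    qed simp
    also have "\<dots> = (LBINT v=0..ereal c. cdf D (b + v / k) - cdf D b)"
      using False
      by (subst interval_integral_endpoints_reverse) (simp add: zero_ereal_def interval_integral_Icc set_lebesgue_integral_def right_diff_distrib flip: integral_minus)
    finally show ?thesis .
  qed
  finally show ?thesis .
qed

section \<open>Uniform quadratic approximation of the loss\<close>

lemma scaled_inner_le:
  assumes "0 < c" "norm z / sqrt (real n) \<le> c / (norm u + 1)"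
  shows "\<bar>z \<bullet> u / sqrt (real n)\<bar> \<le> c"
proof -
  have "\<bar>z \<bullet> u / sqrt (real n)\<bar> \<le> norm z * norm u / sqrt (real n)"
    using Cauchy_Schwarz_ineq2[of z u] by (simp add: divide_right_mono)
  also have "\<dots> = norm z / sqrt (real n) * norm u" by simp
  also have "\<dots> \<le> c / (norm u + 1) * norm u" using assms(2) by (intro mult_right_mono) auto
  also have "\<dots> = c * (norm u / (norm u + 1))" by simp
  also have "\<dots> \<le> c" using assms(1) by (intro mult_left_le) (auto simp: divide_le_eq_1 add_nonneg_pos)
  finally show ?thesis .
qed

text \<open>Errors \<open>r i\<close> with \<open>\<tau>\<close>-quantile zero and a design \<open>z i\<close> in a Euclidean space; an intercept is a constant
  coordinate of \<open>z\<close>. The function \<open>q\<close> is the limit of the expected remainder in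
  Knight's identity at the shifts of local order \<open>1 / sqrt n\<close>.\<close>
locale quantile_design = prob_space M for M :: "'w measure" +
  fixes r :: "nat \<Rightarrow> 'w \<Rightarrow> real" and z :: "nat \<Rightarrow> 'a::euclidean_space"
    and q :: "'a \<Rightarrow> real" and \<tau> :: real
  assumes tau: "0 \<le> \<tau>" "\<tau> \<le> 1"
    and indep: "indep_vars (\<lambda>_. borel) r {1..}"
    and score_mean: "\<And>i. 1 \<le> i \<Longrightarrow> expectation (\<lambda>\<omega>. check_score \<tau> (r i \<omega>)) = 0"
    and small_ball: "\<exists>C>0. \<exists>d>0. \<forall>i\<ge>1. \<forall>s. 0 \<le> s \<longrightarrow> s \<le> d \<longrightarrow> prob {\<omega>\<in>space M. \<bar>r i \<omega>\<bar> \<le> s} \<le> C * s"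
    and design_max: "\<And>e. 0 < e \<Longrightarrow> \<forall>\<^sub>F n in sequentially. \<forall>i\<in>{1..n}. norm (z i) / sqrt (real n) \<le> e"
    and design_sq: "\<exists>C>0. \<forall>\<^sub>F n in sequentially. (\<Sum>i=1..n. (norm (z i))\<^sup>2) / real n \<le> C"
    and mean_remainder: "\<And>u. (\<lambda>n. \<Sum>i=1..n. expectation (\<lambda>\<omega>. knight_remainder (r i \<omega>) (z i \<bullet> u / sqrt (real n)))) \<longlonglongrightarrow> q u"
    and q_cont: "continuous_on UNIV q"
begin

definition remainder :: "nat \<Rightarrow> 'a \<Rightarrow> 'w \<Rightarrow> real" where
  "remainder n u \<omega> = (\<Sum>i=1..n. knight_remainder (r i \<omega>) (z i \<bullet> u / sqrt (real n)))"

definition score :: "nat \<Rightarrow> 'w \<Rightarrow> 'a" where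
  "score n \<omega> = (1 / sqrt (real n)) *\<^sub>R (\<Sum>i=1..n. check_score \<tau> (r i \<omega>) *\<^sub>R z i)"

lemma r_measurable: "1 \<le> i \<Longrightarrow> random_variable borel (r i)"
  using indep by (auto simp: indep_vars_def)

lemma check_score_bound: "\<bar>check_score \<tau> x\<bar> \<le> 1"
  using tau by (auto simp: check_score_def indicator_def)

lemma borel_measurable_check_score [measurable]: "check_score \<tau> \<in> borel_measurable borel"
  unfolding check_score_def[abs_def] by measurable

lemma integrable_knight_remainder:
  assumes "1 \<le> i" shows "integrable M (\<lambda>\<omega>. knight_remainder (r i \<omega>) s)"
proof -
  note [measurable] = r_measurable[OF assms]
  show ?thesis
    by (rule integrable_const_bound[where B="\<bar>s\<bar>"]) (auto simp: knight_remainder_bounds)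
qed

text \<open>The variance of the remainder is at most the largest shift times its mean, so it vanishes.\<close>
lemma remainder_pointwise:
  assumes "0 < d" "0 < e"
  shows "eventually_prob e (\<lambda>n \<omega>. \<bar>remainder n u \<omega> - q u\<bar> \<le> d)"
proof -
  define s where "s n i = z i \<bullet> u / sqrt (real n)" for n i
  define \<xi> where "\<xi> n i \<omega> = knight_remainder (r i \<omega>) (s n i)" for n i \<omega>
  have \<xi>_int: "integrable M (\<xi> n i)" if "1 \<le> i" for n i
    unfolding \<xi>_def by (rule integrable_knight_remainder[OF that])
  have \<xi>_m[measurable]: "\<xi> n i \<in> borel_measurable M" if "1 \<le> i" for n i
    using \<xi>_int[OF that] by (rule borel_measurable_integrable)
  have \<xi>0: "0 \<le> \<xi> n i \<omega>" and \<xi>s: "\<xi> n i \<omega> \<le> \<bar>s n i\<bar>" for n i \<omega>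
    by (auto simp: \<xi>_def knight_remainder_bounds)
  have E\<xi>: "0 \<le> expectation (\<xi> n i)" "expectation (\<xi> n i) \<le> \<bar>s n i\<bar>" if "1 \<le> i" for n i
    using \<xi>0 \<xi>s \<xi>_int[OF that] by (auto intro!: integral_le_const)
  have dev: "\<bar>\<xi> n i \<omega> - expectation (\<xi> n i)\<bar> \<le> \<bar>s n i\<bar>" if "1 \<le> i" for i n \<omega>
    using \<xi>0[of n i \<omega>] \<xi>s[of n i \<omega>] E\<xi>[OF that, of n] by auto
  define X where "X n \<omega> = (\<Sum>i=1..n. \<xi> n i \<omega> - expectation (\<xi> n i))" for n \<omega>
  have X_eq: "X n \<omega> = remainder n u \<omega> - (\<Sum>i=1..n. expectation (\<xi> n i))" for n \<omega>
    by (simp add: X_def remainder_def \<xi>_def s_def sum_subtractf)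
  have X2: "expectation (\<lambda>\<omega>. (X n \<omega>)\<^sup>2) = (\<Sum>i=1..n. expectation (\<lambda>\<omega>. (\<xi> n i \<omega> - expectation (\<xi> n i))\<^sup>2))" for n
    unfolding X_def
  proof (rule expectation_square_sum_indep)
    show "indep_vars (\<lambda>_. borel) (\<lambda>i \<omega>. \<xi> n i \<omega> - expectation (\<xi> n i)) {1..n}"
      unfolding \<xi>_def by (rule indep_vars_compose2[OF indep_vars_subset[OF indep]]) auto
    show "\<bar>\<xi> n i \<omega> - expectation (\<xi> n i)\<bar> \<le> \<bar>s n i\<bar>" if "i \<in> {1..n}" for i \<omega>
      using that by (intro dev) simp
    show "expectation (\<lambda>\<omega>. \<xi> n i \<omega> - expectation (\<xi> n i)) = 0" if "i \<in> {1..n}" for i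
      using \<xi>_int[of i n] that prob_space by simp
  qed simp
  have X_int: "integrable M (\<lambda>\<omega>. (X n \<omega>)\<^sup>2)" for n
  proof (rule integrable_square_bounded)
    show "\<bar>X n \<omega>\<bar> \<le> (\<Sum>i=1..n. \<bar>s n i\<bar>)" for \<omega>
      unfolding X_def by (intro order_trans[OF sum_abs] sum_mono dev) auto
    show "random_variable borel (X n)" unfolding X_def by measurable
  qed
  have mean: "(\<lambda>n. \<Sum>i=1..n. expectation (\<xi> n i)) \<longlonglongrightarrow> q u"
    unfolding \<xi>_def s_def by (rule mean_remainder)
  have X0: "(\<lambda>n. expectation (\<lambda>\<omega>. (X n \<omega>)\<^sup>2)) \<longlonglongrightarrow> 0"
  proof (rule tendstoI)
    fix \<epsilon> :: real assume "0 < \<epsilon>"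
    \<comment> \<open>eventually the shifts are at most \<open>c\<close> and the mean is at most \<open>\<bar>q u\<bar> + 1\<close>\<close>
    define c where "c = \<epsilon> / (\<bar>q u\<bar> + 2)"
    have c: "0 < c" "c * (\<bar>q u\<bar> + 1) < \<epsilon>" using \<open>0 < \<epsilon>\<close> by (auto simp: c_def field_simps)
    have "\<forall>\<^sub>F n in sequentially. (\<Sum>i=1..n. expectation (\<xi> n i)) < \<bar>q u\<bar> + 1"
      by (rule order_tendstoD[OF mean]) auto
    moreover have "\<forall>\<^sub>F n in sequentially. \<forall>i\<in>{1..n}. norm (z i) / sqrt (real n) \<le> c / (norm u + 1)"
      using c by (intro design_max divide_pos_pos add_nonneg_pos) auto
    ultimately show "\<forall>\<^sub>F n in sequentially. dist (expectation (\<lambda>\<omega>. (X n \<omega>)\<^sup>2)) 0 < \<epsilon>"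
    proof eventually_elim
      case (elim n)
      have sc: "\<bar>s n i\<bar> \<le> c" if "i \<in> {1..n}" for i
        unfolding s_def using elim that c by (intro scaled_inner_le) auto
      have "expectation (\<lambda>\<omega>. (X n \<omega>)\<^sup>2) \<le> (\<Sum>i=1..n. c * expectation (\<xi> n i))"
        unfolding X2
      proof (rule sum_mono)
        fix i assume i: "i \<in> {1..n}"
        then have i1: "1 \<le> i" by simp
        note [measurable] = \<xi>_m[OF i1]
        have le: "(\<xi> n i \<omega>)\<^sup>2 \<le> c * \<xi> n i \<omega>" for \<omega>
          using mult_right_mono[OF order_trans[OF \<xi>s sc[OF i]] \<xi>0] by (simp add: power2_eq_square)
        have int2: "integrable M (\<lambda>\<omega>. (\<xi> n i \<omega>)\<^sup>2)"
          by (rule Bochner_Integration.integrable_bound[of M "\<lambda>\<omega>. c * \<xi> n i \<omega>"])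
            (use \<xi>_int[OF i1] \<xi>0 le c in \<open>auto simp: abs_mult\<close>)
        have "expectation (\<lambda>\<omega>. (\<xi> n i \<omega> - expectation (\<xi> n i))\<^sup>2) = expectation (\<lambda>\<omega>. (\<xi> n i \<omega>)\<^sup>2) - (expectation (\<xi> n i))\<^sup>2"
          by (rule variance_eq[OF \<xi>_int[OF i1] int2])
        also have "\<dots> \<le> expectation (\<lambda>\<omega>. (\<xi> n i \<omega>)\<^sup>2)" by simp
        also have "\<dots> \<le> expectation (\<lambda>\<omega>. c * \<xi> n i \<omega>)"
          using int2 \<xi>_int[OF i1] le by (intro integral_mono) auto
        finally show "expectation (\<lambda>\<omega>. (\<xi> n i \<omega> - expectation (\<xi> n i))\<^sup>2) \<le> c * expectation (\<xi> n i)" by simp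
      qed
      also have "\<dots> = c * (\<Sum>i=1..n. expectation (\<xi> n i))" by (simp add: sum_distrib_left)
      also have "\<dots> \<le> c * (\<bar>q u\<bar> + 1)" using elim c by (intro mult_left_mono) auto
      also note c(2)
      finally show ?case by simp
    qed
  qed
  have "eventually_prob e (\<lambda>n \<omega>. \<bar>X n \<omega>\<bar> \<le> d / 2)"
    by (rule eventually_prob_Chebyshev[OF X_int X0]) (use assms in auto)
  moreover have "\<forall>\<^sub>F n in sequentially. dist (\<Sum>i=1..n. expectation (\<xi> n i)) (q u) < d / 2"
    using tendstoD[OF mean, of "d / 2"] assms by simp
  then have "\<forall>\<^sub>F n in sequentially. \<forall>\<omega>\<in>space M. \<bar>X n \<omega>\<bar> \<le> d / 2 \<longrightarrow> \<bar>remainder n u \<omega> - q u\<bar> \<le> d"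
  proof eventually_elim
    case (elim n)
    then show ?case unfolding X_eq dist_real_def by (intro ballI impI) linarith
  qed
  ultimately show ?thesis by (rule eventually_prob_mono)
qed

text \<open>The Lipschitz constant of the remainder on a ball is dominated by a sum over the few errors
  close to zero, and the density bound keeps its mean bounded.\<close>
lemma remainder_Lipschitz:
  assumes K: "0 < K"
  obtains C where "0 < C"
    "\<And>e. 0 < e \<Longrightarrow> eventually_prob e (\<lambda>n \<omega>. \<forall>u\<in>cball 0 K. \<forall>v\<in>cball 0 K.
        \<bar>remainder n u \<omega> - remainder n v \<omega>\<bar> \<le> C / e * norm (u - v))"
proof -
  obtain C1 d where C1: "0 < C1" and d: "0 < d"
    and sb: "\<And>i s. 1 \<le> i \<Longrightarrow> 0 \<le> s \<Longrightarrow> s \<le> d \<Longrightarrow> prob {\<omega>\<in>space M. \<bar>r i \<omega>\<bar> \<le> s} \<le> C1 * s"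
    using small_ball by auto
  obtain C2 where C2: "0 < C2" and sq: "\<forall>\<^sub>F n in sequentially. (\<Sum>i=1..n. (norm (z i))\<^sup>2) / real n \<le> C2"
    using design_sq by auto
  define a where "a n i = norm (z i) / sqrt (real n)" for n i
  have a0: "0 \<le> a n i" for n i by (simp add: a_def)
  define L where "L n \<omega> = (\<Sum>i=1..n. a n i * indicat_real {\<omega>\<in>space M. \<bar>r i \<omega>\<bar> \<le> K * a n i} \<omega>)" for n \<omega>
  have ev: "{\<omega>\<in>space M. \<bar>r i \<omega>\<bar> \<le> s} \<in> events" if "1 \<le> i" for i s
  proof -
    note [measurable] = r_measurable[OF that]
    show ?thesis by measurable
  qed
  have int: "integrable M (\<lambda>\<omega>. a n i * indicat_real {\<omega>\<in>space M. \<bar>r i \<omega>\<bar> \<le> K * a n i} \<omega>)" if "1 \<le> i" for n i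
    using ev[OF that] by (intro integrable_mult_right integrable_real_indicator) (auto simp: emeasure_eq_measure)
  have EL: "expectation (L n) = (\<Sum>i=1..n. a n i * prob {\<omega>\<in>space M. \<bar>r i \<omega>\<bar> \<le> K * a n i})" for n
  proof -
    have "expectation (L n) = (\<Sum>i=1..n. expectation (\<lambda>\<omega>. a n i * indicat_real {\<omega>\<in>space M. \<bar>r i \<omega>\<bar> \<le> K * a n i} \<omega>))"
      unfolding L_def by (rule Bochner_Integration.integral_sum) (use int in auto)
    also have "\<dots> = (\<Sum>i=1..n. a n i * prob {\<omega>\<in>space M. \<bar>r i \<omega>\<bar> \<le> K * a n i})"
      using ev by (intro sum.cong) (auto simp: Int_absorb1 subset_eq)
    finally show ?thesis .
  qed
  have bound: "\<forall>\<^sub>F n in sequentially. expectation (L n) \<le> C1 * K * C2"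
    using sq design_max[OF divide_pos_pos[OF d K]] unfolding a_def[symmetric]
  proof eventually_elim
    case 1: (elim n)
    then have small: "K * a n i \<le> d" if "i \<in> {1..n}" for i
      using that K by (auto simp: field_simps)
    have "expectation (L n) \<le> (\<Sum>i=1..n. a n i * (C1 * (K * a n i)))"
      unfolding EL using K small by (intro sum_mono mult_left_mono sb a0) (auto simp: a0)
    also have "\<dots> = C1 * K * (\<Sum>i=1..n. (a n i)\<^sup>2)"
      by (simp add: sum_distrib_left power2_eq_square mult_ac)
    also have "(\<Sum>i=1..n. (a n i)\<^sup>2) = (\<Sum>i=1..n. (norm (z i))\<^sup>2) / real n"
      by (simp add: a_def power_divide sum_divide_distrib)
    also have "C1 * K * \<dots> \<le> C1 * K * C2" using 1 C1 K by (intro mult_left_mono) auto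
    finally show ?case .
  qed
  have L0: "0 \<le> L n \<omega>" for n \<omega> unfolding L_def by (intro sum_nonneg mult_nonneg_nonneg a0) simp
  have Li: "integrable M (L n)" for n
    unfolding L_def by (rule Bochner_Integration.integrable_sum) (use int in auto)
  have Lip: "\<bar>remainder n u \<omega> - remainder n v \<omega>\<bar> \<le> L n \<omega> * norm (u - v)"
    if \<omega>: "\<omega> \<in> space M" and uv: "u \<in> cball 0 K" "v \<in> cball 0 K" for n \<omega> u v
  proof -
    have shift: "\<bar>z i \<bullet> w / sqrt (real n)\<bar> \<le> a n i * norm w" for i w
      using Cauchy_Schwarz_ineq2[of "z i" w] by (simp add: a_def divide_right_mono)
    have shiftK: "\<bar>z i \<bullet> w / sqrt (real n)\<bar> \<le> K * a n i" if "w \<in> cball 0 K" for i w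
      using shift[of i w] mult_left_mono[OF _ a0[of n i], of "norm w" K] that by (auto simp: mult.commute)
    have "\<bar>remainder n u \<omega> - remainder n v \<omega>\<bar> \<le> (\<Sum>i=1..n. \<bar>knight_remainder (r i \<omega>) (z i \<bullet> u / sqrt (real n))
        - knight_remainder (r i \<omega>) (z i \<bullet> v / sqrt (real n))\<bar>)"
      unfolding remainder_def sum_subtractf[symmetric] by (rule sum_abs)
    also have "\<dots> \<le> (\<Sum>i=1..n. (a n i * norm (u - v)) * indicat_real {\<omega>\<in>space M. \<bar>r i \<omega>\<bar> \<le> K * a n i} \<omega>)"
    proof (rule sum_mono)
      fix i
      have "\<bar>knight_remainder (r i \<omega>) (z i \<bullet> u / sqrt (real n)) - knight_remainder (r i \<omega>) (z i \<bullet> v / sqrt (real n))\<bar>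
          \<le> \<bar>z i \<bullet> u / sqrt (real n) - z i \<bullet> v / sqrt (real n)\<bar> * of_bool (\<bar>r i \<omega>\<bar> \<le> K * a n i)"
        by (intro knight_remainder_Lipschitz shiftK uv)
      also have "\<dots> \<le> (a n i * norm (u - v)) * of_bool (\<bar>r i \<omega>\<bar> \<le> K * a n i)"
        using shift[of i "u - v"] by (intro mult_right_mono) (auto simp: inner_diff_right diff_divide_distrib)
      finally show "\<bar>knight_remainder (r i \<omega>) (z i \<bullet> u / sqrt (real n)) - knight_remainder (r i \<omega>) (z i \<bullet> v / sqrt (real n))\<bar>
          \<le> (a n i * norm (u - v)) * indicat_real {\<omega>\<in>space M. \<bar>r i \<omega>\<bar> \<le> K * a n i} \<omega>"
        using \<omega> by (simp add: indicator_def)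
    qed
    also have "\<dots> = L n \<omega> * norm (u - v)" unfolding L_def sum_distrib_right by (intro sum.cong refl) (simp only: mult_ac)
    finally show ?thesis .
  qed
  show ?thesis
  proof (rule that)
    show "0 < C1 * K * C2" using C1 C2 K by simp
    fix e :: real assume "0 < e"
    from eventually_prob_Markov[OF Li L0 bound \<open>0 < C1 * K * C2\<close> this]
    show "eventually_prob e (\<lambda>n \<omega>. \<forall>u\<in>cball 0 K. \<forall>v\<in>cball 0 K.
        \<bar>remainder n u \<omega> - remainder n v \<omega>\<bar> \<le> C1 * K * C2 / e * norm (u - v))"
    proof (rule eventually_prob_mono[OF _ always_eventually], intro allI ballI impI)
      fix n \<omega> and u v :: 'a assume "\<omega> \<in> space M" "L n \<omega> < C1 * K * C2 / e" "u \<in> cball 0 K" "v \<in> cball 0 K"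
      then show "\<bar>remainder n u \<omega> - remainder n v \<omega>\<bar> \<le> C1 * K * C2 / e * norm (u - v)"
        using Lip[of \<omega> u v n] mult_right_mono[of "L n \<omega>" "C1 * K * C2 / e" "norm (u - v)"] by fastforce
    qed
  qed
qed

text \<open>Pointwise approximation together with a stochastic Lipschitz bound gives uniform approximation on
  compact sets, by passing to a finite net.\<close>
lemma remainder_uniform:
  assumes K: "0 < K" and d: "0 < d" and e: "0 < e"
  shows "eventually_prob e (\<lambda>n \<omega>. \<forall>u\<in>cball 0 K. \<bar>remainder n u \<omega> - q u\<bar> \<le> d)"
proof -
  obtain C where C: "0 < C" and Lip: "\<And>e. 0 < e \<Longrightarrow> eventually_prob e (\<lambda>n \<omega>. \<forall>u\<in>cball 0 K. \<forall>v\<in>cball 0 K.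
        \<bar>remainder n u \<omega> - remainder n v \<omega>\<bar> \<le> C / e * norm (u - v))"
    using remainder_Lipschitz[OF K] by blast
  define B where "B = C / (e / 2)"
  have B: "0 < B" using C e by (simp add: B_def)
  have "uniformly_continuous_on (cball 0 K) q"
    by (rule compact_uniformly_continuous) (auto intro: continuous_on_subset[OF q_cont])
  then obtain d1 where d1: "0 < d1"
    "\<And>u v. u \<in> cball 0 K \<Longrightarrow> v \<in> cball 0 K \<Longrightarrow> dist v u < d1 \<Longrightarrow> dist (q v) (q u) < d / 3"
    using d unfolding uniformly_continuous_on_def by (metis divide_pos_pos zero_less_numeral)
  define \<delta> where "\<delta> = min d1 (d / (3 * B))"
  have \<delta>: "0 < \<delta>" "B * \<delta> \<le> d / 3"
  proof -
    show "0 < \<delta>" using d d1 B by (simp add: \<delta>_def)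
    have "B * \<delta> \<le> B * (d / (3 * B))" using B by (intro mult_left_mono) (auto simp: \<delta>_def)
    then show "B * \<delta> \<le> d / 3" using B by simp
  qed
  have "\<exists>S. finite S \<and> S \<subseteq> cball (0::'a) K \<and> cball 0 K \<subseteq> (\<Union>x\<in>S. ball x \<delta>)"
    using seq_compact_imp_totally_bounded[of "cball (0::'a) K"] \<delta>(1) compact_imp_seq_compact[OF compact_cball] by blast
  then obtain S where S: "finite S" "S \<subseteq> cball (0::'a) K" "cball 0 K \<subseteq> (\<Union>x\<in>S. ball x \<delta>)" by blast
  have "eventually_prob (e / 2) (\<lambda>n \<omega>. \<forall>x\<in>S. \<bar>remainder n x \<omega> - q x\<bar> \<le> d / 3)"
    by (rule eventually_prob_ball[OF S(1)], rule remainder_pointwise) (use d e in auto)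
  moreover have "eventually_prob (e / 2) (\<lambda>n \<omega>. \<forall>u\<in>cball 0 K. \<forall>v\<in>cball 0 K.
        \<bar>remainder n u \<omega> - remainder n v \<omega>\<bar> \<le> B * norm (u - v))"
    unfolding B_def by (rule Lip) (use e in simp)
  ultimately have "eventually_prob (e / 2 + e / 2) (\<lambda>n \<omega>. (\<forall>x\<in>S. \<bar>remainder n x \<omega> - q x\<bar> \<le> d / 3) \<and>
      (\<forall>u\<in>cball 0 K. \<forall>v\<in>cball 0 K. \<bar>remainder n u \<omega> - remainder n v \<omega>\<bar> \<le> B * norm (u - v)))"
    by (rule eventually_prob_conj)
  then have "eventually_prob e (\<lambda>n \<omega>. (\<forall>x\<in>S. \<bar>remainder n x \<omega> - q x\<bar> \<le> d / 3) \<and>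
      (\<forall>u\<in>cball 0 K. \<forall>v\<in>cball 0 K. \<bar>remainder n u \<omega> - remainder n v \<omega>\<bar> \<le> B * norm (u - v)))" by simp
  then show ?thesis
  proof (rule eventually_prob_mono[OF _ always_eventually], intro allI ballI impI, elim conjE)
    fix n \<omega> and u :: 'a
    assume net: "\<forall>x\<in>S. \<bar>remainder n x \<omega> - q x\<bar> \<le> d / 3"
      and lip: "\<forall>u\<in>cball 0 K. \<forall>v\<in>cball 0 K. \<bar>remainder n u \<omega> - remainder n v \<omega>\<bar> \<le> B * norm (u - v)"
      and u: "u \<in> cball 0 K"
    obtain x where x: "x \<in> S" "dist x u < \<delta>" using S(3) u by auto
    then have xK: "x \<in> cball 0 K" using S by blast
    have "\<bar>remainder n u \<omega> - remainder n x \<omega>\<bar> \<le> B * norm (u - x)" using lip u xK by blast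
    also have "\<dots> \<le> B * \<delta>" using x B by (intro mult_left_mono) (auto simp: dist_norm norm_minus_commute)
    also note \<delta>(2)
    finally have "\<bar>remainder n u \<omega> - remainder n x \<omega>\<bar> \<le> d / 3" .
    moreover have "\<bar>remainder n x \<omega> - q x\<bar> \<le> d / 3" using net x by blast
    moreover have "\<bar>q x - q u\<bar> < d / 3" using d1(2)[OF u xK] x by (simp add: \<delta>_def dist_real_def)
    ultimately show "\<bar>remainder n u \<omega> - q u\<bar> \<le> d" by linarith
  qed
qed

lemma score_measurable: "random_variable borel (score n)"
proof -
  have "random_variable borel (\<lambda>\<omega>. check_score \<tau> (r i \<omega>))" if "1 \<le> i" for i
    using r_measurable[OF that] by simp
  then show ?thesis
    unfolding score_def by (intro borel_measurable_scaleR borel_measurable_sum borel_measurable_const) auto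
qed

lemma score_inner: "score n \<omega> \<bullet> u = (\<Sum>i=1..n. z i \<bullet> u / sqrt (real n) * check_score \<tau> (r i \<omega>))"
  by (simp add: score_def inner_sum_left sum_distrib_left mult_ac)

lemma score_bounded:
  assumes "0 < e"
  obtains K where "0 < K" "eventually_prob e (\<lambda>n \<omega>. norm (score n \<omega>) \<le> K)"
proof -
  obtain C where C: "0 < C" and sq: "\<forall>\<^sub>F n in sequentially. (\<Sum>i=1..n. (norm (z i))\<^sup>2) / real n \<le> C"
    using design_sq by auto
  have rm: "random_variable borel (\<lambda>\<omega>. check_score \<tau> (r i \<omega>))" if "1 \<le> i" for i
    using r_measurable[OF that] by simp
  have mean: "expectation (\<lambda>\<omega>. c * check_score \<tau> (r i \<omega>)) = 0" if "1 \<le> i" for i c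
    using score_mean[OF that] by simp
  have sq_le: "(check_score \<tau> x)\<^sup>2 \<le> 1" for x
    using check_score_bound[of x] by (simp add: abs_square_le_1)
  have E: "expectation (\<lambda>\<omega>. (score n \<omega> \<bullet> u)\<^sup>2) \<le> (norm u)\<^sup>2 * ((\<Sum>i=1..n. (norm (z i))\<^sup>2) / real n)" for n u
  proof -
    let ?c = "\<lambda>i. z i \<bullet> u / sqrt (real n)"
    have "expectation (\<lambda>\<omega>. (score n \<omega> \<bullet> u)\<^sup>2) = (\<Sum>i=1..n. expectation (\<lambda>\<omega>. (?c i * check_score \<tau> (r i \<omega>))\<^sup>2))"
      unfolding score_inner
    proof (rule expectation_square_sum_indep)
      show "indep_vars (\<lambda>_. borel) (\<lambda>i \<omega>. ?c i * check_score \<tau> (r i \<omega>)) {1..n}"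
        by (rule indep_vars_compose2[OF indep_vars_subset[OF indep]]) auto
      show "\<bar>?c i * check_score \<tau> (r i \<omega>)\<bar> \<le> \<bar>?c i\<bar>" for i \<omega>
        unfolding abs_mult by (intro mult_left_le check_score_bound) simp
    qed (use mean in auto)
    also have "\<dots> \<le> (\<Sum>i=1..n. (norm u)\<^sup>2 * ((norm (z i))\<^sup>2 / real n))"
    proof (rule sum_mono)
      fix i assume "i \<in> {1..n}"
      then have i: "1 \<le> i" by simp
      note [measurable] = rm[OF i]
      have le: "(?c i * check_score \<tau> (r i \<omega>))\<^sup>2 \<le> (?c i)\<^sup>2" for \<omega>
        unfolding power_mult_distrib by (intro mult_left_le sq_le) simp
      have "expectation (\<lambda>\<omega>. (?c i * check_score \<tau> (r i \<omega>))\<^sup>2) \<le> (?c i)\<^sup>2"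
      proof (rule integral_le_const)
        show "integrable M (\<lambda>\<omega>. (?c i * check_score \<tau> (r i \<omega>))\<^sup>2)"
          by (rule integrable_const_bound[where B="(?c i)\<^sup>2"]) (use le in auto)
      qed (use le in auto)
      also have "(?c i)\<^sup>2 = (z i \<bullet> u)\<^sup>2 / real n" by (simp add: power_divide)
      also have "\<dots> \<le> (norm u)\<^sup>2 * (norm (z i))\<^sup>2 / real n"
        using Cauchy_Schwarz_ineq2[of "z i" u]
        by (intro divide_right_mono) (auto simp: power_mult_distrib[symmetric] mult.commute intro!: abs_le_square_iff[THEN iffD1] order_trans[OF _ abs_ge_self])
      finally show "expectation (\<lambda>\<omega>. (?c i * check_score \<tau> (r i \<omega>))\<^sup>2) \<le> (norm u)\<^sup>2 * ((norm (z i))\<^sup>2 / real n)" by simp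
    qed
    also have "\<dots> = (norm u)\<^sup>2 * ((\<Sum>i=1..n. (norm (z i))\<^sup>2) / real n)"
      by (simp add: sum_distrib_left sum_divide_distrib)
    finally show ?thesis .
  qed
  have int: "integrable M (\<lambda>\<omega>. (score n \<omega> \<bullet> u)\<^sup>2)" for n u
  proof (rule integrable_square_bounded[OF borel_measurable_inner[OF score_measurable borel_measurable_const]])
    show "\<bar>score n \<omega> \<bullet> u\<bar> \<le> (\<Sum>i=1..n. \<bar>z i \<bullet> u / sqrt (real n)\<bar>)" for \<omega>
      unfolding score_inner
      by (intro order_trans[OF sum_abs] sum_mono) (simp only: abs_mult mult_left_le check_score_bound abs_ge_zero)
  qed
  define X where "X n \<omega> = (\<Sum>b\<in>Basis. (score n \<omega> \<bullet> b)\<^sup>2)" for n \<omega>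
  have X: "X n \<omega> = (norm (score n \<omega>))\<^sup>2" for n \<omega>
  proof -
    have "X n \<omega> = score n \<omega> \<bullet> score n \<omega>"
      unfolding X_def by (subst euclidean_inner) (simp add: power2_eq_square)
    then show ?thesis by (simp add: power2_norm_eq_inner)
  qed
  have Xi: "integrable M (X n)" for n unfolding X_def by (intro Bochner_Integration.integrable_sum int)
  define C' where "C' = real DIM('a) * C"
  have EX: "\<forall>\<^sub>F n in sequentially. expectation (X n) \<le> C'"
    using sq
  proof eventually_elim
    case (elim n)
    have "expectation (X n) = (\<Sum>b\<in>Basis. expectation (\<lambda>\<omega>. (score n \<omega> \<bullet> b)\<^sup>2))"
      unfolding X_def by (rule Bochner_Integration.integral_sum) (rule int)
    also have "\<dots> \<le> (\<Sum>b\<in>(Basis::'a set). C)"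
      using E elim by (intro sum_mono) (fastforce intro: order_trans)
    finally show ?case by (simp add: C'_def)
  qed
  have C': "0 < C'" using C by (simp add: C'_def)
  have ev: "eventually_prob e (\<lambda>n \<omega>. X n \<omega> < C' / e)"
    by (rule eventually_prob_Markov[OF Xi _ EX C' assms]) (simp add: X)
  show ?thesis
  proof (rule that)
    show "0 < sqrt (C' / e)" using C' assms by simp
    show "eventually_prob e (\<lambda>n \<omega>. norm (score n \<omega>) \<le> sqrt (C' / e))"
      using ev by (rule eventually_prob_mono) (auto intro!: always_eventually real_le_rsqrt simp: X)
  qed
qed

end

section \<open>Positive definite forms, subvectors and the design\<close>

lemma positive_definite_coercive:
  fixes S :: "real ^ 'n ^ 'n::finite"
  assumes "positive_definite S"
  obtains \<kappa> where "0 < \<kappa>" "\<And>x. \<kappa> * (norm x)\<^sup>2 \<le> x \<bullet> (S *v x)"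
proof -
  have cont: "continuous_on (sphere 0 1) (\<lambda>x. x \<bullet> (S *v x))" by (intro continuous_intros)
  have "sphere (0::real^'n) 1 \<noteq> {}" using vector_choose_size[of 1] by (auto simp: set_eq_iff)
  then obtain y where y: "norm y = 1" and min: "\<And>x. norm x = 1 \<Longrightarrow> y \<bullet> (S *v y) \<le> x \<bullet> (S *v x)"
    using continuous_attains_inf[OF compact_sphere _ cont] by auto
  show ?thesis
  proof (rule that)
    show "0 < y \<bullet> (S *v y)" using assms y by (metis norm_zero positive_definite_def zero_neq_one)
    fix x :: "real^'n"
    show "y \<bullet> (S *v y) * (norm x)\<^sup>2 \<le> x \<bullet> (S *v x)"
    proof (cases "x = 0")
      case False
      let ?e = "(1 / norm x) *\<^sub>R x"
      have "y \<bullet> (S *v y) \<le> ?e \<bullet> (S *v ?e)" using False by (intro min) simp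
      also have "\<dots> = (x \<bullet> (S *v x)) / (norm x)\<^sup>2" by (simp add: matrix_vector_mult_scaleR power2_eq_square)
      finally show ?thesis using False by (simp add: field_simps)
    qed simp
  qed
qed

lemma positive_definite_symmetric:
  assumes "positive_definite S"
  shows "x \<bullet> (S *v y) = y \<bullet> (S *v x)"
  using assms by (metis dot_lmul_matrix inner_commute positive_definite_def transpose_matrix_vector)

text \<open>A convex function that vanishes at the origin and is large on a sphere cannot be small outside
  the ball; this localises minimisers even though the parameter set need not be convex.\<close>
lemma star_convex_localization:
  fixes G :: "'a::real_normed_vector \<Rightarrow> real"
  assumes ray: "\<And>t. 0 \<le> t \<Longrightarrow> t \<le> 1 \<Longrightarrow> G (t *\<^sub>R u) \<le> t * G u"
    and K: "0 < K" and sphere: "\<And>v. norm v = K \<Longrightarrow> \<delta> * K < G v" and u: "G u \<le> \<delta> * norm u"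
  shows "norm u \<le> K"
proof (rule ccontr)
  assume "\<not> norm u \<le> K"
  then have nu: "K < norm u" by simp
  define t where "t = K / norm u"
  have t: "0 \<le> t" "t \<le> 1" "t * norm u = K" using K nu by (auto simp: t_def divide_le_eq_1)
  have "\<delta> * K < G (t *\<^sub>R u)" using t by (intro sphere) simp
  also have "\<dots> \<le> t * G u" by (rule ray[OF t(1,2)])
  also have "\<dots> \<le> t * (\<delta> * norm u)" using t u by (intro mult_left_mono)
  also have "\<dots> = \<delta> * K" using t(3) by (simp add: mult.left_commute)
  finally show False by simp
qed

text \<open>For injective \<open>\<iota>\<close>, the adjoint and a right inverse of \<open>subvector \<iota>\<close>.\<close>
definition embed_vector :: "('a \<Rightarrow> 'p) \<Rightarrow> real ^ 'a \<Rightarrow> real ^ 'p" where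
  "embed_vector \<iota> v = (\<chi> j. if j \<in> range \<iota> then v $ inv \<iota> j else 0)"

lemma inner_embed_vector:
  fixes \<iota> :: "'a::finite \<Rightarrow> 'p::finite"
  assumes "inj \<iota>"
  shows "embed_vector \<iota> v \<bullet> x = v \<bullet> subvector \<iota> x"
proof -
  have "embed_vector \<iota> v \<bullet> x = (\<Sum>j\<in>UNIV. if j \<in> range \<iota> then v $ inv \<iota> j * x $ j else 0)"
    by (simp add: inner_vec_def embed_vector_def if_distrib[of "\<lambda>a. a * b" for b] cong: if_cong)
  also have "\<dots> = (\<Sum>j\<in>range \<iota>. v $ inv \<iota> j * x $ j)"
    by (simp add: sum.If_cases)
  also have "\<dots> = v \<bullet> subvector \<iota> x"
    by (simp add: sum.reindex[OF assms] assms inner_vec_def subvector_def)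
  finally show ?thesis .
qed

lemma subvector_embed_vector:
  fixes \<iota> :: "'a::finite \<Rightarrow> 'p::finite"
  assumes "inj \<iota>" shows "subvector \<iota> (embed_vector \<iota> v) = v"
  using assms by (simp add: subvector_def embed_vector_def vec_eq_iff)

lemma norm_embed_vector:
  fixes \<iota> :: "'a::finite \<Rightarrow> 'p::finite"
  assumes "inj \<iota>" shows "norm (embed_vector \<iota> v) = norm v"
  by (simp add: norm_eq_sqrt_inner inner_embed_vector[OF assms] subvector_embed_vector[OF assms])

lemma norm_subvector_le:
  fixes \<iota> :: "'a::finite \<Rightarrow> 'p::finite"
  assumes "inj \<iota>" shows "norm (subvector \<iota> x) \<le> norm x"
proof -
  let ?y = "subvector \<iota> x"
  have "norm ?y * norm ?y = embed_vector \<iota> ?y \<bullet> x"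
    by (simp add: inner_embed_vector[OF assms] power2_norm_eq_inner[symmetric] power2_eq_square)
  also have "\<dots> \<le> norm ?y * norm x"
    using norm_cauchy_schwarz[of "embed_vector \<iota> ?y" x] by (simp add: norm_embed_vector[OF assms])
  finally show ?thesis by (cases "?y = 0") auto
qed

lemma principal_submatrix_vector_mult:
  fixes \<iota> :: "'a::finite \<Rightarrow> 'p::finite"
  assumes "inj \<iota>" shows "principal_submatrix \<iota> S *v v = subvector \<iota> (S *v embed_vector \<iota> v)"
proof -
  have "(S *v embed_vector \<iota> v) $ i = embed_vector \<iota> v \<bullet> row i S" for i
    by (simp add: matrix_vector_mult_def inner_vec_def row_def mult.commute)
  then show ?thesis
    by (simp add: vec_eq_iff inner_embed_vector[OF assms])
      (simp add: subvector_def principal_submatrix_def matrix_vector_mult_def inner_vec_def row_def mult.commute inner_embed_vector[OF assms])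
qed

lemma positive_definite_principal_submatrix:
  fixes \<iota> :: "'a::finite \<Rightarrow> 'p::finite"
  assumes "inj \<iota>" "positive_definite S" shows "positive_definite (principal_submatrix \<iota> S)"
  unfolding positive_definite_def
proof (intro conjI allI impI)
  have "S $ i $ j = S $ j $ i" for i j
    using assms(2) by (auto simp: positive_definite_def transpose_def vec_eq_iff)
  then show "transpose (principal_submatrix \<iota> S) = principal_submatrix \<iota> S"
    by (simp add: transpose_def principal_submatrix_def vec_eq_iff)
  fix v :: "real^'a" assume "v \<noteq> 0"
  then have "embed_vector \<iota> v \<noteq> 0" using norm_embed_vector[OF assms(1), of v] by auto
  then show "0 < v \<bullet> (principal_submatrix \<iota> S *v v)"
    using assms(2)
    by (simp add: principal_submatrix_vector_mult[OF assms(1)] inner_embed_vector[OF assms(1), symmetric] positive_definite_def)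
qed

lemma scaleR_matrix_mult:
  fixes A B :: "real ^ 'n ^ 'n::finite"
  shows "(c *\<^sub>R A) ** B = c *\<^sub>R (A ** B)" "A ** (c *\<^sub>R B) = c *\<^sub>R (A ** B)"
  by (simp_all add: matrix_matrix_mult_def vec_eq_iff sum_distrib_left mult_ac)

lemma positive_definite_inverse:
  fixes Q :: "real ^ 'n ^ 'n::finite"
  assumes "positive_definite Q"
  shows "matrix_inv Q ** Q = mat 1" "Q ** matrix_inv Q = mat 1"
proof -
  obtain A :: "real^'n^'n" where "transpose A ** Q ** A = mat 1" using positive_definite_orthonormal[OF assms] .
  then have "det (transpose A) * det Q * det A = 1" by (metis det_I det_mul)
  then have "invertible Q" by (auto simp: invertible_det_nz)
  then have "Q ** matrix_inv Q = mat 1 \<and> matrix_inv Q ** Q = mat 1"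
    unfolding matrix_inv_def invertible_def by (rule someI_ex)
  then show "matrix_inv Q ** Q = mat 1" "Q ** matrix_inv Q = mat 1" by auto
qed

text \<open>The limit law written as the image of the standard Gaussian under \<open>A\<close>, where \<open>A ** transpose A\<close> is
  the covariance matrix.\<close>
lemma multivariate_normal_inverse:
  fixes Q :: "real ^ 'n ^ 'n::finite"
  assumes Q: "positive_definite Q" and c: "0 < c"
  defines "N \<equiv> multivariate_normal 0 (c *\<^sub>R matrix_inv Q)"
  shows "prob_space N" and "sets N = sets borel"
    and "(CLINT x|N. iexp (t \<bullet> x)) = exp (- (c * (t \<bullet> (matrix_inv Q *v t))) / 2)"
proof -
  let ?P = "(1 / c) *\<^sub>R Q" and ?S = "c *\<^sub>R matrix_inv Q"
  have P: "positive_definite ?P"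
    using Q c by (simp add: positive_definite_def transpose_def vec_eq_iff scaleR_matrix_vector_assoc[symmetric])
  obtain A :: "real^'n^'n" where A: "transpose A ** ?P ** A = mat 1" using positive_definite_orthonormal[OF P] .
  have SP: "?S ** ?P = mat 1" "?P ** ?S = mat 1"
    using c by (simp_all add: scaleR_matrix_mult positive_definite_inverse[OF Q])
  have N: "N = distr std_gaussian borel ((*v) A)"
    unfolding N_def by (rule multivariate_normal_eq_distr[OF SP A])
  have m[measurable]: "(*v) A \<in> borel_measurable borel"
    by (intro borel_measurable_continuous_onI linear_continuous_on)
      (simp add: matrix_vector_mul_linear linear_linear)
  show "sets N = sets borel" by (simp add: N)
  show "prob_space N"
    unfolding N by (intro prob_space.prob_space_distr prob_space_std_gaussian) simp
  have "A ** (transpose A ** ?P) = mat 1"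
    using A matrix_left_right_inverse[of "transpose A ** ?P" A] by simp
  then have "A ** transpose A ** ?P ** ?S = ?S" by (simp add: matrix_mul_assoc)
  then have AA: "A ** transpose A = ?S" by (simp add: matrix_mul_assoc[symmetric] SP)
  have dot: "t \<bullet> (A *v x) = (transpose A *v t) \<bullet> x" for x
    by (metis dot_lmul_matrix transpose_matrix_vector transpose_transpose)
  have "(norm (transpose A *v t))\<^sup>2 = t \<bullet> ((A ** transpose A) *v t)"
    by (simp add: power2_norm_eq_inner matrix_vector_mul_assoc[symmetric] dot)
  then have nrm: "(norm (transpose A *v t))\<^sup>2 = c * (t \<bullet> (matrix_inv Q *v t))"
    unfolding AA by (simp add: scaleR_matrix_vector_assoc[symmetric])
  have "(CLINT x|N. iexp (t \<bullet> x)) = (CLINT x|std_gaussian. iexp ((transpose A *v t) \<bullet> x))"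
    unfolding N by (subst integral_distr) (auto simp: dot)
  also have "\<dots> = exp (- (norm (transpose A *v t))\<^sup>2 / 2)" by (rule char_std_gaussian)
  finally show "(CLINT x|N. iexp (t \<bullet> x)) = exp (- (c * (t \<bullet> (matrix_inv Q *v t))) / 2)"
    by (simp only: nrm)
qed

lemma design_assumption_quadratic:
  fixes X :: "nat \<Rightarrow> real ^ 'p::finite"
  assumes "design_assumption X \<Upsilon>"
  shows "(\<lambda>n. (\<Sum>i=1..n. (X i \<bullet> u)\<^sup>2) / real n) \<longlonglongrightarrow> u \<bullet> (\<Upsilon> *v u)"
proof -
  have lim: "(\<lambda>n. (1 / real n) *\<^sub>R (\<Sum>i=1..n. outer_prod (X i) (X i))) \<longlonglongrightarrow> \<Upsilon>"
    using assms by (simp add: design_assumption_def)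
  have mv: "(\<Sum>i\<in>I. A i) *v u = (\<Sum>i\<in>I. A i *v u)" for A :: "nat \<Rightarrow> real^'p^'p" and I
    by (induction I rule: infinite_finite_induct) (auto simp: matrix_vector_mult_add_rdistrib)
  have op: "u \<bullet> (outer_prod x x *v u) = (x \<bullet> u)\<^sup>2" for x :: "real^'p"
  proof -
    have "outer_prod x x *v u = (x \<bullet> u) *\<^sub>R x"
      by (simp add: vec_eq_iff outer_prod_def matrix_vector_mult_def inner_vec_def sum_distrib_left mult_ac)
    then show ?thesis by (simp add: power2_eq_square inner_commute)
  qed
  have "(\<lambda>n. u \<bullet> (((1 / real n) *\<^sub>R (\<Sum>i=1..n. outer_prod (X i) (X i))) *v u)) \<longlonglongrightarrow> u \<bullet> (\<Upsilon> *v u)"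
    unfolding matrix_vector_mult_def by (intro tendsto_intros lim)
  then show ?thesis
    by (simp add: scaleR_matrix_vector_assoc[symmetric] mv inner_sum_right op del: sum.cl_ivl_Suc)
qed

text \<open>The intercept adds a coordinate \<open>1\<close> to each regressor, which is negligible against \<open>sqrt n\<close>.\<close>
lemma design_assumption_max:
  fixes X :: "nat \<Rightarrow> real ^ 'p::finite"
  assumes "design_assumption X \<Upsilon>" "0 < e"
  shows "\<forall>\<^sub>F n in sequentially. \<forall>i\<in>{1..n}. norm (1::real, X i) / sqrt (real n) \<le> e"
proof -
  have "(\<lambda>n. (MAX i\<in>{1..n}. X i \<bullet> X i) / real n) \<longlonglongrightarrow> 0"
    using assms by (simp add: design_assumption_def)
  then have "\<forall>\<^sub>F n in sequentially. (MAX i\<in>{1..n}. X i \<bullet> X i) / real n < e\<^sup>2 / 2"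
    by (rule order_tendstoD) (use assms in simp)
  moreover have "(\<lambda>n. 1 / real n) \<longlonglongrightarrow> 0" by (rule lim_1_over_n)
  then have "\<forall>\<^sub>F n in sequentially. 1 / real n < e\<^sup>2 / 2"
    by (rule order_tendstoD) (use assms in simp)
  ultimately show ?thesis
  proof eventually_elim
    case (elim n)
    show ?case
    proof
      fix i assume i: "i \<in> {1..n}"
      then have n: "0 < real n" by simp
      have "X i \<bullet> X i \<le> (MAX i\<in>{1..n}. X i \<bullet> X i)" using i by (intro Max_ge) auto
      then have "X i \<bullet> X i / real n \<le> e\<^sup>2 / 2" using elim n by (meson divide_right_mono less_imp_le order_trans of_nat_0_le_iff)
      then have "(1 + X i \<bullet> X i) / real n \<le> e\<^sup>2" using elim unfolding add_divide_distrib by linarith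
      then have "sqrt ((1 + X i \<bullet> X i) / real n) \<le> e" using \<open>0 < e\<close> by (simp add: real_le_lsqrt real_sqrt_le_iff)
      then show "norm (1::real, X i) / sqrt (real n) \<le> e"
        by (simp add: norm_prod_def real_sqrt_divide power2_norm_eq_inner)
    qed
  qed
qed

lemma density_small_ball:
  assumes "continuous_positive_density_near D f x0"
  shows "\<exists>C>0. \<exists>d>0. \<forall>s. 0 \<le> s \<longrightarrow> s \<le> d \<longrightarrow> measure D {x0 - s..x0 + s} \<le> C * s"
    and "0 < f x0"
proof -
  obtain U where U: "open U" "x0 \<in> U" "continuous_on U f" "\<And>x. x \<in> U \<Longrightarrow> 0 < f x"
    and dens: "\<And>A. A \<in> sets borel \<Longrightarrow> A \<subseteq> U \<Longrightarrow> emeasure D A = (\<integral>\<^sup>+x\<in>A. ennreal (f x) \<partial>lborel)"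
    using assms by (auto simp: continuous_positive_density_near_def)
  show "0 < f x0" using U by simp
  obtain d where d: "0 < d" "cball x0 d \<subseteq> U" using U open_contains_cball by metis
  have "bounded (f ` cball x0 d)"
    by (intro compact_imp_bounded compact_continuous_image continuous_on_subset[OF U(3) d(2)]) auto
  then obtain C where C: "\<And>x. x \<in> cball x0 d \<Longrightarrow> \<bar>f x\<bar> \<le> C" by (metis bounded_iff imageI real_norm_def)
  have C0: "0 < C" using C[of x0] U(2) U(4)[of x0] d by auto
  have "measure D {x0 - s..x0 + s} \<le> (2 * C) * s" if s: "0 \<le> s" "s \<le> d" for s
  proof -
    have sub: "{x0 - s..x0 + s} \<subseteq> cball x0 d" using s by (auto simp: dist_real_def)
    have "emeasure D {x0 - s..x0 + s} = (\<integral>\<^sup>+x\<in>{x0 - s..x0 + s}. ennreal (f x) \<partial>lborel)"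
      using sub d by (intro dens) auto
    also have "\<dots> \<le> (\<integral>\<^sup>+x. ennreal C * indicator {x0 - s..x0 + s} x \<partial>lborel)"
    proof (rule nn_integral_mono)
      fix x show "ennreal (f x) * indicator {x0 - s..x0 + s} x \<le> ennreal C * indicator {x0 - s..x0 + s} x"
        using C[of x] sub by (cases "x \<in> {x0 - s..x0 + s}") (auto intro!: ennreal_leI)
    qed
    also have "\<dots> = ennreal ((2 * C) * s)"
      using s C0 by (simp add: nn_integral_cmult_indicator ennreal_mult[symmetric])
    finally show ?thesis using s C0 by (simp add: measure_def enn2real_leI)
  qed
  then show "\<exists>C>0. \<exists>d>0. \<forall>s. 0 \<le> s \<longrightarrow> s \<le> d \<longrightarrow> measure D {x0 - s..x0 + s} \<le> C * s"
    using C0 d by (intro exI[of _ "2 * C"] conjI exI[of _ d]) auto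
qed

section \<open>The model and root-n consistency\<close>

locale adaptive_lasso_quantile = prob_space M for M :: "'w measure" +
  fixes X :: "nat \<Rightarrow> real ^ 'p::finite"
    and Y \<epsilon> :: "nat \<Rightarrow> 'w \<Rightarrow> real"
    and D :: "real measure"
    and F f :: "real \<Rightarrow> real"
    and B :: "real set" and \<Gamma> :: "(real ^ 'p) set"
    and b0 :: real and \<phi>0 :: "real ^ 'p"
    and \<Upsilon> :: "real ^ 'p ^ 'p"
    and \<tau> g :: real and lam :: "nat \<Rightarrow> real"
    and b_hat b_star :: "nat \<Rightarrow> 'w \<Rightarrow> real"
    and \<phi>_hat \<phi>_star :: "nat \<Rightarrow> 'w \<Rightarrow> real ^ 'p"
  assumes tau: "0 < \<tau>" "\<tau> < 1"
    and model: "\<And>i \<omega>. 1 \<le> i \<Longrightarrow> \<omega> \<in> space M \<Longrightarrow> Y i \<omega> = X i \<bullet> \<phi>0 + \<epsilon> i \<omega>"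
    and indep: "indep_vars (\<lambda>_. borel) \<epsilon> {1..}"
    and ident: "\<And>i. 1 \<le> i \<Longrightarrow> distr M borel (\<epsilon> i) = D"
    and F: "F = cdf D"
    and quantile: "F b0 = \<tau>"
    and dens: "continuous_positive_density_near D f b0"
    and interior: "b0 \<in> interior B" "\<phi>0 \<in> interior \<Gamma>"
    and A1: "design_assumption X \<Upsilon>"
    and A2: "smoothness_assumption X \<Upsilon> F f B"
    and g: "0 < g"
    and lam_pos: "\<And>n. 1 \<le> n \<Longrightarrow> 0 < lam n"
    and lam_upper: "(\<lambda>n. real n powr (- 1 / 2) * lam n) \<longlonglongrightarrow> 0"
    and lam_lower: "filterlim (\<lambda>n. real n powr ((g - 1) / 2) * lam n) at_top sequentially"
    and argmin_hat: "\<And>n \<omega>. 1 \<le> n \<Longrightarrow> \<omega> \<in> space M \<Longrightarrow>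
      is_arg_min (quantile_objective \<tau> X (\<lambda>i. Y i \<omega>) n)
        (\<lambda>\<theta>. \<theta> \<in> B \<times> \<Gamma>) (b_hat n \<omega>, \<phi>_hat n \<omega>)"
    and meas_star: "\<And>n. 1 \<le> n \<Longrightarrow> \<phi>_star n \<in> borel_measurable M"
    and argmin_star: "\<And>n \<omega>. 1 \<le> n \<Longrightarrow> \<omega> \<in> space M \<Longrightarrow>
      is_arg_min (adaptive_lasso_objective \<tau> g (lam n) X (\<lambda>i. Y i \<omega>) (\<phi>_hat n \<omega>) n)
        (\<lambda>\<theta>. \<theta> \<in> B \<times> \<Gamma>) (b_star n \<omega>, \<phi>_star n \<omega>)"
begin

definition loss :: "nat \<Rightarrow> 'w \<Rightarrow> real \<times> (real^'p) \<Rightarrow> real" where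
  "loss n \<omega> = quantile_objective \<tau> X (\<lambda>i. Y i \<omega>) n"

text \<open>The limit of the expected increment of the loss in local coordinates. There is no product
  of intercept and slope: the regressors are asymptotically centred.\<close>
definition quad :: "real \<times> (real^'p) \<Rightarrow> real" where
  "quad u = f b0 / 2 * ((fst u)\<^sup>2 + snd u \<bullet> (\<Upsilon> *v snd u))"

lemma f_pos: "0 < f b0"
  using density_small_ball(2)[OF dens] .

lemma Upsilon_pd: "positive_definite \<Upsilon>"
  using A1 by (simp add: design_assumption_def)

lemma \<epsilon>_measurable: "1 \<le> i \<Longrightarrow> random_variable borel (\<epsilon> i)"
  using indep by (auto simp: indep_vars_def)

lemma D_real_distribution: "real_distribution D"
proof -
  have "real_distribution (distr M borel (\<epsilon> 1))" by (rule real_distribution_distr) (simp add: \<epsilon>_measurable)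
  then show ?thesis by (simp add: ident)
qed

lemma expectation_\<epsilon>:
  assumes "1 \<le> i" "h \<in> borel_measurable borel"
  shows "expectation (\<lambda>\<omega>. h (\<epsilon> i \<omega>)) = (\<integral>x. h x \<partial>D :: real)"
  unfolding ident[OF assms(1), symmetric] using assms \<epsilon>_measurable by (subst integral_distr) auto

lemma prob_\<epsilon>:
  assumes "1 \<le> i" "A \<in> sets borel"
  shows "prob {\<omega>\<in>space M. \<epsilon> i \<omega> \<in> A} = measure D A"
  unfolding ident[OF assms(1), symmetric] using assms \<epsilon>_measurable
  by (subst measure_distr) (auto simp: vimage_def Int_def conj_commute)

lemma expectation_le_quantile:
  assumes "1 \<le> i" shows "expectation (\<lambda>\<omega>. indicat_real {..0} (\<epsilon> i \<omega> - b0)) = \<tau>"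
proof -
  interpret D: real_distribution D by (rule D_real_distribution)
  have "expectation (\<lambda>\<omega>. indicat_real {..0} (\<epsilon> i \<omega> - b0)) = (\<integral>x. indicat_real {..b0} x \<partial>D)"
    using expectation_\<epsilon>[OF assms, of "indicat_real {..b0}"] by (simp add: indicator_def)
  also have "\<dots> = \<tau>" using quantile by (simp add: F cdf_def)
  finally show ?thesis .
qed

lemma integrable_le_quantile:
  assumes "1 \<le> i" shows "integrable M (\<lambda>\<omega>. indicat_real {..0} (\<epsilon> i \<omega> - b0))"
proof -
  note [measurable] = \<epsilon>_measurable[OF assms]
  show ?thesis by (rule integrable_const_bound[where B=1]) (auto simp: indicator_def)
qed

lemma expectation_check_score:
  assumes "1 \<le> i" shows "expectation (\<lambda>\<omega>. check_score \<tau> (\<epsilon> i \<omega> - b0)) = 0"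
  unfolding check_score_def
  using integrable_le_quantile[OF assms] expectation_le_quantile[OF assms] prob_space by simp

lemma expectation_check_score_square:
  assumes "1 \<le> i" shows "expectation (\<lambda>\<omega>. (check_score \<tau> (\<epsilon> i \<omega> - b0))\<^sup>2) = \<tau> * (1 - \<tau>)"
proof -
  have sq: "(check_score \<tau> x)\<^sup>2 = \<tau>\<^sup>2 + (1 - 2 * \<tau>) * indicator {..0} x" for x
    by (auto simp: check_score_def indicator_def power2_eq_square algebra_simps)
  show ?thesis
    unfolding sq using integrable_le_quantile[OF assms] expectation_le_quantile[OF assms] prob_space
    by (simp add: power2_eq_square algebra_simps)
qed

text \<open>The expected remainder is exactly the integral whose limit is prescribed by the smoothness assumption
  at \<open>b0\<close>.\<close>
lemma mean_remainder_quad: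
  "(\<lambda>n. \<Sum>i=1..n. expectation (\<lambda>\<omega>. knight_remainder (\<epsilon> i \<omega> - b0) ((1, X i) \<bullet> u / sqrt (real n)))) \<longlonglongrightarrow> quad u"
proof -
  let ?I = "\<lambda>n. (1 / real n) * (\<Sum>i=1..n. LBINT v=0..ereal (fst u + X i \<bullet> snd u).
      sqrt (real n) * (F (b0 + v / sqrt (real n)) - F b0))"
  have "?I \<longlonglongrightarrow> 1 / 2 * f b0 * ((fst u)\<^sup>2 + snd u \<bullet> (\<Upsilon> *v snd u))"
    using A2 interior(1) unfolding smoothness_assumption_def by blast
  also have "1 / 2 * f b0 * ((fst u)\<^sup>2 + snd u \<bullet> (\<Upsilon> *v snd u)) = quad u" by (simp add: quad_def)
  finally have lim: "?I \<longlonglongrightarrow> quad u" .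
  have "(\<Sum>i=1..n. expectation (\<lambda>\<omega>. knight_remainder (\<epsilon> i \<omega> - b0) ((1, X i) \<bullet> u / sqrt (real n)))) = ?I n" for n
  proof (cases "n = 0")
    case False
    then have k: "0 < sqrt (real n)" by simp
    have "expectation (\<lambda>\<omega>. knight_remainder (\<epsilon> i \<omega> - b0) ((1, X i) \<bullet> u / sqrt (real n)))
        = 1 / real n * (LBINT v=0..ereal (fst u + X i \<bullet> snd u). sqrt (real n) * (F (b0 + v / sqrt (real n)) - F b0))"
      if "1 \<le> i" for i
    proof -
      let ?c = "fst u + X i \<bullet> snd u"
      have "expectation (\<lambda>\<omega>. knight_remainder (\<epsilon> i \<omega> - b0) ((1, X i) \<bullet> u / sqrt (real n)))
          = (\<integral>x. knight_remainder (x - b0) (?c / sqrt (real n)) \<partial>D)"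
        using expectation_\<epsilon>[OF that, of "\<lambda>x. knight_remainder (x - b0) (?c / sqrt (real n))"]
        by (simp add: inner_prod_def)
      also have "\<dots> = 1 / sqrt (real n) * (LBINT v=0..ereal ?c. F (b0 + v / sqrt (real n)) - F b0)"
        using expectation_knight_remainder[OF D_real_distribution k, of b0 ?c] k by (simp add: F field_simps)
      also have "(LBINT v=0..ereal ?c. F (b0 + v / sqrt (real n)) - F b0)
          = 1 / sqrt (real n) * (LBINT v=0..ereal ?c. sqrt (real n) * (F (b0 + v / sqrt (real n)) - F b0))"
        using k by simp
      finally show ?thesis
      proof -
        have sq: "1 / sqrt (real n) * (1 / sqrt (real n)) = 1 / real n" by simp
        assume "expectation (\<lambda>\<omega>. knight_remainder (\<epsilon> i \<omega> - b0) ((1, X i) \<bullet> u / sqrt (real n)))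
          = 1 / sqrt (real n) * (1 / sqrt (real n) * (LBINT v=0..ereal ?c. sqrt (real n) * (F (b0 + v / sqrt (real n)) - F b0)))"
        then show ?thesis by (simp only: mult.assoc[symmetric] sq)
      qed
    qed
    then show ?thesis unfolding sum_distrib_left by (intro sum.cong) auto
  qed simp
  with lim show ?thesis by simp
qed

text \<open>The density near the quantile bounds the number of errors that fall close to it.\<close>
lemma small_ball_\<epsilon>: "\<exists>C>0. \<exists>d>0. \<forall>i\<ge>1. \<forall>s. 0 \<le> s \<longrightarrow> s \<le> d \<longrightarrow> prob {\<omega>\<in>space M. \<bar>\<epsilon> i \<omega> - b0\<bar> \<le> s} \<le> C * s"
proof -
  have eq: "{\<omega>\<in>space M. \<bar>\<epsilon> i \<omega> - b0\<bar> \<le> s} = {\<omega>\<in>space M. \<epsilon> i \<omega> \<in> {b0 - s..b0 + s}}" for i s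
    by (auto simp: abs_le_iff)
  have "prob {\<omega>\<in>space M. \<bar>\<epsilon> i \<omega> - b0\<bar> \<le> s} = measure D {b0 - s..b0 + s}" if "1 \<le> i" for i s
    unfolding eq by (rule prob_\<epsilon>[OF that]) simp
  moreover obtain C d where "0 < C" "0 < d" "\<And>s. 0 \<le> s \<Longrightarrow> s \<le> d \<Longrightarrow> measure D {b0 - s..b0 + s} \<le> C * s"
    using density_small_ball(1)[OF dens] by auto
  ultimately show ?thesis
    by (intro exI[of _ C] conjI exI[of _ d] allI impI) auto
qed

lemma design_square_bound:
  "\<exists>C>0. \<forall>\<^sub>F n in sequentially. (\<Sum>i=1..n. (norm (1::real, X i))\<^sup>2) / real n \<le> C"
proof -
  have sq: "(norm (1::real, X i))\<^sup>2 = 1 + (\<Sum>j\<in>UNIV. (X i \<bullet> axis j 1)\<^sup>2)" for i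
    by (simp add: norm_prod_def inner_axis norm_vec_def L2_set_def sum_nonneg)
  define C where "C = (\<Sum>j\<in>UNIV. axis j 1 \<bullet> (\<Upsilon> *v axis j 1)) + 2"
  have "(\<lambda>n. \<Sum>j\<in>UNIV. (\<Sum>i=1..n. (X i \<bullet> axis j 1)\<^sup>2) / real n) \<longlonglongrightarrow> (\<Sum>j\<in>UNIV. axis j 1 \<bullet> (\<Upsilon> *v axis j 1))"
    by (intro tendsto_sum design_assumption_quadratic[OF A1])
  then have "\<forall>\<^sub>F n in sequentially. (\<Sum>j\<in>UNIV. (\<Sum>i=1..n. (X i \<bullet> axis j 1)\<^sup>2) / real n) < C - 1"
    by (rule order_tendstoD) (simp add: C_def)
  then have "\<forall>\<^sub>F n in sequentially. (\<Sum>i=1..n. (norm (1::real, X i))\<^sup>2) / real n \<le> C"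
    using eventually_gt_at_top[of 0]
  proof eventually_elim
    case (elim n)
    have "(\<Sum>i=1..n. (norm (1::real, X i))\<^sup>2) = real n + (\<Sum>j\<in>UNIV. \<Sum>i=1..n. (X i \<bullet> axis j 1)\<^sup>2)"
      unfolding sq sum.distrib by (subst sum.swap) simp
    then have "(\<Sum>i=1..n. (norm (1::real, X i))\<^sup>2) / real n = 1 + (\<Sum>j\<in>UNIV. (\<Sum>i=1..n. (X i \<bullet> axis j 1)\<^sup>2) / real n)"
      using elim by (simp add: add_divide_distrib sum_divide_distrib)
    then show ?case using elim by simp
  qed
  moreover have "0 < C"
  proof -
    have "0 \<le> (\<Sum>j\<in>UNIV. axis j 1 \<bullet> (\<Upsilon> *v axis j 1))"
      using Upsilon_pd by (intro sum_nonneg) (auto simp: positive_definite_def intro!: less_imp_le)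
    then show ?thesis by (simp add: C_def)
  qed
  ultimately show ?thesis by blast
qed

lemma quad_continuous: "continuous_on S quad"
  unfolding quad_def[abs_def]
  by (intro continuous_intros continuous_on_compose2[OF linear_continuous_on[of "(*v) \<Upsilon>"]])
    (auto simp: linear_linear matrix_vector_mul_linear)

sublocale Q: quantile_design M "\<lambda>i \<omega>. \<epsilon> i \<omega> - b0" "\<lambda>i. (1, X i)" quad \<tau>
proof
  show "indep_vars (\<lambda>_. borel) (\<lambda>i \<omega>. \<epsilon> i \<omega> - b0) {1..}"
    by (rule indep_vars_compose2[OF indep]) auto
qed (use tau expectation_check_score small_ball_\<epsilon> design_assumption_max[OF A1] design_square_bound
      mean_remainder_quad quad_continuous in auto)

text \<open>The increment of the loss over its value at the true parameter, in the coordinates of \<open>rescale\<close>; see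
  \<open>loss_diff\<close>.\<close>
definition local_objective :: "nat \<Rightarrow> 'w \<Rightarrow> real \<times> (real^'p) \<Rightarrow> real" where
  "local_objective n \<omega> u = - (Q.score n \<omega> \<bullet> u) + Q.remainder n u \<omega>"

definition rescale :: "nat \<Rightarrow> real \<times> (real^'p) \<Rightarrow> real \<times> (real^'p)" where
  "rescale n \<theta> = sqrt (real n) *\<^sub>R (\<theta> - (b0, \<phi>0))"

abbreviation "u_hat n \<omega> \<equiv> rescale n (b_hat n \<omega>, \<phi>_hat n \<omega>)"
abbreviation "u_star n \<omega> \<equiv> rescale n (b_star n \<omega>, \<phi>_star n \<omega>)"

text \<open>Knight's identity, summed over the observations.\<close>
lemma loss_diff:
  assumes n: "1 \<le> n" and \<omega>: "\<omega> \<in> space M"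
  shows "loss n \<omega> \<theta> - loss n \<omega> (b0, \<phi>0) = local_objective n \<omega> (rescale n \<theta>)"
proof -
  have k: "0 < sqrt (real n)" using n by simp
  let ?s = "\<lambda>i. (1, X i) \<bullet> rescale n \<theta> / sqrt (real n)"
  have s: "?s i = (1, X i) \<bullet> (\<theta> - (b0, \<phi>0))" for i using k by (simp add: rescale_def)
  have ys: "Y i \<omega> - fst \<theta> - X i \<bullet> snd \<theta> = (\<epsilon> i \<omega> - b0) - ?s i" "Y i \<omega> - b0 - X i \<bullet> \<phi>0 = \<epsilon> i \<omega> - b0" if "1 \<le> i" for i
    using model[OF that \<omega>] unfolding s by (auto simp: inner_prod_def inner_diff_right)
  have "loss n \<omega> \<theta> - loss n \<omega> (b0, \<phi>0)
      = (\<Sum>i=1..n. check_loss \<tau> ((\<epsilon> i \<omega> - b0) - ?s i) - check_loss \<tau> (\<epsilon> i \<omega> - b0))"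
    unfolding loss_def quantile_objective_def case_prod_beta fst_conv snd_conv sum_subtractf[symmetric]
    by (intro sum.cong refl) (simp only: atLeastAtMost_iff ys)
  also have "\<dots> = local_objective n \<omega> (rescale n \<theta>)"
    unfolding check_loss_diff sum.distrib local_objective_def Q.remainder_def Q.score_inner
    by (simp add: sum_negf)
  finally show ?thesis .
qed

text \<open>Convexity of the check function along the ray from the true parameter, where the increment is zero.\<close>
lemma local_objective_ray:
  assumes n: "1 \<le> n" and \<omega>: "\<omega> \<in> space M" and t: "0 \<le> t" "t \<le> 1"
  shows "local_objective n \<omega> (t *\<^sub>R u) \<le> t * local_objective n \<omega> u"
proof -
  let ?s = "\<lambda>i. (1, X i) \<bullet> u / sqrt (real n)"
  have eq: "local_objective n \<omega> v = (\<Sum>i=1..n. check_loss \<tau> ((\<epsilon> i \<omega> - b0) - (1, X i) \<bullet> v / sqrt (real n)) - check_loss \<tau> (\<epsilon> i \<omega> - b0))" for v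
    unfolding check_loss_diff sum.distrib local_objective_def Q.remainder_def Q.score_inner
    by (simp add: sum_negf)
  have "check_loss \<tau> ((\<epsilon> i \<omega> - b0) - (1, X i) \<bullet> (t *\<^sub>R u) / sqrt (real n)) - check_loss \<tau> (\<epsilon> i \<omega> - b0)
      \<le> t * (check_loss \<tau> ((\<epsilon> i \<omega> - b0) - ?s i) - check_loss \<tau> (\<epsilon> i \<omega> - b0))" for i
  proof -
    have "(\<epsilon> i \<omega> - b0) - (1, X i) \<bullet> (t *\<^sub>R u) / sqrt (real n) = (1 - t) * (\<epsilon> i \<omega> - b0) + t * ((\<epsilon> i \<omega> - b0) - ?s i)"
      by (simp add: algebra_simps)
    then show ?thesis
      using check_loss_convex[of \<tau> t "\<epsilon> i \<omega> - b0" "(\<epsilon> i \<omega> - b0) - ?s i"] tau t by (simp add: algebra_simps)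
  qed
  then show ?thesis unfolding eq sum_distrib_left by (rule sum_mono)
qed

lemma quad_coercive:
  obtains \<kappa> where "0 < \<kappa>" "\<And>u. \<kappa> * (norm u)\<^sup>2 \<le> quad u"
proof -
  obtain k where k: "0 < k" "\<And>x. k * (norm x)\<^sup>2 \<le> x \<bullet> (\<Upsilon> *v x)"
    using positive_definite_coercive[OF Upsilon_pd] by blast
  show ?thesis
  proof (rule that)
    show "0 < f b0 / 2 * min 1 k" using f_pos k by simp
    fix u :: "real \<times> (real^'p)"
    have "min 1 k * (norm u)\<^sup>2 = min 1 k * (fst u)\<^sup>2 + min 1 k * (norm (snd u))\<^sup>2"
      by (simp add: norm_prod_def algebra_simps)
    also have "\<dots> \<le> 1 * (fst u)\<^sup>2 + k * (norm (snd u))\<^sup>2"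
      by (intro add_mono mult_right_mono) auto
    also have "\<dots> \<le> (fst u)\<^sup>2 + snd u \<bullet> (\<Upsilon> *v snd u)" using k(2) by simp
    finally have "f b0 / 2 * (min 1 k * (norm u)\<^sup>2) \<le> quad u"
      unfolding quad_def using f_pos by (intro mult_left_mono) auto
    then show "f b0 / 2 * min 1 k * (norm u)\<^sup>2 \<le> quad u" by (simp add: mult.assoc)
  qed
qed

text \<open>On a large sphere the quadratic part of the local objective dominates.\<close>
lemma local_objective_sphere:
  assumes "0 < e"
  obtains K where "0 < K" "eventually_prob e (\<lambda>n \<omega>. \<forall>u. norm u = K \<longrightarrow> 1 < local_objective n \<omega> u)"
proof -
  obtain K1 where K1: "0 < K1" and score: "eventually_prob (e / 2) (\<lambda>n \<omega>. norm (Q.score n \<omega>) \<le> K1)"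
    using Q.score_bounded[of "e / 2"] assms by auto
  obtain \<kappa> where \<kappa>: "0 < \<kappa>" "\<And>u. \<kappa> * (norm u)\<^sup>2 \<le> quad u" using quad_coercive by blast
  \<comment> \<open>on the sphere of radius \<open>K\<close> the quadratic part \<open>\<kappa> * K\<^sup>2\<close> exceeds the linear part \<open>K1 * K\<close> plus the errors\<close>
  define K where "K = (K1 + 2) / \<kappa> + 1"
  have K: "1 \<le> K" using K1 \<kappa> by (simp add: K_def)
  have gap: "1 < \<kappa> * K\<^sup>2 - K1 * K - 1"
  proof -
    have "\<kappa> * K = K1 + 2 + \<kappa>" using \<kappa> by (simp add: K_def field_simps)
    then have "\<kappa> * K\<^sup>2 - K1 * K = K * (2 + \<kappa>)" by (simp add: power2_eq_square algebra_simps)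
    moreover have "1 * (2 + \<kappa>) \<le> K * (2 + \<kappa>)" using K \<kappa> by (intro mult_right_mono) auto
    ultimately have "2 + \<kappa> \<le> \<kappa> * K\<^sup>2 - K1 * K" by (metis mult_1)
    then show ?thesis using \<kappa>(1) by simp
  qed
  have unif: "eventually_prob (e / 2) (\<lambda>n \<omega>. \<forall>u\<in>cball 0 K. \<bar>Q.remainder n u \<omega> - quad u\<bar> \<le> 1)"
    by (rule Q.remainder_uniform) (use K assms in auto)
  have ev: "eventually_prob e (\<lambda>n \<omega>. norm (Q.score n \<omega>) \<le> K1 \<and> (\<forall>u\<in>cball 0 K. \<bar>Q.remainder n u \<omega> - quad u\<bar> \<le> 1))"
    using eventually_prob_conj[OF score unif] by simp
  show ?thesis
  proof (rule that)
    show "0 < K" using K by simp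
    show "eventually_prob e (\<lambda>n \<omega>. \<forall>u. norm u = K \<longrightarrow> 1 < local_objective n \<omega> u)"
      using ev
    proof (rule eventually_prob_mono[OF _ always_eventually], intro allI ballI impI, elim conjE)
      fix n \<omega> and u :: "real \<times> (real^'p)"
      assume W: "norm (Q.score n \<omega>) \<le> K1" and H: "\<forall>u\<in>cball 0 K. \<bar>Q.remainder n u \<omega> - quad u\<bar> \<le> 1"
        and u: "norm u = K"
      have "Q.score n \<omega> \<bullet> u \<le> norm (Q.score n \<omega>) * norm u" by (rule norm_cauchy_schwarz)
      also have "\<dots> \<le> K1 * K" using W u K K1 by (intro mult_mono) auto
      finally have "Q.score n \<omega> \<bullet> u \<le> K1 * K" .
      moreover have "\<bar>Q.remainder n u \<omega> - quad u\<bar> \<le> 1" using H u by simp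
      moreover have "\<kappa> * K\<^sup>2 \<le> quad u" using \<kappa>(2)[of u] u by simp
      ultimately show "1 < local_objective n \<omega> u" unfolding local_objective_def using gap by linarith
    qed
  qed
qed

lemma true_parameter_feasible: "(b0, \<phi>0) \<in> B \<times> \<Gamma>"
  using interior by (auto dest: interior_subset[THEN subsetD])

text \<open>Root-\<open>n\<close> consistency of the preliminary estimator: the true parameter competes with it, so its local
  objective is nonpositive.\<close>
lemma hat_bounded:
  assumes "0 < e"
  obtains K where "0 < K" "eventually_prob e (\<lambda>n \<omega>. norm (u_hat n \<omega>) \<le> K)"
proof -
  obtain K where K: "0 < K" and sphere: "eventually_prob e (\<lambda>n \<omega>. \<forall>u. norm u = K \<longrightarrow> 1 < local_objective n \<omega> u)"
    using local_objective_sphere[OF assms] by blast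
  show ?thesis
  proof (rule that[OF K])
    show "eventually_prob e (\<lambda>n \<omega>. norm (u_hat n \<omega>) \<le> K)"
    proof (rule eventually_prob_elim[OF sphere eventually_ge_at_top[of 1]])
      fix n \<omega> assume n: "1 \<le> n" and \<omega>: "\<omega> \<in> space M" and sph: "\<forall>u. norm u = K \<longrightarrow> 1 < local_objective n \<omega> u"
      have "loss n \<omega> (b_hat n \<omega>, \<phi>_hat n \<omega>) \<le> loss n \<omega> (b0, \<phi>0)"
        using argmin_hat[OF n \<omega>] true_parameter_feasible unfolding is_arg_min_def loss_def by (meson not_le)
      then have "local_objective n \<omega> (u_hat n \<omega>) \<le> 0 * norm (u_hat n \<omega>)"
        using loss_diff[OF n \<omega>, of "(b_hat n \<omega>, \<phi>_hat n \<omega>)"] by simp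
      then show "norm (u_hat n \<omega>) \<le> K"
      proof (rule star_convex_localization[OF local_objective_ray[OF n \<omega>] K, rotated -1])
        show "0 * K < local_objective n \<omega> v" if "norm v = K" for v
          using sph[rule_format, OF that] by simp
      qed
    qed
  qed
qed

end

section \<open>The adaptive penalty\<close>

lemma const_over_sqrt_tendsto_0: "(\<lambda>n. c / sqrt (real n)) \<longlonglongrightarrow> 0"
  by (intro tendsto_divide_0[OF tendsto_const] filterlim_at_top_imp_at_infinity
      filterlim_compose[OF sqrt_at_top filterlim_real_sequentially])

context adaptive_lasso_quantile
begin

abbreviation active :: "'p set" where "active \<equiv> support_set \<phi>0"

text \<open>\<open>C\<close> bounds the weights of the relevant coordinates from above. On the irrelevant coordinates the
  reciprocals of the weights are bounded, which also covers infinite weights.\<close>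
definition weights_controlled :: "real \<Rightarrow> real \<Rightarrow> nat \<Rightarrow> 'w \<Rightarrow> bool" where
  "weights_controlled K C n \<omega> \<longleftrightarrow>
     (\<forall>j\<in>active. \<phi>_hat n \<omega> $ j \<noteq> 0 \<and> 1 / (\<bar>\<phi>_hat n \<omega> $ j\<bar> powr g) \<le> C) \<and>
     (\<forall>j\<in>-active. \<bar>\<phi>_hat n \<omega> $ j\<bar> powr g \<le> 1 / (sqrt (real n) / K) powr g)"

text \<open>The extended-real comparison of penalised objectives, in terms of real numbers.\<close>
lemma penalized_comparison:
  assumes n: "1 \<le> n" and \<omega>: "\<omega> \<in> space M" and K: "0 < K" and wc: "weights_controlled K C n \<omega>"
    and \<theta>: "(b', \<phi>') \<in> B \<times> \<Gamma>" and zero: "\<And>j. j \<notin> active \<Longrightarrow> \<phi>' $ j = 0"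
  shows "loss n \<omega> (b_star n \<omega>, \<phi>_star n \<omega>)
      + lam n * (sqrt (real n) / K) powr g * (\<Sum>j\<in>-active. \<bar>\<phi>_star n \<omega> $ j\<bar>)
    \<le> loss n \<omega> (b', \<phi>') + lam n * C * (\<Sum>j\<in>active. \<bar>\<phi>_star n \<omega> $ j - \<phi>' $ j\<bar>)"
proof -
  define m where "m = (sqrt (real n) / K) powr g"
  have m: "0 < m" "\<And>j. j \<notin> active \<Longrightarrow> \<bar>\<phi>_hat n \<omega> $ j\<bar> powr g \<le> 1 / m"
    and C: "\<And>j. j \<in> active \<Longrightarrow> \<phi>_hat n \<omega> $ j \<noteq> 0 \<and> 1 / (\<bar>\<phi>_hat n \<omega> $ j\<bar> powr g) \<le> C"
    using n K wc by (auto simp: m_def weights_controlled_def)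
  let ?h = "\<phi>_hat n \<omega>" and ?s = "\<phi>_star n \<omega>"
  let ?obj = "adaptive_lasso_objective \<tau> g (lam n) X (\<lambda>i. Y i \<omega>) ?h n"
  define w where "w j = 1 / (\<bar>?h $ j\<bar> powr g)" for j
  have w: "adaptive_weight g (?h $ j) = ereal (w j)" if "j \<in> active" for j
    using C[OF that] by (simp add: adaptive_weight_def w_def inverse_eq_divide)
  have m_le: "ereal m \<le> adaptive_weight g (?h $ j)" if "j \<notin> active" for j
  proof (cases "?h $ j = 0")
    case False
    then have "0 < \<bar>?h $ j\<bar> powr g" by simp
    then have "m \<le> inverse (\<bar>?h $ j\<bar> powr g)" using m(2)[OF that] m(1) by (simp add: field_simps)
    then show ?thesis using False by (simp add: adaptive_weight_def)
  qed (use g in \<open>simp add: adaptive_weight_def\<close>)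
  have split: "(\<Sum>j\<in>UNIV. a j) = (\<Sum>j\<in>active. a j) + (\<Sum>j\<in>-active. a j)" for a :: "'p \<Rightarrow> ereal"
    using sum.union_disjoint[of active "-active" a] by simp
  have lam: "0 < lam n" by (rule lam_pos[OF n])
  have opt: "?obj (b_star n \<omega>, ?s) \<le> ?obj (b', \<phi>')"
    using argmin_star[OF n \<omega>] \<theta> unfolding is_arg_min_def by (meson not_le)
  have obj': "?obj (b', \<phi>') = ereal (loss n \<omega> (b', \<phi>') + lam n * (\<Sum>j\<in>active. w j * \<bar>\<phi>' $ j\<bar>))"
  proof -
    have "(\<Sum>j\<in>UNIV. adaptive_weight g (?h $ j) * ereal \<bar>\<phi>' $ j\<bar>) = (\<Sum>j\<in>active. ereal (w j * \<bar>\<phi>' $ j\<bar>))"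
      unfolding split using w zero by (simp add: zero_ereal_def[symmetric])
    then show ?thesis by (simp add: adaptive_lasso_objective_def loss_def)
  qed
  have obj: "ereal (loss n \<omega> (b_star n \<omega>, ?s) + lam n * ((\<Sum>j\<in>active. w j * \<bar>?s $ j\<bar>) + (\<Sum>j\<in>-active. m * \<bar>?s $ j\<bar>)))
      \<le> ?obj (b_star n \<omega>, ?s)"
  proof -
    have "(\<Sum>j\<in>active. ereal (w j * \<bar>?s $ j\<bar>)) + (\<Sum>j\<in>-active. ereal (m * \<bar>?s $ j\<bar>))
        \<le> (\<Sum>j\<in>UNIV. adaptive_weight g (?h $ j) * ereal \<bar>?s $ j\<bar>)"
      unfolding split
    proof (intro add_mono sum_mono)
      fix j assume "j \<in> active"
      then show "ereal (w j * \<bar>?s $ j\<bar>) \<le> adaptive_weight g (?h $ j) * ereal \<bar>?s $ j\<bar>" using w by simp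
    next
      fix j assume "j \<in> - active"
      then show "ereal (m * \<bar>?s $ j\<bar>) \<le> adaptive_weight g (?h $ j) * ereal \<bar>?s $ j\<bar>"
        using ereal_mult_right_mono[OF m_le, of j "ereal \<bar>?s $ j\<bar>"] by simp
    qed
    then have "ereal (lam n) * ereal ((\<Sum>j\<in>active. w j * \<bar>?s $ j\<bar>) + (\<Sum>j\<in>-active. m * \<bar>?s $ j\<bar>))
        \<le> ereal (lam n) * (\<Sum>j\<in>UNIV. adaptive_weight g (?h $ j) * ereal \<bar>?s $ j\<bar>)"
      using lam by (intro ereal_mult_left_mono) auto
    from add_left_mono[OF this, of "ereal (loss n \<omega> (b_star n \<omega>, ?s))"] show ?thesis
      by (simp add: adaptive_lasso_objective_def loss_def)
  qed
  have "loss n \<omega> (b_star n \<omega>, ?s) + lam n * ((\<Sum>j\<in>active. w j * \<bar>?s $ j\<bar>) + (\<Sum>j\<in>-active. m * \<bar>?s $ j\<bar>))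
      \<le> loss n \<omega> (b', \<phi>') + lam n * (\<Sum>j\<in>active. w j * \<bar>\<phi>' $ j\<bar>)"
    using order_trans[OF obj opt] unfolding obj' ereal_less_eq(3) .
  then have "loss n \<omega> (b_star n \<omega>, ?s) + lam n * m * (\<Sum>j\<in>-active. \<bar>?s $ j\<bar>)
      \<le> loss n \<omega> (b', \<phi>') + lam n * (\<Sum>j\<in>active. w j * \<bar>\<phi>' $ j\<bar> - w j * \<bar>?s $ j\<bar>)"
    by (simp add: sum_subtractf sum_distrib_left algebra_simps)
  also have "(\<Sum>j\<in>active. w j * \<bar>\<phi>' $ j\<bar> - w j * \<bar>?s $ j\<bar>) \<le> (\<Sum>j\<in>active. C * \<bar>?s $ j - \<phi>' $ j\<bar>)"
  proof (rule sum_mono)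
    fix j assume j: "j \<in> active"
    have "w j * \<bar>\<phi>' $ j\<bar> - w j * \<bar>?s $ j\<bar> = w j * (\<bar>\<phi>' $ j\<bar> - \<bar>?s $ j\<bar>)" by (simp add: algebra_simps)
    also have "\<dots> \<le> w j * \<bar>?s $ j - \<phi>' $ j\<bar>" by (intro mult_left_mono) (auto simp: w_def)
    also have "\<dots> \<le> C * \<bar>?s $ j - \<phi>' $ j\<bar>" using C[OF j] by (intro mult_right_mono) (auto simp: w_def)
    finally show "w j * \<bar>\<phi>' $ j\<bar> - w j * \<bar>?s $ j\<bar> \<le> C * \<bar>?s $ j - \<phi>' $ j\<bar>" .
  qed
  finally show ?thesis using lam unfolding m_def by (simp add: sum_distrib_left mult.assoc)
qed

lemma sum_abs_le_norm: "(\<Sum>j\<in>J. \<bar>v $ j\<bar>) \<le> real CARD('p) * norm (v :: real^'p)"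
proof -
  have "(\<Sum>j\<in>J. \<bar>v $ j\<bar>) \<le> (\<Sum>j\<in>J. norm v)" by (intro sum_mono component_le_norm_cart)
  also have "\<dots> = real (card J) * norm v" by simp
  also have "\<dots> \<le> real CARD('p) * norm v" by (intro mult_right_mono) (auto intro!: card_mono)
  finally show ?thesis .
qed

lemma rescale_snd:
  assumes "1 \<le> n" shows "norm (\<phi> - \<phi>0) \<le> norm (rescale n (b, \<phi>)) / sqrt (real n)"
proof -
  have "norm (\<phi> - \<phi>0) \<le> norm ((b, \<phi>) - (b0, \<phi>0))"
    using norm_snd_le[of "\<phi> - \<phi>0" "b - b0"] by simp
  also have "\<dots> = norm (rescale n (b, \<phi>)) / sqrt (real n)" using assms unfolding rescale_def norm_scaleR by simp
  finally show ?thesis .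
qed

text \<open>The root-\<open>n\<close> rate of the preliminary estimator keeps the weights of the relevant coordinates
  bounded and makes those of the irrelevant ones at least of order \<open>n\<^bsup>g/2\<^esup>\<close>.\<close>
lemma eventually_weights_controlled:
  assumes e: "0 < e"
  obtains K C where "0 < K" "0 < C" "eventually_prob e (weights_controlled K C)"
proof -
  obtain K where K: "0 < K" and hat: "eventually_prob e (\<lambda>n \<omega>. norm (u_hat n \<omega>) \<le> K)"
    using hat_bounded[OF e] by blast
  obtain a where a: "0 < a" "\<And>j. j \<in> active \<Longrightarrow> a \<le> \<bar>\<phi>0 $ j\<bar>"
  proof (cases "active = {}")
    case False
    show ?thesis
    proof (rule that[of "Min ((\<lambda>j. \<bar>\<phi>0 $ j\<bar>) ` active)"])
      show "0 < Min ((\<lambda>j. \<bar>\<phi>0 $ j\<bar>) ` active)"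
        using False by (subst Min_gr_iff) (auto simp: support_set_def)
    qed auto
  qed (use that[of 1] in auto)
  have small: "\<forall>\<^sub>F n in sequentially. K / sqrt (real n) < a / 2"
    by (rule order_tendstoD(2)[OF const_over_sqrt_tendsto_0]) (use a in simp)
  show ?thesis
  proof (rule that[OF K])
    show "0 < 1 / (a / 2) powr g" using a by simp
    show "eventually_prob e (weights_controlled K (1 / (a / 2) powr g))"
    proof (rule eventually_prob_elim[OF hat eventually_conj[OF small eventually_ge_at_top[of 1]]], elim conjE)
      fix n \<omega> assume sm: "K / sqrt (real n) < a / 2" and n: "1 \<le> n" and h: "norm (u_hat n \<omega>) \<le> K"
      have dist: "\<bar>\<phi>_hat n \<omega> $ j - \<phi>0 $ j\<bar> \<le> K / sqrt (real n)" for j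
        using component_le_norm_cart[of "\<phi>_hat n \<omega> - \<phi>0" j] rescale_snd[OF n, of "\<phi>_hat n \<omega>" "b_hat n \<omega>"]
          divide_right_mono[OF h, of "sqrt (real n)"] by simp
      show "weights_controlled K (1 / (a / 2) powr g) n \<omega>"
        unfolding weights_controlled_def
      proof (intro conjI ballI)
        fix j assume "j \<in> active"
        then have big: "a / 2 \<le> \<bar>\<phi>_hat n \<omega> $ j\<bar>" using dist[of j] a(2)[of j] sm by linarith
        then show "\<phi>_hat n \<omega> $ j \<noteq> 0" using a by auto
        show "1 / (\<bar>\<phi>_hat n \<omega> $ j\<bar> powr g) \<le> 1 / (a / 2) powr g"
          using big a g by (intro divide_left_mono powr_mono2) (auto intro!: mult_pos_pos)
      next
        fix j assume "j \<in> -active"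
        then have "\<bar>\<phi>_hat n \<omega> $ j\<bar> \<le> K / sqrt (real n)" using dist[of j] by (simp add: support_set_def)
        then have "\<bar>\<phi>_hat n \<omega> $ j\<bar> powr g \<le> (K / sqrt (real n)) powr g" using g by (intro powr_mono2) auto
        also have "\<dots> = 1 / (sqrt (real n) / K) powr g" using K n by (simp add: powr_divide)
        finally show "\<bar>\<phi>_hat n \<omega> $ j\<bar> powr g \<le> 1 / (sqrt (real n) / K) powr g" .
      qed
    qed
  qed
qed

lemma lam_over_sqrt: "(\<lambda>n. lam n / sqrt (real n)) \<longlonglongrightarrow> 0"
proof -
  have "real n powr (- 1 / 2) * lam n = lam n / sqrt (real n)" for n
    by (simp add: powr_minus_divide powr_half_sqrt)
  then show ?thesis using lam_upper by simp
qed

text \<open>The factor \<open>lam n\<close> times the lower bound for the irrelevant weights is compared with \<open>n powr (- s)\<close>: for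
  \<open>s = - 1 / 2\<close> this is the penalty per unit of a rescaled coordinate, for \<open>s = - 1\<close> the comparison is with
  the Lipschitz constant of the loss, which is of order \<open>n\<close>.\<close>
lemma irrelevant_weight_at_top:
  assumes K: "0 < K"
    and lim: "filterlim (\<lambda>n. real n powr (g / 2 + s) * lam n) at_top sequentially"
  shows "filterlim (\<lambda>n. lam n * (sqrt (real n) / K) powr g * real n powr s) at_top sequentially"
proof -
  have "filterlim (\<lambda>n. K powr (- g) * (real n powr (g / 2 + s) * lam n)) at_top sequentially"
    using K by (intro filterlim_tendsto_pos_mult_at_top[OF tendsto_const _ lim]) simp
  moreover have "K powr (- g) * (real n powr (g / 2 + s) * lam n) = lam n * (sqrt (real n) / K) powr g * real n powr s" for n
    using K by (simp add: powr_divide powr_minus_divide powr_add powr_half_sqrt[symmetric] powr_powr)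
  ultimately show ?thesis by simp
qed

text \<open>The penalty favours moving away from the true parameter only through the relevant coordinates, and
  by at most \<open>\<delta>\<close> per unit of rescaled distance, where \<open>\<delta>\<close> tends to zero. This cannot beat the loss on a
  large sphere.\<close>
lemma star_bounded:
  assumes "0 < e"
  obtains K where "0 < K" "eventually_prob e (\<lambda>n \<omega>. norm (u_star n \<omega>) \<le> K)"
proof -
  obtain K where K: "0 < K" and sphere: "eventually_prob (e / 2) (\<lambda>n \<omega>. \<forall>u. norm u = K \<longrightarrow> 1 < local_objective n \<omega> u)"
    using local_objective_sphere[of "e / 2"] assms by auto
  obtain K0 C where K0: "0 < K0" and C: "0 < C" and wc: "eventually_prob (e / 2) (weights_controlled K0 C)"
    using eventually_weights_controlled[of "e / 2"] assms by auto
  have "(\<lambda>n. lam n / sqrt (real n) * (C * real CARD('p) * K)) \<longlonglongrightarrow> 0 * (C * real CARD('p) * K)"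
    by (intro tendsto_mult lam_over_sqrt tendsto_const)
  then have small: "\<forall>\<^sub>F n in sequentially. lam n / sqrt (real n) * (C * real CARD('p) * K) < 1"
    by (intro order_tendstoD) auto
  have "eventually_prob (e / 2 + e / 2) (\<lambda>n \<omega>. norm (u_star n \<omega>) \<le> K)"
  proof (rule eventually_prob_elim[OF eventually_prob_conj[OF sphere wc]
        eventually_conj[OF small eventually_ge_at_top[of 1]]], elim conjE)
    fix n \<omega>
    assume sm: "lam n / sqrt (real n) * (C * real CARD('p) * K) < 1" and n: "1 \<le> n" and \<omega>: "\<omega> \<in> space M"
      and w: "weights_controlled K0 C n \<omega>" and sph: "\<forall>u. norm u = K \<longrightarrow> 1 < local_objective n \<omega> u"
    let ?u = "u_star n \<omega>" and ?m = "(sqrt (real n) / K0) powr g"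
    define \<delta> where "\<delta> = lam n * C * real CARD('p) / sqrt (real n)"
    have m: "0 < ?m" using n K0 by simp
    have lam: "0 < lam n" by (rule lam_pos[OF n])
    have "0 \<le> lam n * ?m * (\<Sum>j\<in>-active. \<bar>\<phi>_star n \<omega> $ j\<bar>)"
      using lam m by (intro mult_nonneg_nonneg sum_nonneg) auto
    moreover have "loss n \<omega> (b_star n \<omega>, \<phi>_star n \<omega>) + lam n * ?m * (\<Sum>j\<in>-active. \<bar>\<phi>_star n \<omega> $ j\<bar>)
        \<le> loss n \<omega> (b0, \<phi>0) + lam n * C * (\<Sum>j\<in>active. \<bar>\<phi>_star n \<omega> $ j - \<phi>0 $ j\<bar>)"
      by (rule penalized_comparison[OF n \<omega> K0 w true_parameter_feasible]) (simp add: support_set_def)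
    moreover have "lam n * C * (\<Sum>j\<in>active. \<bar>\<phi>_star n \<omega> $ j - \<phi>0 $ j\<bar>) \<le> \<delta> * norm ?u"
    proof -
      have "(\<Sum>j\<in>active. \<bar>\<phi>_star n \<omega> $ j - \<phi>0 $ j\<bar>) \<le> real CARD('p) * norm (\<phi>_star n \<omega> - \<phi>0)"
        using sum_abs_le_norm[of "\<phi>_star n \<omega> - \<phi>0" active] by simp
      also have "\<dots> \<le> real CARD('p) * (norm ?u / sqrt (real n))"
        by (intro mult_left_mono rescale_snd[OF n]) simp
      finally have "lam n * C * (\<Sum>j\<in>active. \<bar>\<phi>_star n \<omega> $ j - \<phi>0 $ j\<bar>) \<le> lam n * C * (real CARD('p) * (norm ?u / sqrt (real n)))"
        using lam C by (intro mult_left_mono) auto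
      then show ?thesis by (simp add: \<delta>_def mult_ac)
    qed
    ultimately have u: "local_objective n \<omega> ?u \<le> \<delta> * norm ?u"
      using loss_diff[OF n \<omega>, of "(b_star n \<omega>, \<phi>_star n \<omega>)"] by linarith
    have \<delta>: "\<delta> * K < 1" using sm by (simp add: \<delta>_def mult_ac)
    show "norm ?u \<le> K"
    proof (rule star_convex_localization[OF local_objective_ray[OF n \<omega>] K _ u])
      show "\<delta> * K < local_objective n \<omega> v" if "norm v = K" for v
        using sph[rule_format, OF that] \<delta> by simp
    qed
  qed
  with K show ?thesis using that by simp
qed

lemma feasible_ball:
  "\<exists>\<rho>>0. (\<forall>b. \<bar>b - b0\<bar> < \<rho> \<longrightarrow> b \<in> B) \<and> (\<forall>\<phi>. norm (\<phi> - \<phi>0) < \<rho> \<longrightarrow> \<phi> \<in> \<Gamma>)"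
proof -
  obtain r1 r2 where "0 < r1" "ball b0 r1 \<subseteq> B" "0 < r2" "ball \<phi>0 r2 \<subseteq> \<Gamma>"
    using interior by (auto simp: mem_interior)
  then show ?thesis
    by (intro exI[of _ "min r1 r2"]) (auto simp: subset_eq dist_norm norm_minus_commute abs_minus_commute)
qed

text \<open>Moving the irrelevant coordinates to zero changes the loss by at most a constant times \<open>n\<close> per
  unit, which is less than the penalty that it saves.\<close>
lemma selection_consistency:
  assumes lim: "filterlim (\<lambda>n. real n powr (g / 2 - 1) * lam n) at_top sequentially" and e: "0 < e"
  shows "eventually_prob e (\<lambda>n \<omega>. support_set (\<phi>_star n \<omega>) = active)"
proof -
  obtain K where K: "0 < K" and star: "eventually_prob (e / 2) (\<lambda>n \<omega>. norm (u_star n \<omega>) \<le> K)"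
    using star_bounded[of "e / 2"] e by auto
  obtain K0 C where K0: "0 < K0" and wc: "eventually_prob (e / 2) (weights_controlled K0 C)"
    using eventually_weights_controlled[OF half_gt_zero[OF e]] by blast
  obtain C2 where C2: "0 < C2" and sq: "\<forall>\<^sub>F n in sequentially. (\<Sum>i=1..n. (norm (1::real, X i))\<^sup>2) / real n \<le> C2"
    using design_square_bound by blast
  obtain \<rho> where \<rho>: "0 < \<rho>" "\<And>\<phi>. norm (\<phi> - \<phi>0) < \<rho> \<Longrightarrow> \<phi> \<in> \<Gamma>" using feasible_ball by blast
  have rel: "\<forall>\<^sub>F n in sequentially. \<forall>j\<in>active. K / sqrt (real n) < \<bar>\<phi>0 $ j\<bar>"
    by (rule eventually_ball_finite, simp, intro ballI order_tendstoD(2)[OF const_over_sqrt_tendsto_0])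
      (simp add: support_set_def)
  have near: "\<forall>\<^sub>F n in sequentially. K / sqrt (real n) < \<rho>"
    by (rule order_tendstoD(2)[OF const_over_sqrt_tendsto_0 \<rho>(1)])
  have "filterlim (\<lambda>n. lam n * (sqrt (real n) / K0) powr g * real n powr (- 1)) at_top sequentially"
    by (rule irrelevant_weight_at_top[OF K0]) (use lim in simp)
  then have pen: "\<forall>\<^sub>F n in sequentially. C2 < lam n * (sqrt (real n) / K0) powr g * real n powr (- 1)"
    by (simp add: filterlim_at_top_dense)
  have "eventually_prob (e / 2 + e / 2) (\<lambda>n \<omega>. support_set (\<phi>_star n \<omega>) = active)"
  proof (rule eventually_prob_elim[OF eventually_prob_conj[OF star wc] eventually_conj[OF rel
        eventually_conj[OF near eventually_conj[OF pen eventually_conj[OF sq eventually_ge_at_top[of 1]]]]]], elim conjE)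
    fix n \<omega>
    assume rel: "\<forall>j\<in>active. K / sqrt (real n) < \<bar>\<phi>0 $ j\<bar>" and near: "K / sqrt (real n) < \<rho>"
      and pen: "C2 < lam n * (sqrt (real n) / K0) powr g * real n powr (- 1)"
      and sq: "(\<Sum>i=1..n. (norm (1::real, X i))\<^sup>2) / real n \<le> C2"
      and n: "1 \<le> n" and \<omega>: "\<omega> \<in> space M"
      and s: "norm (u_star n \<omega>) \<le> K" and w: "weights_controlled K0 C n \<omega>"
    let ?s = "\<phi>_star n \<omega>" and ?m = "(sqrt (real n) / K0) powr g"
    define S where "S = (\<Sum>j\<in>-active. \<bar>?s $ j\<bar>)"
    \<comment> \<open>the competitor keeps the relevant coordinates, so the penalties on them cancel\<close>
    define \<phi>' where "\<phi>' = (\<chi> j. if j \<in> active then ?s $ j else 0)"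
    have n0: "0 < real n" using n by simp
    have m: "0 < ?m" using n K0 by simp
    have close: "norm (?s - \<phi>0) \<le> K / sqrt (real n)"
      using rescale_snd[OF n, of ?s "b_star n \<omega>"] divide_right_mono[OF s, of "sqrt (real n)"] by simp
    have "norm (\<phi>' - \<phi>0) \<le> norm (?s - \<phi>0)"
      by (rule norm_le_componentwise_cart) (auto simp: \<phi>'_def support_set_def)
    then have "\<phi>' \<in> \<Gamma>" using close near by (intro \<rho>(2)) simp
    moreover have "b_star n \<omega> \<in> B" using argmin_star[OF n \<omega>] by (simp add: is_arg_min_def)
    ultimately have feas: "(b_star n \<omega>, \<phi>') \<in> B \<times> \<Gamma>" by simp
    have "loss n \<omega> (b_star n \<omega>, ?s) + lam n * ?m * (\<Sum>j\<in>-active. \<bar>?s $ j\<bar>)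
        \<le> loss n \<omega> (b_star n \<omega>, \<phi>') + lam n * C * (\<Sum>j\<in>active. \<bar>?s $ j - \<phi>' $ j\<bar>)"
      by (rule penalized_comparison[OF n \<omega> K0 w feas]) (simp add: \<phi>'_def)
    moreover have "(\<Sum>j\<in>active. \<bar>?s $ j - \<phi>' $ j\<bar>) = 0" by (intro sum.neutral) (simp add: \<phi>'_def)
    ultimately have cmp: "loss n \<omega> (b_star n \<omega>, ?s) + lam n * ?m * S \<le> loss n \<omega> (b_star n \<omega>, \<phi>')"
      by (simp add: S_def)
    have normS: "norm (?s - \<phi>') \<le> S"
    proof -
      have "norm (?s - \<phi>') \<le> (\<Sum>j\<in>UNIV. \<bar>(?s - \<phi>') $ j\<bar>)" by (rule norm_le_l1_cart)
      also have "\<dots> = (\<Sum>j\<in>-active. \<bar>(?s - \<phi>') $ j\<bar>)"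
        by (rule sum.mono_neutral_right) (auto simp: \<phi>'_def)
      also have "\<dots> = S" unfolding S_def by (intro sum.cong) (auto simp: \<phi>'_def)
      finally show ?thesis .
    qed
    have "loss n \<omega> (b_star n \<omega>, \<phi>') - loss n \<omega> (b_star n \<omega>, ?s) \<le> (\<Sum>i=1..n. (norm (1::real, X i))\<^sup>2 * S)"
      unfolding loss_def quantile_objective_def case_prod_beta fst_conv snd_conv sum_subtractf[symmetric]
    proof (rule sum_mono)
      fix i
      have "check_loss \<tau> (Y i \<omega> - b_star n \<omega> - X i \<bullet> \<phi>') - check_loss \<tau> (Y i \<omega> - b_star n \<omega> - X i \<bullet> ?s)
          \<le> \<bar>X i \<bullet> (?s - \<phi>')\<bar>"
        using check_loss_Lipschitz[of \<tau> "Y i \<omega> - b_star n \<omega> - X i \<bullet> \<phi>'" "Y i \<omega> - b_star n \<omega> - X i \<bullet> ?s"] tau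
        by (simp add: inner_diff_right)
      also have "\<dots> \<le> norm (X i) * norm (?s - \<phi>')" by (rule Cauchy_Schwarz_ineq2)
      also have "\<dots> \<le> (norm (1::real, X i))\<^sup>2 * S"
      proof (intro mult_mono normS)
        have "(norm (X i) - 1 / 2)\<^sup>2 = (norm (X i))\<^sup>2 - norm (X i) + 1 / 4"
          by (simp add: power2_eq_square algebra_simps)
        moreover have "0 \<le> (norm (X i) - 1 / 2)\<^sup>2" by (rule zero_le_power2)
        ultimately have "norm (X i) \<le> 1 + (norm (X i))\<^sup>2" by linarith
        then show "norm (X i) \<le> (norm (1::real, X i))\<^sup>2" by (simp add: norm_prod_def)
      qed auto
      finally show "check_loss \<tau> (Y i \<omega> - b_star n \<omega> - X i \<bullet> \<phi>') - check_loss \<tau> (Y i \<omega> - b_star n \<omega> - X i \<bullet> ?s)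
          \<le> (norm (1::real, X i))\<^sup>2 * S" .
    qed
    also have "\<dots> = (\<Sum>i=1..n. (norm (1::real, X i))\<^sup>2) * S" by (simp add: sum_distrib_right)
    also have "\<dots> \<le> (C2 * real n) * S"
      using sq n0 by (intro mult_right_mono) (auto simp: S_def divide_le_eq intro!: sum_nonneg)
    finally have "(lam n * ?m) * S \<le> (C2 * real n) * S" using cmp by linarith
    moreover have "C2 * real n < lam n * ?m"
      using pen n0 by (simp add: powr_minus_divide field_simps)
    ultimately have "S \<le> 0" by (simp add: mult_le_cancel_right)
    then have "S = 0" by (intro antisym) (auto simp: S_def intro!: sum_nonneg)
    then have zero: "?s $ j = 0" if "j \<notin> active" for j
      using that unfolding S_def by (subst (asm) sum_nonneg_eq_0_iff) auto
    have "?s $ j \<noteq> 0" if "j \<in> active" for j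
    proof -
      have "\<bar>(?s - \<phi>0) $ j\<bar> < \<bar>\<phi>0 $ j\<bar>"
        using component_le_norm_cart[of "?s - \<phi>0" j] close rel that by fastforce
      then show ?thesis by auto
    qed
    then show "support_set ?s = active" using zero by (auto simp: support_set_def)
  qed
  then show ?thesis by simp
qed

end

section \<open>The limit law\<close>

context adaptive_lasso_quantile
begin

text \<open>The minimiser of the quadratic approximation \<open>quad u - score \<bullet> u\<close> among the \<open>u\<close> that vanish on the
  irrelevant coordinates, in closed form: linear in the score.\<close>
definition oracle_fit :: "('a::finite \<Rightarrow> 'p) \<Rightarrow> nat \<Rightarrow> 'w \<Rightarrow> real \<times> (real^'p)" where
  "oracle_fit \<iota> n \<omega> = (fst (Q.score n \<omega>) / f b0,
     embed_vector \<iota> ((1 / f b0) *\<^sub>R (matrix_inv (principal_submatrix \<iota> \<Upsilon>) *v subvector \<iota> (snd (Q.score n \<omega>)))))"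

text \<open>Second-order Taylor expansion of the quadratic approximation at \<open>u'\<close>.\<close>
lemma quad_translate:
  "quad u - W \<bullet> u - (quad u' - W \<bullet> u')
    = quad (u - u') + (f b0 * fst u' - fst W) * (fst u - fst u')
      + (f b0 *\<^sub>R (\<Upsilon> *v snd u') - snd W) \<bullet> (snd u - snd u')"
proof -
  have sym: "snd u' \<bullet> (\<Upsilon> *v snd u) = snd u \<bullet> (\<Upsilon> *v snd u')"
    by (rule positive_definite_symmetric[OF Upsilon_pd])
  show ?thesis
    by (simp add: quad_def inner_prod_def matrix_vector_mult_diff_distrib inner_diff_left inner_diff_right
        sym inner_commute[of "\<Upsilon> *v snd u'"] power2_eq_square algebra_simps add_divide_distrib diff_divide_distrib)
qed

context
  fixes \<iota> :: "'a::finite \<Rightarrow> 'p"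
  assumes bij: "bij_betw \<iota> UNIV active"
begin

lemma inj_index: "inj \<iota>" and range_index: "range \<iota> = active"
  using bij by (auto simp: bij_betw_def)

lemma oracle_irrelevant: "j \<notin> active \<Longrightarrow> snd (oracle_fit \<iota> n \<omega>) $ j = 0"
  by (simp add: oracle_fit_def embed_vector_def range_index)

text \<open>The normal equations of the restricted quadratic problem.\<close>
lemma oracle_stationary:
  assumes "j \<in> active"
  shows "(f b0 *\<^sub>R (\<Upsilon> *v snd (oracle_fit \<iota> n \<omega>)) - snd (Q.score n \<omega>)) $ j = 0"
proof -
  let ?Q = "principal_submatrix \<iota> \<Upsilon>"
  have pd: "positive_definite ?Q" by (rule positive_definite_principal_submatrix[OF inj_index Upsilon_pd])
  obtain a where j: "j = \<iota> a" using assms range_index by auto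
  let ?v = "(1 / f b0) *\<^sub>R (matrix_inv ?Q *v subvector \<iota> (snd (Q.score n \<omega>)))"
  have "subvector \<iota> (\<Upsilon> *v snd (oracle_fit \<iota> n \<omega>)) = ?Q *v ?v"
    by (simp add: oracle_fit_def principal_submatrix_vector_mult[OF inj_index])
  also have "\<dots> = (1 / f b0) *\<^sub>R subvector \<iota> (snd (Q.score n \<omega>))"
    by (simp add: matrix_vector_mult_scaleR matrix_vector_mul_assoc positive_definite_inverse[OF pd])
  finally have "subvector \<iota> (\<Upsilon> *v snd (oracle_fit \<iota> n \<omega>)) $ a = ((1 / f b0) *\<^sub>R subvector \<iota> (snd (Q.score n \<omega>))) $ a"
    by simp
  then show ?thesis using f_pos by (simp add: subvector_def j)
qed

lemma oracle_bounds:
  obtains c where "0 < c" "\<And>n \<omega>. norm (oracle_fit \<iota> n \<omega>) \<le> c * norm (Q.score n \<omega>)"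
    "\<And>n \<omega>. norm (f b0 *\<^sub>R (\<Upsilon> *v snd (oracle_fit \<iota> n \<omega>)) - snd (Q.score n \<omega>)) \<le> c * norm (Q.score n \<omega>)"
proof -
  let ?R = "matrix_inv (principal_submatrix \<iota> \<Upsilon>)"
  obtain k1 where k1: "0 < k1" "\<And>x. norm (?R *v x) \<le> norm x * k1"
    using bounded_linear.pos_bounded[OF matrix_vector_mul_bounded_linear[of ?R]] by blast
  obtain k2 where k2: "0 < k2" "\<And>x. norm (\<Upsilon> *v x) \<le> norm x * k2"
    using bounded_linear.pos_bounded[OF matrix_vector_mul_bounded_linear[of \<Upsilon>]] by blast
  define c1 where "c1 = (1 + k1) / f b0"
  have c1: "0 < c1" using f_pos k1 by (simp add: c1_def)
  have o: "norm (oracle_fit \<iota> n \<omega>) \<le> c1 * norm (Q.score n \<omega>)" for n \<omega>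
  proof -
    let ?W = "Q.score n \<omega>"
    have "norm (oracle_fit \<iota> n \<omega>) \<le> norm (fst (oracle_fit \<iota> n \<omega>)) + norm (snd (oracle_fit \<iota> n \<omega>))"
      using norm_Pair_le[of "fst (oracle_fit \<iota> n \<omega>)" "snd (oracle_fit \<iota> n \<omega>)"] by simp
    also have "norm (fst (oracle_fit \<iota> n \<omega>)) \<le> norm ?W / f b0"
      using f_pos norm_fst_le[of "fst ?W" "snd ?W"] by (simp add: oracle_fit_def divide_right_mono)
    also have "norm (snd (oracle_fit \<iota> n \<omega>)) \<le> k1 * norm ?W / f b0"
    proof -
      have "norm (subvector \<iota> (snd ?W)) \<le> norm ?W"
        using norm_subvector_le[OF inj_index, of "snd ?W"] norm_snd_le[of "snd ?W" "fst ?W"] by simp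
      then have "norm (?R *v subvector \<iota> (snd ?W)) \<le> norm ?W * k1"
        by (intro order_trans[OF k1(2)] mult_right_mono) (use k1 in auto)
      then show ?thesis using f_pos
        by (simp add: oracle_fit_def norm_embed_vector[OF inj_index] divide_right_mono mult.commute)
    qed
    finally show ?thesis by (simp add: c1_def add_divide_distrib algebra_simps)
  qed
  define c where "c = c1 + f b0 * (c1 * k2) + 1"
  have cp: "0 < c" using c1 f_pos k2 by (simp add: c_def add_pos_pos)
  show ?thesis
  proof (rule that[OF cp])
    fix n \<omega>
    let ?W = "Q.score n \<omega>" and ?w = "snd (oracle_fit \<iota> n \<omega>)"
    have "c1 * norm ?W \<le> c * norm ?W"
      using c1 f_pos k2 by (intro mult_right_mono) (auto simp: c_def)
    then show "norm (oracle_fit \<iota> n \<omega>) \<le> c * norm ?W" using o[of n \<omega>] by simp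
    have "norm (f b0 *\<^sub>R (\<Upsilon> *v ?w) - snd ?W) \<le> f b0 * norm (\<Upsilon> *v ?w) + norm (snd ?W)"
      using norm_triangle_ineq4[of "f b0 *\<^sub>R (\<Upsilon> *v ?w)" "snd ?W"] f_pos by simp
    also have "\<dots> \<le> f b0 * (c1 * norm ?W * k2) + norm ?W"
    proof (intro add_mono mult_left_mono)
      have "norm ?w \<le> c1 * norm ?W"
        using o[of n \<omega>] norm_snd_le[of ?w "fst (oracle_fit \<iota> n \<omega>)"] by simp
      then show "norm (\<Upsilon> *v ?w) \<le> c1 * norm ?W * k2"
        by (intro order_trans[OF k2(2)] mult_right_mono) (use k2 in auto)
      show "norm (snd ?W) \<le> norm ?W" using norm_snd_le[of "snd ?W" "fst ?W"] by simp
    qed (use f_pos in simp)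
    also have "\<dots> \<le> c * norm ?W" using c1 by (simp add: c_def algebra_simps)
    finally show "norm (f b0 *\<^sub>R (\<Upsilon> *v ?w) - snd ?W) \<le> c * norm ?W" .
  qed
qed

text \<open>By coercivity and the Taylor expansion, a multiple of the squared distance between the two is at most
  the difference of the quadratic approximations minus the contribution of the gradient, which only
  involves the irrelevant coordinates. Optimality of the penalised
  estimator bounds the former, and the penalty on the irrelevant coordinates, whose factor tends to
  infinity, absorbs the latter.\<close>
lemma star_near_oracle_fit:
  assumes d: "0 < d" and e: "0 < e"
  shows "eventually_prob e (\<lambda>n \<omega>. norm (u_star n \<omega> - oracle_fit \<iota> n \<omega>) \<le> d)"
proof -
  obtain K1 where K1: "0 < K1" and score: "eventually_prob (e / 4) (\<lambda>n \<omega>. norm (Q.score n \<omega>) \<le> K1)"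
    using Q.score_bounded[of "e / 4"] e by auto
  obtain K0 C where K0: "0 < K0" and C: "0 < C" and wc: "eventually_prob (e / 4) (weights_controlled K0 C)"
    using eventually_weights_controlled[of "e / 4"] e by auto
  obtain K where K: "0 < K" and star: "eventually_prob (e / 4) (\<lambda>n \<omega>. norm (u_star n \<omega>) \<le> K)"
    using star_bounded[of "e / 4"] e by auto
  obtain c where c: "0 < c" "\<And>n \<omega>. norm (oracle_fit \<iota> n \<omega>) \<le> c * norm (Q.score n \<omega>)"
    "\<And>n \<omega>. norm (f b0 *\<^sub>R (\<Upsilon> *v snd (oracle_fit \<iota> n \<omega>)) - snd (Q.score n \<omega>)) \<le> c * norm (Q.score n \<omega>)"
    using oracle_bounds by blast
  obtain \<kappa> where \<kappa>: "0 < \<kappa>" "\<And>u. \<kappa> * (norm u)\<^sup>2 \<le> quad u" using quad_coercive by blast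
  obtain \<rho> where \<rho>: "0 < \<rho>" "\<And>b. \<bar>b - b0\<bar> < \<rho> \<Longrightarrow> b \<in> B" "\<And>\<phi>. norm (\<phi> - \<phi>0) < \<rho> \<Longrightarrow> \<phi> \<in> \<Gamma>"
    using feasible_ball by blast
  define K' where "K' = max K (c * K1)"
  have K': "0 < K'" "K \<le> K'" "c * K1 \<le> K'" using K by (auto simp: K'_def)
  \<comment> \<open>two errors of the quadratic approximation and the cost of the relevant penalties, each at most \<open>d'\<close>\<close>
  define d' where "d' = \<kappa> * d\<^sup>2 / 3"
  have d': "0 < d'" using \<kappa> d by (simp add: d'_def)
  have unif: "eventually_prob (e / 4) (\<lambda>n \<omega>. \<forall>u\<in>cball 0 K'. \<bar>Q.remainder n u \<omega> - quad u\<bar> \<le> d')"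
    by (rule Q.remainder_uniform) (use K' d' e in auto)
  have "(\<lambda>n. lam n / sqrt (real n) * (C * real CARD('p) * (2 * K'))) \<longlonglongrightarrow> 0 * (C * real CARD('p) * (2 * K'))"
    by (intro tendsto_mult lam_over_sqrt tendsto_const)
  then have small: "\<forall>\<^sub>F n in sequentially. lam n / sqrt (real n) * (C * real CARD('p) * (2 * K')) < d'"
    by (intro order_tendstoD) (use d' in auto)
  have near: "\<forall>\<^sub>F n in sequentially. K' / sqrt (real n) < \<rho>"
    by (rule order_tendstoD(2)[OF const_over_sqrt_tendsto_0 \<rho>(1)])
  have "filterlim (\<lambda>n. lam n * (sqrt (real n) / K0) powr g * real n powr (- 1 / 2)) at_top sequentially"
    by (rule irrelevant_weight_at_top[OF K0]) (use lam_lower in \<open>simp add: diff_divide_distrib\<close>)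
  then have pen: "\<forall>\<^sub>F n in sequentially. c * K1 < lam n * (sqrt (real n) / K0) powr g * real n powr (- 1 / 2)"
    by (simp add: filterlim_at_top_dense)
  have "eventually_prob (e / 4 + (e / 4 + (e / 4 + e / 4))) (\<lambda>n \<omega>. norm (u_star n \<omega> - oracle_fit \<iota> n \<omega>) \<le> d)"
  proof (rule eventually_prob_elim[OF
        eventually_prob_conj[OF score eventually_prob_conj[OF wc eventually_prob_conj[OF star unif]]]
        eventually_conj[OF small eventually_conj[OF near eventually_conj[OF pen eventually_ge_at_top[of 1]]]]], elim conjE)
    fix n \<omega>
    assume sm: "lam n / sqrt (real n) * (C * real CARD('p) * (2 * K')) < d'"
      and near: "K' / sqrt (real n) < \<rho>"
      and pen: "c * K1 < lam n * (sqrt (real n) / K0) powr g * real n powr (- 1 / 2)"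
      and n: "1 \<le> n" and \<omega>: "\<omega> \<in> space M" and W: "norm (Q.score n \<omega>) \<le> K1"
      and w: "weights_controlled K0 C n \<omega>" and s: "norm (u_star n \<omega>) \<le> K"
      and H: "\<forall>u\<in>cball 0 K'. \<bar>Q.remainder n u \<omega> - quad u\<bar> \<le> d'"
    let ?W = "Q.score n \<omega>" and ?u = "u_star n \<omega>" and ?o = "oracle_fit \<iota> n \<omega>"
    let ?m = "(sqrt (real n) / K0) powr g" and ?k = "sqrt (real n)"
    let ?d = "f b0 *\<^sub>R (\<Upsilon> *v snd ?o) - snd ?W"
    define S where "S = (\<Sum>j\<in>-active. \<bar>snd ?u $ j\<bar>)"
    have S0: "0 \<le> S" by (simp add: S_def sum_nonneg)
    have k: "0 < ?k" using n by simp
    have m: "0 < ?m" using n K0 by simp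
    have lam: "0 < lam n" by (rule lam_pos[OF n])
    have cW: "c * norm ?W \<le> c * K1" using W c(1) by (intro mult_left_mono) auto
    have oK: "norm ?o \<le> K'" using c(2)[of n \<omega>] cW K'(3) by linarith
    have uK: "norm ?u \<le> K'" using s K' by linarith
    \<comment> \<open>this fit, transported back to the parameter space, is a feasible competitor\<close>
    define b' \<phi>' where "b' = b0 + fst ?o / ?k" and "\<phi>' = \<phi>0 + (1 / ?k) *\<^sub>R snd ?o"
    have o': "rescale n (b', \<phi>') = ?o" using k by (simp add: rescale_def b'_def \<phi>'_def)
    have "\<bar>b' - b0\<bar> \<le> norm ?o / ?k"
      using norm_fst_le[of "fst ?o" "snd ?o"] k by (simp add: b'_def divide_right_mono)
    then have "\<bar>b' - b0\<bar> < \<rho>" using divide_right_mono[OF oK, of ?k] near k by linarith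
    moreover have "norm (\<phi>' - \<phi>0) \<le> norm ?o / ?k" using rescale_snd[OF n, of \<phi>' b'] by (simp add: o')
    then have "norm (\<phi>' - \<phi>0) < \<rho>" using divide_right_mono[OF oK, of ?k] near k by linarith
    ultimately have feas: "(b', \<phi>') \<in> B \<times> \<Gamma>" using \<rho> by simp
    have cmp: "loss n \<omega> (b_star n \<omega>, \<phi>_star n \<omega>) + lam n * ?m * (\<Sum>j\<in>-active. \<bar>\<phi>_star n \<omega> $ j\<bar>)
        \<le> loss n \<omega> (b', \<phi>') + lam n * C * (\<Sum>j\<in>active. \<bar>\<phi>_star n \<omega> $ j - \<phi>' $ j\<bar>)"
      by (rule penalized_comparison[OF n \<omega> K0 w feas])
        (use oracle_irrelevant in \<open>simp add: \<phi>'_def support_set_def\<close>)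
    have "\<bar>snd ?u $ j\<bar> = ?k * \<bar>\<phi>_star n \<omega> $ j\<bar>" if "j \<notin> active" for j
      using that k by (simp add: rescale_def support_set_def abs_mult)
    then have S_eq: "S = ?k * (\<Sum>j\<in>-active. \<bar>\<phi>_star n \<omega> $ j\<bar>)"
      by (simp add: S_def sum_distrib_left)
    have gain: "c * K1 * S \<le> lam n * ?m * (\<Sum>j\<in>-active. \<bar>\<phi>_star n \<omega> $ j\<bar>)"
    proof -
      have "c * K1 * S \<le> lam n * ?m * real n powr (- 1 / 2) * S" using pen S0 by (intro mult_right_mono) auto
      also have "\<dots> = lam n * ?m * (\<Sum>j\<in>-active. \<bar>\<phi>_star n \<omega> $ j\<bar>)"
        using k by (simp add: S_eq powr_minus_divide powr_half_sqrt)
      finally show ?thesis .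
    qed
    have cost: "lam n * C * (\<Sum>j\<in>active. \<bar>\<phi>_star n \<omega> $ j - \<phi>' $ j\<bar>) \<le> d'"
    proof -
      have "\<phi>_star n \<omega> - \<phi>' = (1 / ?k) *\<^sub>R snd (?u - rescale n (b', \<phi>'))"
        using k by (simp add: rescale_def scaleR_diff_right)
      then have "norm (\<phi>_star n \<omega> - \<phi>') = norm (snd (?u - ?o)) / ?k" unfolding o' using k by simp
      also have "\<dots> \<le> (2 * K') / ?k"
      proof (rule divide_right_mono)
        have "norm (snd (?u - ?o)) \<le> norm (?u - ?o)"
          using norm_snd_le[of "snd (?u - ?o)" "fst (?u - ?o)"] unfolding prod.collapse .
        also have "\<dots> \<le> norm ?u + norm ?o" by (rule norm_triangle_ineq4)
        finally show "norm (snd (?u - ?o)) \<le> 2 * K'" using uK oK by linarith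
      qed (use k in simp)
      finally have "real CARD('p) * norm (\<phi>_star n \<omega> - \<phi>') \<le> real CARD('p) * ((2 * K') / ?k)"
        by (intro mult_left_mono) auto
      then have "(\<Sum>j\<in>active. \<bar>\<phi>_star n \<omega> $ j - \<phi>' $ j\<bar>) \<le> real CARD('p) * ((2 * K') / ?k)"
        using sum_abs_le_norm[of "\<phi>_star n \<omega> - \<phi>'" active] by simp
      then have "lam n * C * (\<Sum>j\<in>active. \<bar>\<phi>_star n \<omega> $ j - \<phi>' $ j\<bar>) \<le> lam n * C * (real CARD('p) * ((2 * K') / ?k))"
        using lam C by (intro mult_left_mono) auto
      also have "\<dots> = lam n / ?k * (C * real CARD('p) * (2 * K'))" by simp
      finally show ?thesis using sm by linarith
    qed
    have "local_objective n \<omega> ?u + c * K1 * S \<le> local_objective n \<omega> ?o + d'"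
      using cmp gain cost loss_diff[OF n \<omega>, of "(b_star n \<omega>, \<phi>_star n \<omega>)"] loss_diff[OF n \<omega>, of "(b', \<phi>')"]
      unfolding o' by linarith
    moreover have "\<bar>Q.remainder n ?u \<omega> - quad ?u\<bar> \<le> d'" "\<bar>Q.remainder n ?o \<omega> - quad ?o\<bar> \<le> d'"
      using H uK oK by auto
    ultimately have obj: "quad ?u - ?W \<bullet> ?u - (quad ?o - ?W \<bullet> ?o) + c * K1 * S \<le> 3 * d'"
      unfolding local_objective_def by linarith
    have "- (?d \<bullet> (snd ?u - snd ?o)) \<le> c * K1 * S"
    proof -
      have eq: "?d \<bullet> (snd ?u - snd ?o) = (\<Sum>j\<in>-active. ?d $ j * (snd ?u - snd ?o) $ j)"
        unfolding inner_vec_def inner_real_def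
        by (rule sum.mono_neutral_right) (use oracle_stationary in auto)
      have "- (?d \<bullet> (snd ?u - snd ?o)) \<le> \<bar>\<Sum>j\<in>-active. ?d $ j * (snd ?u - snd ?o) $ j\<bar>"
        unfolding eq by simp
      also have "\<dots> \<le> (\<Sum>j\<in>-active. \<bar>?d $ j * (snd ?u - snd ?o) $ j\<bar>)" by (rule sum_abs)
      also have "\<dots> \<le> (\<Sum>j\<in>-active. c * K1 * \<bar>snd ?u $ j\<bar>)"
      proof (rule sum_mono)
        fix j assume j: "j \<in> - active"
        have "\<bar>?d $ j\<bar> \<le> c * K1"
          using component_le_norm_cart[of ?d j] c(3)[of n \<omega>] cW by linarith
        then show "\<bar>?d $ j * (snd ?u - snd ?o) $ j\<bar> \<le> c * K1 * \<bar>snd ?u $ j\<bar>"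
          using j oracle_irrelevant[of j n \<omega>] unfolding abs_mult by (intro mult_mono) auto
      qed
      also have "\<dots> = c * K1 * S" by (simp add: S_def sum_distrib_left)
      finally show ?thesis .
    qed
    moreover have "f b0 * fst ?o - fst ?W = 0" using f_pos by (simp add: oracle_fit_def)
    ultimately have "quad (?u - ?o) \<le> 3 * d'"
      using obj quad_translate[of ?u ?W ?o] by simp
    then have "\<kappa> * (norm (?u - ?o))\<^sup>2 \<le> \<kappa> * d\<^sup>2" using \<kappa>(2)[of "?u - ?o"] by (simp add: d'_def)
    then have "(norm (?u - ?o))\<^sup>2 \<le> d\<^sup>2" using \<kappa>(1) by simp
    then show "norm (?u - ?o) \<le> d" by (rule power2_le_imp_le) (use d in simp)
  qed
  then show ?thesis by simp
qed

text \<open>Each projection of the fit is a weighted sum of the i.i.d. scores, whose squared weights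
  add up, in the limit, to the quadratic form of the inverse submatrix divided by \<open>(f b0)\<^sup>2\<close>.\<close>
lemma oracle_char_tendsto:
  defines "R \<equiv> matrix_inv (principal_submatrix \<iota> \<Upsilon>)"
  shows "(\<lambda>n. CLINT \<omega>|M. iexp (t \<bullet> subvector \<iota> (snd (oracle_fit \<iota> n \<omega>))))
    \<longlonglongrightarrow> exp (- (\<tau> * (1 - \<tau>) / (f b0)\<^sup>2 * (t \<bullet> (R *v t))) / 2)"
proof -
  let ?Q = "principal_submatrix \<iota> \<Upsilon>"
  have pd: "positive_definite ?Q" by (rule positive_definite_principal_submatrix[OF inj_index Upsilon_pd])
  note RQ = positive_definite_inverse[OF pd, folded R_def]
  have symR: "x \<bullet> (R *v y) = (R *v x) \<bullet> y" for x y
  proof -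
    have "x \<bullet> (R *v y) = (?Q *v (R *v x)) \<bullet> (R *v y)" by (simp add: matrix_vector_mul_assoc RQ)
    also have "\<dots> = (R *v x) \<bullet> (?Q *v (R *v y))"
      using positive_definite_symmetric[OF pd, of "R *v y" "R *v x"] by (simp add: inner_commute)
    finally show ?thesis by (simp add: matrix_vector_mul_assoc RQ)
  qed
  define v where "v = (1 / f b0) *\<^sub>R (R *v t)"
  define u :: "real \<times> (real^'p)" where "u = (0, embed_vector \<iota> v)"
  define a where "a n i = (1, X i) \<bullet> u / sqrt (real n)" for n i
  have lin: "t \<bullet> subvector \<iota> (snd (oracle_fit \<iota> n \<omega>)) = (\<Sum>i=1..n. a n i * check_score \<tau> (\<epsilon> i \<omega> - b0))" for n \<omega>
  proof -
    have "t \<bullet> subvector \<iota> (snd (oracle_fit \<iota> n \<omega>)) = v \<bullet> subvector \<iota> (snd (Q.score n \<omega>))"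
      by (simp add: oracle_fit_def subvector_embed_vector[OF inj_index] v_def symR R_def[symmetric])
    also have "\<dots> = Q.score n \<omega> \<bullet> u"
      by (simp add: u_def inner_prod_def inner_commute[of _ "embed_vector \<iota> v"] inner_embed_vector[OF inj_index])
    finally show ?thesis by (simp add: Q.score_inner a_def)
  qed
  have "(\<lambda>n. (\<Sum>i=1..n. (a n i)\<^sup>2)) \<longlonglongrightarrow> (t \<bullet> (R *v t)) / (f b0)\<^sup>2"
  proof -
    have "(\<Sum>i=1..n. (a n i)\<^sup>2) = (\<Sum>i=1..n. (X i \<bullet> embed_vector \<iota> v)\<^sup>2) / real n" for n
      by (simp add: a_def u_def inner_prod_def power_divide sum_divide_distrib)
    moreover have "embed_vector \<iota> v \<bullet> (\<Upsilon> *v embed_vector \<iota> v) = (t \<bullet> (R *v t)) / (f b0)\<^sup>2"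
    proof -
      have "embed_vector \<iota> v \<bullet> (\<Upsilon> *v embed_vector \<iota> v) = v \<bullet> (?Q *v v)"
        by (simp add: inner_embed_vector[OF inj_index] principal_submatrix_vector_mult[OF inj_index])
      also have "?Q *v v = (1 / f b0) *\<^sub>R t"
        by (simp add: v_def matrix_vector_mult_scaleR matrix_vector_mul_assoc RQ)
      finally show ?thesis by (simp add: v_def symR power2_eq_square)
    qed
    ultimately show ?thesis using design_assumption_quadratic[OF A1, of "embed_vector \<iota> v"] by simp
  qed
  moreover have "\<forall>\<^sub>F n in sequentially. \<forall>i\<in>{1..n}. \<bar>a n i\<bar> \<le> c" if "0 < c" for c
  proof -
    have "0 < c / (norm u + 1)" using that by (simp add: add_nonneg_pos)
    from design_assumption_max[OF A1 this] show ?thesis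
    proof eventually_elim
      case (elim n)
      then show ?case unfolding a_def by (intro ballI scaled_inner_le[OF that]) blast
    qed
  qed
  ultimately have "(\<lambda>n. CLINT \<omega>|M. iexp (\<Sum>i=1..n. a n i * check_score \<tau> (\<epsilon> i \<omega> - b0)))
      \<longlonglongrightarrow> exp (- (\<tau> * (1 - \<tau>) * ((t \<bullet> (R *v t)) / (f b0)\<^sup>2)) / 2)"
    using indep_vars_compose2[OF indep, of "\<lambda>_ x. check_score \<tau> (x - b0)" "\<lambda>_. borel"]
    by (intro weighted_sum_char_tendsto)
      (auto intro!: Q.check_score_bound expectation_check_score expectation_check_score_square)
  then show ?thesis unfolding lin by (simp add: mult_ac)
qed

text \<open>The difference to the fit is negligible, so both have the same limit of characteristic functions.\<close>
lemma oracle_asymptotics: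
  "converges_in_distribution M
     (\<lambda>n \<omega>. sqrt (real n) *\<^sub>R (subvector \<iota> (\<phi>_star n \<omega>) - subvector \<iota> \<phi>0))
     (multivariate_normal 0 ((\<tau> * (1 - \<tau>) / (f b0)\<^sup>2) *\<^sub>R matrix_inv (principal_submatrix \<iota> \<Upsilon>)))"
proof -
  let ?Q = "principal_submatrix \<iota> \<Upsilon>" and ?c = "\<tau> * (1 - \<tau>) / (f b0)\<^sup>2"
  let ?Z = "\<lambda>n \<omega>. sqrt (real n) *\<^sub>R (subvector \<iota> (\<phi>_star n \<omega>) - subvector \<iota> \<phi>0)"
  have pd: "positive_definite ?Q" by (rule positive_definite_principal_submatrix[OF inj_index Upsilon_pd])
  have c: "0 < ?c" using tau f_pos by simp
  note N = multivariate_normal_inverse[OF pd c]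
  have sub_cont: "continuous_on UNIV (subvector \<iota> :: real^'p \<Rightarrow> real^'a)"
    unfolding subvector_def by (intro continuous_intros)
  have sub_m[measurable]: "(subvector \<iota> :: real^'p \<Rightarrow> real^'a) \<in> borel_measurable borel"
    by (rule borel_measurable_continuous_onI[OF sub_cont])
  have Zm: "?Z n \<in> borel_measurable M" for n
  proof (cases "n = 0")
    case False
    then have [measurable]: "\<phi>_star n \<in> borel_measurable M" using meas_star by simp
    show ?thesis by measurable
  qed simp
  have Z_eq: "?Z n \<omega> = subvector \<iota> (snd (u_star n \<omega>))" for n \<omega>
    by (simp add: rescale_def subvector_def vec_eq_iff)
  have om: "random_variable borel (\<lambda>\<omega>. t \<bullet> subvector \<iota> (snd (oracle_fit \<iota> n \<omega>)))" for t n
  proof -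
    have "continuous_on UNIV (\<lambda>W::real \<times> (real^'p). t \<bullet> ((1 / f b0) *\<^sub>R (matrix_inv ?Q *v subvector \<iota> (snd W))))"
      by (intro continuous_intros continuous_on_compose2[OF sub_cont]
          continuous_on_compose2[OF linear_continuous_on[OF matrix_vector_mul_bounded_linear]]) auto
    from measurable_compose[OF Q.score_measurable borel_measurable_continuous_onI[OF this]]
    show ?thesis by (simp add: oracle_fit_def subvector_embed_vector[OF inj_index])
  qed
  show ?thesis
  proof (rule levy_continuity_euclidean[OF prob_space_axioms Zm N(1,2)])
    fix t :: "real^'a"
    show "(\<lambda>n. CLINT \<omega>|M. iexp (t \<bullet> ?Z n \<omega>)) \<longlonglongrightarrow> (CLINT x|multivariate_normal 0 (?c *\<^sub>R matrix_inv ?Q). iexp (t \<bullet> x))"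
      unfolding N(3)
    proof (rule cf_tendsto_perturb[OF _ om _ oracle_char_tendsto])
      show "random_variable borel (\<lambda>\<omega>. t \<bullet> ?Z n \<omega>)" for n using Zm[of n] by (intro borel_measurable_inner) auto
      fix d e :: real assume d: "0 < d" and e: "0 < e"
      have "eventually_prob e (\<lambda>n \<omega>. norm (u_star n \<omega> - oracle_fit \<iota> n \<omega>) \<le> d / (norm t + 1))"
        by (rule star_near_oracle_fit[OF _ e]) (use d in \<open>simp add: add_nonneg_pos\<close>)
      then show "eventually_prob e (\<lambda>n \<omega>. \<bar>t \<bullet> ?Z n \<omega> - t \<bullet> subvector \<iota> (snd (oracle_fit \<iota> n \<omega>))\<bar> \<le> d)"
      proof (rule eventually_prob_mono[OF _ always_eventually], intro allI ballI impI)
        fix n \<omega>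
        let ?v = "u_star n \<omega> - oracle_fit \<iota> n \<omega>"
        assume le: "norm ?v \<le> d / (norm t + 1)"
        have "t \<bullet> ?Z n \<omega> - t \<bullet> subvector \<iota> (snd (oracle_fit \<iota> n \<omega>)) = t \<bullet> subvector \<iota> (snd ?v)"
          unfolding Z_eq by (simp add: subvector_def inner_vec_def sum_subtractf[symmetric] algebra_simps)
        then have "\<bar>t \<bullet> ?Z n \<omega> - t \<bullet> subvector \<iota> (snd (oracle_fit \<iota> n \<omega>))\<bar> \<le> norm t * norm (subvector \<iota> (snd ?v))"
          using Cauchy_Schwarz_ineq2 by metis
        also have "\<dots> \<le> norm t * norm ?v"
          using norm_snd_le[of "snd ?v" "fst ?v"] unfolding prod.collapse
          by (intro mult_left_mono order_trans[OF norm_subvector_le[OF inj_index]]) auto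
        also have "\<dots> \<le> norm t * (d / (norm t + 1))" using le by (intro mult_left_mono) auto
        also have "\<dots> = d * (norm t / (norm t + 1))" by simp
        also have "\<dots> \<le> d" using d by (intro mult_left_le) (auto simp: divide_le_eq_1 add_nonneg_pos)
        finally show "\<bar>t \<bullet> ?Z n \<omega> - t \<bullet> subvector \<iota> (snd (oracle_fit \<iota> n \<omega>))\<bar> \<le> d" .
      qed
    qed
  qed
qed

end

lemma selection_probability:
  assumes "filterlim (\<lambda>n. real n powr (g / 2 - 1) * lam n) at_top sequentially"
  shows "(\<lambda>n. prob {\<omega>\<in>space M. support_set (\<phi>_star n \<omega>) = active}) \<longlonglongrightarrow> 1"
proof (rule eventually_prob_imp_tendsto_1[OF selection_consistency[OF assms]])
  show "\<forall>\<^sub>F n in sequentially. {\<omega>\<in>space M. support_set (\<phi>_star n \<omega>) = active} \<in> events"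
    using eventually_ge_at_top[of 1]
  proof eventually_elim
    case (elim n)
    have comp: "(\<lambda>\<omega>. \<phi>_star n \<omega> $ j) \<in> borel_measurable M" for j
      using meas_star[OF elim] by (rule measurable_compose) (intro borel_measurable_continuous_onI continuous_intros)
    have "{\<omega>\<in>space M. support_set (\<phi>_star n \<omega>) = active}
        = {\<omega>\<in>space M. \<forall>j\<in>UNIV. (\<phi>_star n \<omega> $ j \<noteq> 0) = (j \<in> active)}"
      by (auto simp: support_set_def)
    also have "\<dots> \<in> events"
      using comp by measurable
    finally show ?case .
  qed
qed

end

section \<open>Asymptotic normality and selection consistency\<close>

theorem theorem2p3:
  fixes M :: "'w measure"
    and X :: "nat \<Rightarrow> real ^ 'p::finite"
    and Y \<epsilon> :: "nat \<Rightarrow> 'w \<Rightarrow> real"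
    and D :: "real measure"
    and F f :: "real \<Rightarrow> real"
    and B :: "real set" and \<Gamma> :: "(real ^ 'p) set"
    and b0 :: real and \<phi>0 :: "real ^ 'p"
    and \<Upsilon> :: "real ^ 'p ^ 'p"
    and \<tau> g :: real and lam :: "nat \<Rightarrow> real"
    and b_hat b_star :: "nat \<Rightarrow> 'w \<Rightarrow> real"
    and \<phi>_hat \<phi>_star :: "nat \<Rightarrow> 'w \<Rightarrow> real ^ 'p"
  assumes "prob_space M"
    and tau: "0 < \<tau>" "\<tau> < 1"
    and model: "\<And>i \<omega>. 1 \<le> i \<Longrightarrow> \<omega> \<in> space M \<Longrightarrow> Y i \<omega> = X i \<bullet> \<phi>0 + \<epsilon> i \<omega>"
    and indep: "prob_space.indep_vars M (\<lambda>_. borel) \<epsilon> {1..}"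
    and ident: "\<And>i. 1 \<le> i \<Longrightarrow> distr M borel (\<epsilon> i) = D"
    and F: "F = cdf D"
    and quantile: "F b0 = \<tau>"
    and dens: "continuous_positive_density_near D f b0"
    and "compact B" "compact \<Gamma>"
    and "b0 \<in> interior B" "\<phi>0 \<in> interior \<Gamma>"
    and A1: "design_assumption X \<Upsilon>"
    and A2: "smoothness_assumption X \<Upsilon> F f B"
    and g: "0 < g"
    and lam_pos: "\<And>n. 1 \<le> n \<Longrightarrow> 0 < lam n"
    and lam_at_top: "filterlim lam at_top sequentially"
    and lam_upper: "(\<lambda>n. real n powr (- 1 / 2) * lam n) \<longlonglongrightarrow> 0"
    and lam_lower: "filterlim (\<lambda>n. real n powr ((g - 1) / 2) * lam n) at_top sequentially"
    and meas_hat: "\<And>n. 1 \<le> n \<Longrightarrow> b_hat n \<in> borel_measurable M"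
      "\<And>n. 1 \<le> n \<Longrightarrow> \<phi>_hat n \<in> borel_measurable M"
    and argmin_hat: "\<And>n \<omega>. 1 \<le> n \<Longrightarrow> \<omega> \<in> space M \<Longrightarrow>
      is_arg_min (quantile_objective \<tau> X (\<lambda>i. Y i \<omega>) n)
        (\<lambda>\<theta>. \<theta> \<in> B \<times> \<Gamma>) (b_hat n \<omega>, \<phi>_hat n \<omega>)"
    and meas_star: "\<And>n. 1 \<le> n \<Longrightarrow> b_star n \<in> borel_measurable M"
      "\<And>n. 1 \<le> n \<Longrightarrow> \<phi>_star n \<in> borel_measurable M"
    and argmin_star: "\<And>n \<omega>. 1 \<le> n \<Longrightarrow> \<omega> \<in> space M \<Longrightarrow>
      is_arg_min (adaptive_lasso_objective \<tau> g (lam n) X (\<lambda>i. Y i \<omega>) (\<phi>_hat n \<omega>) n)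
        (\<lambda>\<theta>. \<theta> \<in> B \<times> \<Gamma>) (b_star n \<omega>, \<phi>_star n \<omega>)"
  shows "(\<forall>\<iota> :: 'a::finite \<Rightarrow> 'p. bij_betw \<iota> UNIV (support_set \<phi>0) \<longrightarrow>
            converges_in_distribution M
              (\<lambda>n \<omega>. sqrt (real n) *\<^sub>R (subvector \<iota> (\<phi>_star n \<omega>) - subvector \<iota> \<phi>0))
              (multivariate_normal 0
                ((\<tau> * (1 - \<tau>) / (f b0)\<^sup>2) *\<^sub>R matrix_inv (principal_submatrix \<iota> \<Upsilon>))))
       \<and> (filterlim (\<lambda>n. real n powr (g / 2 - 1) * lam n) at_top sequentially \<longrightarrow>
            (\<lambda>n. measure M {\<omega> \<in> space M. support_set (\<phi>_star n \<omega>) = support_set \<phi>0})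
              \<longlonglongrightarrow> 1)"
proof -
  interpret prob_space M by fact
  interpret adaptive_lasso_quantile M X Y \<epsilon> D F f B \<Gamma> b0 \<phi>0 \<Upsilon> \<tau> g lam b_hat b_star \<phi>_hat \<phi>_star
    by (intro adaptive_lasso_quantile.intro adaptive_lasso_quantile_axioms.intro) (fact assms)+
  show ?thesis
    using oracle_asymptotics selection_probability by blast
qed

end
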